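(* Let $\mu=(\mu_1,\ldots,\mu_n)\in\mathbb{Z}_{\ge 0}^n$, and suppose $n=\sum_{i=1}^n i\mu_i$; set $k=\sum_{i=1}^n\mu_i$. Let $\mathcal{A}_\mu$ be the set of dissections of the polygon $P_{n+2}$ whose subgons consist of exactly $\mu_i$ subgons with $i+2$ vertices for each $1\le i\le n$ (such dissections use $k-1$ diagonals), let $G_{n+2}=\langle\sigma\rangle$ be the cyclic group of order $n+2$ acting on $\mathcal{A}_\mu$ by rotation, and let $$a_\mu(q)=\frac{1}{[n+1]_q}\begin{bmatrix} n+k\\ k\end{bmatrix}_q\begin{bmatrix} k\\ \mu_1,\mu_2,\ldots,\mu_n\end{bmatrix}_q .$$ Then the triple $(\mathcal{A}_\mu,G_{n+2},a_\mu(q))$ exhibits the cyclic sieving phenomenon.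
   Context: $P_N$ denotes a convex polygon with vertices $v_0,\ldots,v_{N-1}$ in clockwise order, indices taken modulo $N$. A dissection of $P_N$ is a set of pairwise non-crossing diagonals; its subgons are the connected components of $P_N$ minus the diagonals. The rotation $\sigma$ sends $v_i\mapsto v_{i-1}$ for all $i$, and acts on dissections by sending each diagonal $(v_i,v_j)$ to $(v_{i-1},v_{j-1})$. $q$-notation: $[a]_q=1+q+\cdots+q^{a-1}$, $[a]_q!=[1]_q\cdots[a]_q$, $\begin{bmatrix} a\\ b\end{bmatrix}_q=\frac{[a]_q!}{[b]_q![a-b]_q!}$, and $\begin{bmatrix} k\\ \mu_1,\ldots,\mu_n\end{bmatrix}_q=\frac{[k]_q!}{[\mu_1]_q!\cdots[\mu_n]_q!}$. A triple $(X,G,X(q))$ consisting of a finite set $X$ with an action of a cyclic group $G=\langle\sigma\rangle$ of order $N$ and a polynomial $X(q)\in\mathbb{Z}[q]$ exhibits the cyclic sieving phenomenon if for every integer $j$, $X(\zeta_N^j)$ equals the number of elements of $X$ fixed by $\sigma^j$, where $\zeta_N$ is a primitive $N$-th root of unity. *)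

theory Defs
  imports "HOL-Analysis.Analysis" "HOL-Computational_Algebra.Polynomial"
begin

section \<open>Polygon P_N: vertices 0..N-1 (clockwise), diagonals as 2-element vertex sets\<close>

definition side :: "nat \<Rightarrow> nat \<Rightarrow> nat \<Rightarrow> bool" where
  "side N x y \<longleftrightarrow> x < N \<and> y < N \<and> x \<noteq> y \<and> (y = Suc x mod N \<or> x = Suc y mod N)"

definition is_diagonal :: "nat \<Rightarrow> nat set \<Rightarrow> bool" where
  "is_diagonal N d \<longleftrightarrow> (\<exists>i j. d = {i, j} \<and> i < N \<and> j < N \<and> i \<noteq> j \<and> \<not> side N i j)"

definition crosses :: "nat set \<Rightarrow> nat set \<Rightarrow> bool" where
  "crosses d e \<longleftrightarrow>
     (\<exists>a b c c'. d = {a, b} \<and> e = {c, c'} \<and> a < c \<and> c < b \<and> b < c') \<or>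
     (\<exists>a b c c'. e = {a, b} \<and> d = {c, c'} \<and> a < c \<and> c < b \<and> b < c')"

definition dissection :: "nat \<Rightarrow> nat set set \<Rightarrow> bool" where
  "dissection N D \<longleftrightarrow> (\<forall>d\<in>D. is_diagonal N d) \<and> (\<forall>d\<in>D. \<forall>e\<in>D. \<not> crosses d e)"

definition cyc_consec :: "nat \<Rightarrow> nat set \<Rightarrow> nat \<Rightarrow> nat \<Rightarrow> bool" where
  "cyc_consec N S x y \<longleftrightarrow> x \<in> S \<and> y \<in> S \<and> x \<noteq> y \<and>
     (\<forall>z\<in>S. z \<noteq> x \<longrightarrow> (int y - int x) mod int N \<le> (int z - int x) mod int N)"

text \<open>Subgons (faces) of the dissection D, identified with their vertex sets: a convex
  subpolygon whose boundary edges are sides of P_N or diagonals in D, and which is not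
  cut by any diagonal of D.\<close>
definition subgon :: "nat \<Rightarrow> nat set set \<Rightarrow> nat set \<Rightarrow> bool" where
  "subgon N D S \<longleftrightarrow> S \<subseteq> {..<N} \<and> 3 \<le> card S \<and>
     (\<forall>x y. cyc_consec N S x y \<longrightarrow> side N x y \<or> {x, y} \<in> D) \<and>
     (\<forall>x\<in>S. \<forall>y\<in>S. {x, y} \<in> D \<longrightarrow> cyc_consec N S x y \<or> cyc_consec N S y x)"

definition subgons :: "nat \<Rightarrow> nat set set \<Rightarrow> nat set set" where
  "subgons N D = {S. subgon N D S}"

definition rot_vertex :: "nat \<Rightarrow> int \<Rightarrow> nat \<Rightarrow> nat" where
  "rot_vertex N j i = nat ((int i - j) mod int N)"

definition rot_dissection :: "nat \<Rightarrow> int \<Rightarrow> nat set set \<Rightarrow> nat set set" where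
  "rot_dissection N j D = (\<lambda>d. rot_vertex N j ` d) ` D"

definition A_mu :: "nat \<Rightarrow> (nat \<Rightarrow> nat) \<Rightarrow> nat set set set" where
  "A_mu n mu = {D. dissection (n + 2) D \<and>
      (\<forall>i\<in>{1..n}. card {S \<in> subgons (n + 2) D. card S = i + 2} = mu i)}"

definition qint :: "nat \<Rightarrow> int poly" where
  "qint a = (\<Sum>i<a. monom 1 i)"

definition qfact :: "nat \<Rightarrow> int poly" where
  "qfact a = (\<Prod>i\<in>{1..a}. qint i)"

definition qbinom :: "nat \<Rightarrow> nat \<Rightarrow> int poly" where
  "qbinom a b = qfact a div (qfact b * qfact (a - b))"

definition qmultinom :: "nat \<Rightarrow> nat \<Rightarrow> (nat \<Rightarrow> nat) \<Rightarrow> int poly" where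
  "qmultinom k n mu = qfact k div (\<Prod>i\<in>{1..n}. qfact (mu i))"

definition a_mu :: "nat \<Rightarrow> (nat \<Rightarrow> nat) \<Rightarrow> int poly" where
  "a_mu n mu = (let k = (\<Sum>i=1..n. mu i) in
      (qbinom (n + k) k * qmultinom k n mu) div qint (n + 1))"

definition cyclic_sieving :: "nat \<Rightarrow> nat set set set \<Rightarrow> int poly \<Rightarrow> bool" where
  "cyclic_sieving N X p \<longleftrightarrow>
     (\<forall>j::int. poly (map_poly of_int p) (cis (2 * pi / real N) powi j)
        = of_nat (card {D \<in> X. rot_dissection N j D = D}))"

end

theory Submission
  imports Defs
begin

text \<open>
  Both sides of the sieving identity at a root of unity of order d are computed in closed form.

  Counting: cut the polygon open and record a dissection as a non-crossing set of arcs on a line of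
  M + 1 points; a cell is then the set of points under its base arc not hidden by smaller arcs.
  Removing the first point, or else the longest arc at it, gives a recurrence of ballot type for the
  number of arc sets with prescribed cell sizes and c + 1 exposed points, with solution
  c (M + K - 1)! / (M! \<Prod> m_i!) for K arcs. The case c = 1 counts all dissections. A dissection
  invariant under a rotation of order d \<ge> 2 has a central cell or a central diagonal; if vertex 0 lies
  on it, the dissection is d copies of an arc set on one period M = (n + 2) / d, where the centre has
  c d vertices. Counting pairs (dissection, central vertex) in two ways gives
  (M + K - 1)! / ((M - 1)! \<Prod> (mu_i div d)!), with K the sum of the mu_i div d; such a dissection can
  exist only if the residues mu_i mod d have sum at most 1.

  Evaluation: a_mu is [n + k]! / ([n + 1]! \<Prod> [mu_i]!), and splitting the power of [d] off every
  q-factorial yields the same value, or 0 if the residues have sum at least 2.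
\<close>

section \<open>Non-crossing arc sets\<close>

text \<open>The parameter c is forced by the recurrence: deleting the longest arc at 0, whose cell
  has i + 2 vertices, turns a contour with c edges into one with c + i edges, so the case c = 1
  alone is not closed. The same parameter then serves the symmetric count, where the contour of one
  period, repeated d times around the polygon, bounds the centre. For a symmetric dissection the
  obstacle is that the place of the cut is not canonical: only at a central vertex do the diagonals
  respect the cuts at multiples of M. Counting pairs removes the choice, because every symmetric
  dissection of the given type has the same number d c of central vertices: \<open>mu\<close>
  determines c through d c = 2 + sum of i (mu_i mod d). The value d c = 2, possible only for d = 2,
  is the central diagonal, a centre that contributes no subgon.\<close>

definition arcset :: "nat \<Rightarrow> (nat \<times> nat) set \<Rightarrow> bool" where
  "arcset M E \<longleftrightarrow> (\<forall>a b. (a,b) \<in> E \<longrightarrow> a + 2 \<le> b \<and> b \<le> M) \<and>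
     (\<forall>a b c e. (a,b) \<in> E \<longrightarrow> (c,e) \<in> E \<longrightarrow> a < c \<longrightarrow> c < b \<longrightarrow> e \<le> b)"

text \<open>The exclusion of \<open>(a,b)\<close> itself makes this the polygon below the chord from
  a to b whether or not that chord belongs to \<open>E\<close>; it is also used for
  \<open>(0,M)\<close> when that arc is absent.\<close>

definition cellset :: "(nat \<times> nat) set \<Rightarrow> nat \<Rightarrow> nat \<Rightarrow> nat set" where
  "cellset E a b = {z \<in> {a..b}. \<forall>(x,y)\<in>E. (x,y) \<noteq> (a,b) \<longrightarrow> a \<le> x \<longrightarrow> y \<le> b \<longrightarrow> \<not> (x < z \<and> z < y)}"

text \<open>The contour of \<open>E\<close> seen from above: neighbouring points are joined by an
  outermost arc or a unit step, and there is one contour edge fewer than there are points.\<close>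

definition exposed :: "(nat \<times> nat) set \<Rightarrow> nat \<Rightarrow> nat set" where
  "exposed E M = {z \<in> {..M}. \<forall>(x,y)\<in>E. \<not> (x < z \<and> z < y)}"

text \<open>Type i is the number of triangles in a triangulation of the cell, which makes types
  additive over cells.\<close>

definition arcs_of_type :: "(nat \<times> nat) set \<Rightarrow> nat \<Rightarrow> (nat \<times> nat) set" where
  "arcs_of_type E i = {(a,b) \<in> E. card (cellset E a b) = i + 2}"

definition arcsets_of_type :: "nat \<Rightarrow> nat \<Rightarrow> (nat \<Rightarrow> nat) \<Rightarrow> (nat \<times> nat) set set" where
  "arcsets_of_type c M m =
     {E. arcset M E \<and> card (exposed E M) = c + 1 \<and> (\<forall>i. card (arcs_of_type E i) = m i)}"

lemma arcset_bounds: "arcset M E \<Longrightarrow> (a,b) \<in> E \<Longrightarrow> a + 2 \<le> b \<and> b \<le> M"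
  unfolding arcset_def by blast

lemma arcset_noncrossing:
  "arcset M E \<Longrightarrow> (a,b) \<in> E \<Longrightarrow> (c,e) \<in> E \<Longrightarrow> a < c \<Longrightarrow> c < b \<Longrightarrow> e \<le> b"
  unfolding arcset_def by blast

lemma finite_arcset: "arcset M E \<Longrightarrow> finite E"
  by (rule finite_subset[of _ "{..M} \<times> {..M}"]) (auto dest: arcset_bounds)

lemma arcset_mono: "arcset M E \<Longrightarrow> F \<subseteq> E \<Longrightarrow> arcset M F"
  unfolding arcset_def by blast

lemma finite_cellset [simp]: "finite (cellset E a b)"
  by (simp add: cellset_def)

lemma finite_exposed [simp]: "finite (exposed E M)"
  by (simp add: exposed_def)

lemma finite_arcs_of_type: "arcset M E \<Longrightarrow> finite (arcs_of_type E i)"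
  using finite_arcset[of M E] by (rule rev_finite_subset) (auto simp: arcs_of_type_def)

lemma finite_arcsets_of_type: "finite (arcsets_of_type c M m)"
  by (rule finite_subset[of _ "Pow ({..M} \<times> {..M})"])
     (auto simp: arcsets_of_type_def dest: arcset_bounds)

text \<open>If x + 1 is hidden from the cell, some arc inside the cell starts at x. The longest of
  these ends at a point of the cell: an arc hiding that end would either hide x as well or be a
  longer arc at x. So its end is y.\<close>

lemma cellset_consecutive:
  assumes E: "arcset M E" and ab: "b \<le> M"
    and x: "x \<in> cellset E a b" and y: "y \<in> cellset E a b" and xy: "x < y"
    and none: "\<And>z. z \<in> cellset E a b \<Longrightarrow> x < z \<Longrightarrow> \<not> z < y"
  shows "y = Suc x \<or> (x,y) \<in> E \<and> (x,y) \<noteq> (a,b)"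
proof (rule ccontr)
  assume neg: "\<not> ?thesis"
  hence lt: "Suc x < y" using xy by simp
  have xb: "a \<le> x" "y \<le> b" using x y by (auto simp: cellset_def)
  have "Suc x \<notin> cellset E a b" using none lt by blast
  then obtain p q where pq: "(p,q) \<in> E" "(p,q) \<noteq> (a,b)" "a \<le> p" "q \<le> b" "p < Suc x" "Suc x < q"
    using lt xb by (auto simp: cellset_def)
  have "p = x"
  proof (rule ccontr)
    assume "p \<noteq> x"
    hence "p < x" using pq by simp
    with x pq show False by (auto simp: cellset_def)
  qed
  define Q where "Q = {q. (x,q) \<in> E \<and> (x,q) \<noteq> (a,b) \<and> q \<le> b}"
  have fQ: "finite Q" unfolding Q_def by (rule finite_subset[of _ "{..b}"]) auto
  have "q \<in> Q" using pq \<open>p = x\<close> by (auto simp: Q_def)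
  hence mQ: "Max Q \<in> Q" "q \<le> Max Q" using fQ by (auto intro!: Max_in)
  define r where "r = Max Q"
  have r: "(x,r) \<in> E" "(x,r) \<noteq> (a,b)" "r \<le> b" "Suc x < r" using mQ pq by (auto simp: Q_def r_def)
  have "r \<in> cellset E a b"
  proof (rule ccontr)
    assume "r \<notin> cellset E a b"
    then obtain u w where uw: "(u,w) \<in> E" "(u,w) \<noteq> (a,b)" "a \<le> u" "w \<le> b" "u < r" "r < w"
      using r xb by (auto simp: cellset_def)
    have "u \<le> x" using arcset_noncrossing[OF E r(1) uw(1)] uw r by force
    moreover have "\<not> u < x" using x uw r by (auto simp: cellset_def)
    ultimately have "u = x" by simp
    hence "w \<in> Q" using uw by (auto simp: Q_def)
    hence "w \<le> r" using fQ by (simp add: r_def)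
    thus False using uw by simp
  qed
  hence "y \<le> r" using none r by (meson Suc_lessD not_less)
  moreover have "\<not> y < r" using y r xb xy by (auto simp: cellset_def)
  ultimately show False using r neg by simp
qed

lemma endpoints_in_cellset: "a \<le> b \<Longrightarrow> a \<in> cellset E a b \<and> b \<in> cellset E a b"
  by (auto simp: cellset_def)

text \<open>Were a and b alone in the cell, they would be consecutive in it, and the arc joining
  them would have to differ from \<open>(a,b)\<close>.\<close>

lemma card_cellset_ge_3:
  assumes E: "arcset M E" and ab: "a + 2 \<le> b" "b \<le> M"
  shows "3 \<le> card (cellset E a b)"
proof (rule ccontr)
  assume neg: "\<not> ?thesis"
  have sub: "{a,b} \<subseteq> cellset E a b" using endpoints_in_cellset[of a b E] ab by auto
  have c2: "card {a,b} = 2" using ab by simp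
  have "cellset E a b = {a,b}"
    using card_subset_eq[of "cellset E a b" "{a,b}"] sub neg c2 card_mono[OF _ sub] by force
  hence "b = Suc a \<or> (a,b) \<in> E \<and> (a,b) \<noteq> (a,b)"
    using ab by (intro cellset_consecutive[OF E ab(2)]) auto
  thus False using ab by simp
qed

text \<open>Without the arc \<open>(0,M)\<close> the exposed points are the cell below that chord,
  hence at least three. This translates c = 1 into the presence of a root arc.\<close>

lemma exposed_eq_endpoints_iff:
  assumes E: "arcset M E" and M: "2 \<le> M"
  shows "card (exposed E M) = 2 \<longleftrightarrow> (0,M) \<in> E"
proof
  assume "(0,M) \<in> E"
  hence "exposed E M = {0,M}" using M arcset_bounds[OF E] 
    by (force simp: exposed_def)
  thus "card (exposed E M) = 2" using M by simp
next
  assume c: "card (exposed E M) = 2"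
  show "(0,M) \<in> E"
  proof (rule ccontr)
    assume "(0,M) \<notin> E"
    hence "exposed E M = cellset E 0 M"
      using arcset_bounds[OF E] by (fastforce simp: exposed_def cellset_def)
    thus False using card_cellset_ge_3[OF E, of 0 M] c M by simp
  qed
qed

lemma exposed_endpoints: "arcset M E \<Longrightarrow> 0 \<in> exposed E M \<and> M \<in> exposed E M"
  by (auto simp: exposed_def dest: arcset_bounds)

text \<open>Deleting an outermost arc replaces one contour edge by the remaining sides of its cell;
  the 2 in the count stands for the shared endpoints. Other cells are unaffected, since the arc lies
  below no other arc.\<close>

lemma remove_outermost:
  assumes E: "arcset M E" and ab: "(a,b) \<in> E"
    and outer: "\<And>x y. (x,y) \<in> E \<Longrightarrow> x \<le> a \<Longrightarrow> b \<le> y \<Longrightarrow> (x,y) = (a,b)"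
  shows "\<And>x y. (x,y) \<in> E \<Longrightarrow> (x,y) \<noteq> (a,b) \<Longrightarrow> cellset (E - {(a,b)}) x y = cellset E x y"
    and "exposed (E - {(a,b)}) M = exposed E M \<union> cellset E a b"
    and "exposed E M \<inter> cellset E a b = {a,b}"
    and "card (exposed (E - {(a,b)}) M) + 2 = card (exposed E M) + card (cellset E a b)"
proof -
  show "cellset (E - {(a,b)}) x y = cellset E x y" if "(x,y) \<in> E" "(x,y) \<noteq> (a,b)" for x y
    using outer[OF that(1)] that(2) unfolding cellset_def by fast
  have abM: "a + 2 \<le> b" "b \<le> M" using arcset_bounds[OF E ab] by auto
  have cov: "a \<le> x \<and> y \<le> b \<or> y \<le> a \<or> b \<le> x" if xy: "(x,y) \<in> E" for x y
  proof (rule ccontr)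
    assume n: "\<not> ?thesis"
    have b1: "x + 2 \<le> y" using arcset_bounds[OF E xy] by simp
    consider "x < a" | "a \<le> x" "b < y" using n by linarith
    thus False
    proof cases
      case 1
      hence "b \<le> y" using arcset_noncrossing[OF E xy ab] n by simp
      thus False using outer[OF xy] 1 by simp
    next
      case 2
      show False
      proof (cases "x = a")
        case True thus False using outer[OF xy] 2 by simp
      next
        case False
        thus False using arcset_noncrossing[OF E ab xy] n 2 by simp
      qed
    qed
  qed
  have in_iff: "z \<in> exposed (E - {(a,b)}) M \<longleftrightarrow> z \<in> exposed E M \<union> cellset E a b" for z
  proof
    assume z: "z \<in> exposed (E - {(a,b)}) M"
    show "z \<in> exposed E M \<union> cellset E a b"
    proof (cases "a < z \<and> z < b")
      case True
      thus ?thesis using z by (auto simp: exposed_def cellset_def)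
    next
      case False
      thus ?thesis using z by (auto simp: exposed_def)
    qed
  next
    assume z: "z \<in> exposed E M \<union> cellset E a b"
    show "z \<in> exposed (E - {(a,b)}) M"
    proof (cases "z \<in> exposed E M")
      case True thus ?thesis by (auto simp: exposed_def)
    next
      case False
      hence zc: "z \<in> cellset E a b" using z by simp
      have "\<not> (x < z \<and> z < y)" if "(x,y) \<in> E" "(x,y) \<noteq> (a,b)" for x y
        using cov[OF that(1)] that zc by (auto simp: cellset_def)
      thus ?thesis using zc abM by (auto simp: exposed_def cellset_def)
    qed
  qed
  thus un: "exposed (E - {(a,b)}) M = exposed E M \<union> cellset E a b" by blast
  have ends: "a \<in> exposed E M" "b \<in> exposed E M"
    using cov abM by (fastforce simp: exposed_def)+
  show int: "exposed E M \<inter> cellset E a b = {a,b}"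
  proof
    show "exposed E M \<inter> cellset E a b \<subseteq> {a,b}"
      using ab by (force simp: exposed_def cellset_def)
    show "{a,b} \<subseteq> exposed E M \<inter> cellset E a b"
      using ends endpoints_in_cellset[of a b E] abM by auto
  qed
  have "card (exposed E M \<union> cellset E a b) + card (exposed E M \<inter> cellset E a b)
      = card (exposed E M) + card (cellset E a b)"
    by (rule card_Un_Int[symmetric]) auto
  thus "card (exposed (E - {(a,b)}) M) + 2 = card (exposed E M) + card (cellset E a b)"
    using un int abM by simp
qed

text \<open>An Euler relation: with no arcs all M + 1 points are exposed, and inserting an outermost
  arc lowers their number by the type of its cell.\<close>

lemma card_exposed_plus_types:
  assumes "arcset M E"
  shows "card (exposed E M) + (\<Sum>(a,b)\<in>E. card (cellset E a b) - 2) = M + 1"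
  using assms
proof (induction "card E" arbitrary: E)
  case 0
  hence "E = {}" using finite_arcset by auto
  thus ?case by (simp add: exposed_def)
next
  case (Suc k)
  have fin: "finite E" and ne: "E \<noteq> {}" using Suc finite_arcset by auto
  \<comment> \<open>An arc of maximal length is outermost.\<close>
  define f where "f = (\<lambda>e::nat\<times>nat. snd e - fst e)"
  have "Max (f ` E) \<in> f ` E" using fin ne by (intro Max_in) auto
  then obtain a b where ab: "(a,b) \<in> E" "b - a = Max (f ` E)" by (auto simp: f_def)
  have outer: "(x,y) = (a,b)" if "(x,y) \<in> E" "x \<le> a" "b \<le> y" for x y
  proof -
    have "f (x,y) \<le> Max (f ` E)" using fin that by auto
    thus ?thesis using that ab(2) arcset_bounds[OF Suc.prems ab(1)] by (auto simp: f_def)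
  qed
  note rem = remove_outermost[OF Suc.prems ab(1) outer]
  let ?F = "E - {(a,b)}"
  have IH: "card (exposed ?F M) + (\<Sum>(x,y)\<in>?F. card (cellset ?F x y) - 2) = M + 1"
    using Suc.hyps(2) ab fin by (intro Suc.hyps(1)) (auto intro: arcset_mono[OF Suc.prems])
  have "(\<Sum>(x,y)\<in>?F. card (cellset ?F x y) - 2) = (\<Sum>(x,y)\<in>?F. card (cellset E x y) - 2)"
    using rem(1) by (intro sum.cong) (simp_all add: split_beta, metis prod.collapse)
  moreover have "(\<Sum>(x,y)\<in>E. card (cellset E x y) - 2)
      = (card (cellset E a b) - 2) + (\<Sum>(x,y)\<in>?F. card (cellset E x y) - 2)"
    using sum.remove[OF fin ab(1), of "\<lambda>(x,y). card (cellset E x y) - 2"] by simp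
  moreover have "3 \<le> card (cellset E a b)"
    using card_cellset_ge_3[OF Suc.prems] arcset_bounds[OF Suc.prems ab(1)] by blast
  ultimately show ?case using IH rem(4) by linarith
qed

section \<open>Arc sets in which the first point carries no arc\<close>

abbreviation shift_arcs :: "(nat \<times> nat) set \<Rightarrow> (nat \<times> nat) set" where
  "shift_arcs E \<equiv> map_prod Suc Suc ` E"

lemma in_shift_arcs: "(x,y) \<in> shift_arcs E \<longleftrightarrow> (\<exists>a b. x = Suc a \<and> y = Suc b \<and> (a,b) \<in> E)"
  by force

lemma arcset_shift: "arcset (Suc M) (shift_arcs E) \<longleftrightarrow> arcset M E"
proof
  assume "arcset (Suc M) (shift_arcs E)"
  hence "(\<forall>a b. (Suc a, Suc b) \<in> shift_arcs E \<longrightarrow> Suc a + 2 \<le> Suc b \<and> Suc b \<le> Suc M) \<and>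
     (\<forall>a b c e. (Suc a, Suc b) \<in> shift_arcs E \<longrightarrow> (Suc c, Suc e) \<in> shift_arcs E \<longrightarrow>
        Suc a < Suc c \<longrightarrow> Suc c < Suc b \<longrightarrow> Suc e \<le> Suc b)"
    unfolding arcset_def by blast
  thus "arcset M E" unfolding arcset_def in_shift_arcs by simp
next
  assume "arcset M E"
  thus "arcset (Suc M) (shift_arcs E)"
    unfolding arcset_def in_shift_arcs by (metis Suc_le_mono Suc_less_eq add_Suc)
qed

lemma cellset_shift: "cellset (shift_arcs E) (Suc a) (Suc b) = Suc ` cellset E a b"
proof -
  have "z \<in> cellset (shift_arcs E) (Suc a) (Suc b) \<longleftrightarrow> z \<in> Suc ` cellset E a b" for z
    by (cases z) (auto simp: cellset_def image_iff split_beta)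
  thus ?thesis by blast
qed

lemma exposed_shift: "exposed (shift_arcs E) (Suc M) = insert 0 (Suc ` exposed E M)"
proof -
  have "z \<in> exposed (shift_arcs E) (Suc M) \<longleftrightarrow> z \<in> insert 0 (Suc ` exposed E M)" for z
    by (cases z) (auto simp: exposed_def image_iff split_beta)
  thus ?thesis by blast
qed

lemma card_arcs_of_type_shift: "card (arcs_of_type (shift_arcs E) i) = card (arcs_of_type E i)"
proof -
  have "arcs_of_type (shift_arcs E) i = map_prod Suc Suc ` arcs_of_type E i"
    by (force simp: arcs_of_type_def cellset_shift card_image)
  moreover have "inj (map_prod Suc Suc)" by (simp add: prod.inj_map)
  ultimately show ?thesis by (metis card_image inj_on_subset subset_UNIV)
qed

lemma shift_in_arcsets_of_type:
  "shift_arcs E \<in> arcsets_of_type (Suc c) (Suc M) m \<longleftrightarrow> E \<in> arcsets_of_type c M m"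
  by (simp add: arcsets_of_type_def arcset_shift exposed_shift card_arcs_of_type_shift card_image)

text \<open>Deleting an isolated first point removes the contour edge from 0 to 1, so both
  parameters drop by one.\<close>

lemma card_arcsets_isolated_0:
  "card {E \<in> arcsets_of_type (Suc c) (Suc M) m. \<forall>b. (0,b) \<notin> E} = card (arcsets_of_type c M m)"
proof (rule bij_betw_same_card[symmetric])
  show "bij_betw (\<lambda>E. shift_arcs E) (arcsets_of_type c M m)
          {E \<in> arcsets_of_type (Suc c) (Suc M) m. \<forall>b. (0,b) \<notin> E}"
  proof (rule bij_betw_imageI)
    show "inj_on (\<lambda>E. shift_arcs E) (arcsets_of_type c M m)"
      by (simp add: inj_on_def inj_image_eq_iff prod.inj_map)
    have "E \<in> (\<lambda>E. shift_arcs E) ` arcsets_of_type c M m"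
      if "E \<in> arcsets_of_type (Suc c) (Suc M) m" "\<forall>b. (0,b) \<notin> E" for E
    proof -
      have ac: "arcset (Suc M) E" using that by (simp add: arcsets_of_type_def)
      have "E = shift_arcs {(a,b). (Suc a, Suc b) \<in> E}"
      proof (rule set_eqI, clarify)
        fix x y show "(x,y) \<in> E \<longleftrightarrow> (x,y) \<in> shift_arcs {(a,b). (Suc a, Suc b) \<in> E}"
          using that(2) arcset_bounds[OF ac, of x y] unfolding in_shift_arcs
          by (cases x; cases y) auto
      qed
      then obtain E' where E': "E = shift_arcs E'" by blast
      hence "E' \<in> arcsets_of_type c M m" using that(1) by (simp only: shift_in_arcsets_of_type)
      thus ?thesis using E' by (rule rev_image_eqI)
    qed
    thus "(\<lambda>E. shift_arcs E) ` arcsets_of_type c M m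
        = {E \<in> arcsets_of_type (Suc c) (Suc M) m. \<forall>b. (0,b) \<notin> E}"
      by (auto simp: shift_in_arcsets_of_type)
  qed
qed

text \<open>The longest arc at 0 is outermost, because an arc around it would start at 0 too. The
  description of its cell as an initial segment of the contour of \<open>F\<close> is what makes the
  deletion reversible.\<close>

lemma remove_root:
  assumes E: "arcset M E" and y: "(0,y) \<in> E" and maxy: "\<And>y'. (0,y') \<in> E \<Longrightarrow> y' \<le> y"
  defines "F \<equiv> E - {(0,y)}"
  shows "arcset M F" and "y \<in> exposed F M" and "cellset E 0 y = exposed F M \<inter> {..y}"
    and "arcs_of_type F j = arcs_of_type E j - {(0,y)}"
    and "card (exposed F M) + 2 = card (exposed E M) + card (cellset E 0 y)"
proof -
  have outer: "(x,w) = (0,y)" if "(x,w) \<in> E" "x \<le> 0" "y \<le> w" for x w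
    using maxy[of w] that by auto
  note rem = remove_outermost[OF E y outer, folded F_def]
  show "arcset M F" by (rule arcset_mono[OF E]) (auto simp: F_def)
  show "card (exposed F M) + 2 = card (exposed E M) + card (cellset E 0 y)" by (rule rem(4))
  show "y \<in> exposed F M" using rem(2,3) by blast
  have "exposed E M \<inter> {..y} \<subseteq> {0,y}" using y by (force simp: exposed_def)
  moreover have "cellset E 0 y \<subseteq> {..y}" by (auto simp: cellset_def)
  moreover have "{0,y} \<subseteq> cellset E 0 y" using endpoints_in_cellset[of 0 y E] by simp
  ultimately have "(exposed E M \<union> cellset E 0 y) \<inter> {..y} = cellset E 0 y" by blast
  thus "cellset E 0 y = exposed F M \<inter> {..y}" using rem(2) by (simp add: F_def)
  show "arcs_of_type F j = arcs_of_type E j - {(0,y)}"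
    using rem(1) by (auto simp: arcs_of_type_def F_def)
qed

lemma card_initial_segment_inj:
  fixes X :: "nat set"
  assumes "finite X" "y \<in> X" "z \<in> X" "card (X \<inter> {..y}) = card (X \<inter> {..z})"
  shows "y = z"
  using assms
proof (induction y z rule: linorder_wlog)
  case (le a b)
  have "X \<inter> {..a} = X \<inter> {..b}" using le by (intro card_subset_eq) auto
  hence "b \<in> X \<inter> {..a}" using le by simp
  thus ?case using le by simp
next
  case (sym a b) thus ?case by simp
qed

lemma card_initial_segment_surj:
  fixes X :: "nat set"
  assumes "finite X" "Suc k \<le> card X"
  shows "\<exists>y\<in>X. card (X \<inter> {..y}) = Suc k"
  using assms(2)
proof (induction k)
  case 0
  have ne: "X \<noteq> {}" using 0 by auto
  have "X \<inter> {..Min X} = {Min X}" using Min_in[OF assms(1) ne] Min_le[OF assms(1)] by (auto intro: antisym)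
  thus ?case using assms(1) ne by (intro bexI[of _ "Min X"]) auto
next
  case (Suc k)
  then obtain y where y: "y \<in> X" "card (X \<inter> {..y}) = Suc k" by auto
  have ne: "X \<inter> {y<..} \<noteq> {}"
  proof
    assume "X \<inter> {y<..} = {}"
    hence "X \<inter> {..y} = X" by (auto simp: not_less[symmetric])
    thus False using y Suc by simp
  qed
  define z where "z = Min (X \<inter> {y<..})"
  have z: "z \<in> X" "y < z" using Min_in[OF _ ne] assms(1) by (auto simp: z_def)
  have "w \<le> y" if "w \<in> X" "w < z" for w
  proof (rule ccontr)
    assume "\<not> w \<le> y"
    hence "z \<le> w" unfolding z_def using assms(1) that by (intro Min_le) auto
    thus False using that by simp
  qed
  hence "X \<inter> {..z} = insert z (X \<inter> {..y})" using z by force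
  moreover have "z \<notin> X \<inter> {..y}" using z by simp
  ultimately show ?case using y z assms(1) by (intro bexI[of _ z]) auto
qed

text \<open>The deleted arc can be recovered from what remains: it ends at the exposed point of rank
  i + 2. Opening a cell with i + 2 vertices lengthens the contour by i edges.\<close>

lemma card_arcsets_root_type:
  fixes c M :: nat
  assumes i: "1 \<le> i" and mi: "0 < m i" and c: "1 \<le> c"
  defines "B \<equiv> {E \<in> arcsets_of_type c M m. \<exists>y. (0,y) \<in> arcs_of_type E i \<and> (\<forall>y'. (0,y') \<in> E \<longrightarrow> y' \<le> y)}"
  shows "card B = card (arcsets_of_type (c + i) M (m(i := m i - 1)))"
proof (rule bij_betw_same_card)
  define root where "root = (\<lambda>E::(nat\<times>nat) set. THE y. (0,y) \<in> E \<and> (\<forall>y'. (0,y') \<in> E \<longrightarrow> y' \<le> y))"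
  define f where "f = (\<lambda>E. E - {(0, root E)})"
  have rootI: "root E = y" if "(0,y) \<in> E" "\<forall>y'. (0,y') \<in> E \<longrightarrow> y' \<le> y" for E y
    unfolding root_def using that by (intro the_equality) (auto intro: antisym)
  have key: "arcset M E \<and> (0, root E) \<in> E \<and> f E \<in> arcsets_of_type (c + i) M (m(i := m i - 1)) \<and>
      root E \<in> exposed (f E) M \<and> card (exposed (f E) M \<inter> {..root E}) = i + 2"
    if EB: "E \<in> B" for E
  proof -
    obtain y where y: "(0,y) \<in> arcs_of_type E i" "\<forall>y'. (0,y') \<in> E \<longrightarrow> y' \<le> y" and
      E: "arcset M E" "card (exposed E M) = c + 1" "\<And>j. card (arcs_of_type E j) = m j"
      using EB by (auto simp: B_def arcsets_of_type_def)
    have yE: "(0,y) \<in> E" "card (cellset E 0 y) = i + 2" using y by (auto simp: arcs_of_type_def)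
    have r: "root E = y" using rootI yE y by blast
    note rr = remove_root[OF E(1) yE(1) y(2)[rule_format]]
    have "card (arcs_of_type (f E) j) = (m(i := m i - 1)) j" for j
    proof -
      have "(0,y) \<in> arcs_of_type E j \<longleftrightarrow> j = i" using yE by (auto simp: arcs_of_type_def)
      thus ?thesis using E(3) finite_arcs_of_type[OF E(1)]
        by (cases "j = i") (simp_all add: f_def r rr(4) card_Diff_singleton_if)
    qed
    thus ?thesis using rr E(1,2) yE by (simp add: f_def r arcsets_of_type_def)
  qed
  show "bij_betw f B (arcsets_of_type (c + i) M (m(i := m i - 1)))"
  proof (rule bij_betw_imageI)
    show "inj_on f B"
    proof (rule inj_onI)
      fix E E' assume as: "E \<in> B" "E' \<in> B" "f E = f E'"
      have "root E = root E'"
        using key[OF as(1)] key[OF as(2)] as(3) finite_exposed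
        by (metis card_initial_segment_inj)
      moreover have "E = insert (0, root E) (f E)" "E' = insert (0, root E') (f E')"
        using key[OF as(1), THEN conjunct2, THEN conjunct1] key[OF as(2), THEN conjunct2, THEN conjunct1]
        by (simp_all add: f_def insert_absorb)
      ultimately show "E = E'" using as(3) by simp
    qed
    have "F \<in> f ` B" if "F \<in> arcsets_of_type (c + i) M (m(i := m i - 1))" for F
    proof -
      have F: "arcset M F" "card (exposed F M) = c + i + 1"
        and Ft: "\<And>j. card (arcs_of_type F j) = (m(i := m i - 1)) j"
        using that by (auto simp: arcsets_of_type_def)
      \<comment> \<open>Since c \<ge> 1, the c + i + 1 exposed points of \<open>F\<close> include
        one of rank i + 2.\<close>
      obtain y where y: "y \<in> exposed F M" "card (exposed F M \<inter> {..y}) = i + 2"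
        using card_initial_segment_surj[of "exposed F M" "i + 1"] F c by auto
      have "card (exposed F M \<inter> {..y}) \<le> card {..y}" by (intro card_mono) auto
      hence y2: "2 \<le> y" using y i by simp
      have yM: "y \<le> M" using y by (auto simp: exposed_def)
      \<comment> \<open>An arc \<open>(0,y)\<close> in \<open>F\<close> would hide everything
        between its ends and leave y with rank at most 2, whereas i \<ge> 1.\<close>
      have notF: "(0,y) \<notin> F"
      proof
        assume "(0,y) \<in> F"
        hence "exposed F M \<inter> {..y} \<subseteq> {0,y}" by (force simp: exposed_def)
        hence "card (exposed F M \<inter> {..y}) \<le> card {0,y}" by (intro card_mono) auto
        also have "\<dots> \<le> 2" by (simp add: card_insert_if)
        finally show False using y i by simp
      qed
      define E where "E = insert (0,y) F"
      have cov: "\<not> (a < y \<and> y < b)" if "(a,b) \<in> F" for a b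
        using y that by (auto simp: exposed_def)
      have E: "arcset M E"
        unfolding arcset_def
      proof (intro conjI allI impI)
        fix a b assume "(a,b) \<in> E"
        thus "a + 2 \<le> b" "b \<le> M" using arcset_bounds[OF F(1), of a b] y2 yM by (auto simp: E_def)
      next
        fix a b c e assume "(a,b) \<in> E" "(c,e) \<in> E" "a < c" "c < b"
        thus "e \<le> b" using arcset_noncrossing[OF F(1), of a b c e] cov[of c e]
          unfolding E_def by (metis Pair_inject insert_iff not_less not_less_zero)
      qed
      have maxy: "y' \<le> y" if "(0,y') \<in> E" for y' using that cov[of 0 y'] y2 by (auto simp: E_def)
      have yE: "(0,y) \<in> E" by (simp add: E_def)
      have EF: "E - {(0,y)} = F" using notF by (simp add: E_def)
      note rr = remove_root[OF E yE maxy, unfolded EF]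
      have cE: "card (cellset E 0 y) = i + 2" using rr(3) y by simp
      have r: "root E = y" using rootI yE maxy by blast
      have "card (arcs_of_type E j) = m j" for j
      proof -
        have iff: "(0,y) \<in> arcs_of_type E j \<longleftrightarrow> j = i" using yE cE by (auto simp: arcs_of_type_def)
        have "card (arcs_of_type E j - {(0,y)}) = (m(i := m i - 1)) j" using Ft[of j] rr(4) by simp
        thus ?thesis using iff finite_arcs_of_type[OF E, of j] mi
          by (cases "j = i") (auto simp: card_Diff_singleton_if, metis One_nat_def Suc_pred' card_gt_0_iff empty_iff less_irrefl)
      qed
      hence "E \<in> B" using E rr(5) F cE yE maxy
        by (auto simp: B_def arcsets_of_type_def arcs_of_type_def)
      moreover have "f E = F" by (simp add: f_def r EF)
      ultimately show ?thesis by blast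
    qed
    thus "f ` B = arcsets_of_type (c + i) M (m(i := m i - 1))" using key by blast
  qed
qed


lemma card_arcsets_recurrence:
  assumes I: "finite I" "0 \<notin> I" "\<And>i. i \<notin> I \<Longrightarrow> m i = 0"
  shows "card (arcsets_of_type (Suc c) (Suc M) m) = card (arcsets_of_type c M m) +
    (\<Sum>i\<in>I. if 0 < m i then card (arcsets_of_type (Suc c + i) (Suc M) (m(i := m i - 1))) else 0)"
proof -
  let ?L = "arcsets_of_type (Suc c) (Suc M) m"
  define A where "A = {E \<in> ?L. \<forall>b. (0,b) \<notin> E}"
  define B where "B = (\<lambda>i. {E \<in> ?L. \<exists>y. (0,y) \<in> arcs_of_type E i \<and> (\<forall>y'. (0,y') \<in> E \<longrightarrow> y' \<le> y)})"
  define J where "J = {i\<in>I. 0 < m i}"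
  have fJ: "finite J" using I by (simp add: J_def)
  have fL: "finite ?L" by (rule finite_arcsets_of_type)
  have "E \<in> A \<union> (\<Union>i\<in>J. B i)" if E: "E \<in> ?L" for E
  proof (cases "\<forall>b. (0,b) \<notin> E")
    case True thus ?thesis using E by (simp add: A_def)
  next
    case False
    have ac: "arcset (Suc M) E" using E by (simp add: arcsets_of_type_def)
    define Y where "Y = {y. (0,y) \<in> E}"
    have fY: "finite Y" unfolding Y_def
      by (rule finite_subset[of _ "{..Suc M}"]) (use arcset_bounds[OF ac] in auto)
    have Y: "Max Y \<in> Y" using False fY by (intro Max_in) (auto simp: Y_def)
    have mx: "\<forall>y'. (0,y') \<in> E \<longrightarrow> y' \<le> Max Y" using fY by (simp add: Y_def)
    have "3 \<le> card (cellset E 0 (Max Y))"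
      using card_cellset_ge_3[OF ac] arcset_bounds[OF ac, of 0 "Max Y"] Y by (simp add: Y_def)
    then obtain i where i: "card (cellset E 0 (Max Y)) = i + 2"
      using that[of "card (cellset E 0 (Max Y)) - 2"] by simp
    hence "(0, Max Y) \<in> arcs_of_type E i" using Y by (simp add: arcs_of_type_def Y_def)
    moreover from this have "0 < m i"
      using E finite_arcs_of_type[OF ac, of i] card_gt_0_iff[of "arcs_of_type E i"]
      by (auto simp: arcsets_of_type_def)
    moreover from this have "i \<in> J" using I(3) by (force simp: J_def)
    ultimately show ?thesis using E mx by (auto simp: B_def)
  qed
  hence "?L = A \<union> (\<Union>i\<in>J. B i)" by (auto simp: A_def B_def)
  moreover have "A \<inter> (\<Union>i\<in>J. B i) = {}" by (auto simp: A_def B_def arcs_of_type_def)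
  moreover have "finite A" "\<And>i. finite (B i)" using fL by (auto simp: A_def B_def)
  ultimately have "card ?L = card A + card (\<Union>i\<in>J. B i)"
    using fJ by (simp add: card_Un_disjoint)
  also have "card (\<Union>i\<in>J. B i) = (\<Sum>i\<in>J. card (B i))"
  proof (rule card_UN_disjoint[OF fJ])
    show "\<forall>i\<in>J. finite (B i)" using \<open>\<And>i. finite (B i)\<close> by blast
    have "i = j" if Ei: "E \<in> B i" and Ej: "E \<in> B j" for i j E
    proof -
      obtain y where y: "(0,y) \<in> arcs_of_type E i" "\<forall>y'. (0,y') \<in> E \<longrightarrow> y' \<le> y"
        using Ei unfolding B_def by blast
      obtain z where z: "(0,z) \<in> arcs_of_type E j" "\<forall>y'. (0,y') \<in> E \<longrightarrow> y' \<le> z"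
        using Ej unfolding B_def by blast
      have "y = z" using y z by (auto simp: arcs_of_type_def intro: antisym)
      thus ?thesis using y z by (simp add: arcs_of_type_def)
    qed
    thus "\<forall>i\<in>J. \<forall>j\<in>J. i \<noteq> j \<longrightarrow> B i \<inter> B j = {}" by blast
  qed
  also have "card A = card (arcsets_of_type c M m)"
    unfolding A_def by (rule card_arcsets_isolated_0)
  also have "(\<Sum>i\<in>J. card (B i))
      = (\<Sum>i\<in>J. card (arcsets_of_type (Suc c + i) (Suc M) (m(i := m i - 1))))"
  proof (rule sum.cong[OF refl])
    fix i assume "i \<in> J"
    hence "1 \<le> i" "0 < m i" using I by (auto simp: J_def Suc_le_eq intro: gr0I)
    thus "card (B i) = card (arcsets_of_type (Suc c + i) (Suc M) (m(i := m i - 1)))"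
      unfolding B_def by (intro card_arcsets_root_type) auto
  qed
  also have "\<dots> = (\<Sum>i\<in>I. if 0 < m i then card (arcsets_of_type (Suc c + i) (Suc M) (m(i := m i - 1))) else 0)"
    unfolding J_def by (rule sum.inter_filter[OF I(1)])
  finally show ?thesis .
qed

text \<open>Stated without division so as to remain in \<open>nat\<close>. The induction runs over M
  + K, since one branch of the recurrence lowers M and the other lowers some \<open>m i\<close>
  while keeping M.\<close>

theorem card_arcsets_of_type:
  assumes I: "finite I" "0 \<notin> I" and "\<And>i. i \<notin> I \<Longrightarrow> m i = 0"
    and "1 \<le> M" and "M = c + (\<Sum>i\<in>I. i * m i)"
  shows "card (arcsets_of_type c M m) * (fact M * (\<Prod>i\<in>I. fact (m i))) = c * (fact (M + sum m I - 1) :: nat)"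
  using assms(3-)
proof (induction "M + sum m I" arbitrary: M c m rule: less_induct)
  case less
  note m0 = less.prems(1) and M1 = less.prems(2) and M = less.prems(3)
  show ?case
  proof (cases "c = 0")
    case True
    have "E \<notin> arcsets_of_type 0 M m" for E
    proof
      assume "E \<in> arcsets_of_type 0 M m"
      hence E: "arcset M E" "card (exposed E M) = 1" by (auto simp: arcsets_of_type_def)
      have "card {0,M} \<le> card (exposed E M)" using exposed_endpoints[OF E(1)] by (intro card_mono) auto
      thus False using E(2) M1 by simp
    qed
    hence "arcsets_of_type 0 M m = {}" by blast
    thus ?thesis using True by simp
  next
    case False
    then obtain c' where c: "c = Suc c'" by (cases c) auto
    obtain M' where M': "M = Suc M'" using M1 by (cases M) auto
    \<comment> \<open>M = 1 is a base case: removing a point would lead to M = 0, outside the range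
      of the formula.\<close>
    show ?thesis
    proof (cases "M' = 0")
      case True
      hence "(\<Sum>i\<in>I. i * m i) = 0" "c = 1" using M M' c by auto
      hence "m i = 0" for i using I m0 by (cases "i \<in> I") auto
      hence m: "m = (\<lambda>_. 0)" by blast
      have ac: "arcset 1 E \<longleftrightarrow> E = {}" for E
      proof
        assume "arcset 1 E"
        hence "(a,b) \<notin> E" for a b using arcset_bounds[of 1 E a b] by auto
        thus "E = {}" by auto
      qed (simp add: arcset_def)
      have "E \<in> arcsets_of_type 1 1 m \<longleftrightarrow> E = {}" for E
        unfolding arcsets_of_type_def mem_Collect_eq ac by (auto simp: m exposed_def arcs_of_type_def)
      hence "arcsets_of_type 1 1 m = {{}}" by blast
      thus ?thesis using True M' \<open>c = 1\<close> m by simp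
    next
      case False
      define K where "K = sum m I"
      define P :: nat where "P = (\<Prod>i\<in>I. fact (m i))"
      \<comment> \<open>All terms of the recurrence share this factor; M \<ge> 2 here, so the
        subtraction is not truncated.\<close>
      define F :: nat where "F = fact (M + K - 2)"
      have F: "fact (M + K - 1) = (M + K - 1) * F"
        using False M' fact_reduce[of "M + K - 1", where 'a = nat] by (simp add: F_def)
      have IH1: "card (arcsets_of_type c' M' m) * (fact M' * P) = c' * F"
        using less.hyps[of M' m c'] m0 False M M' c by (simp add: P_def F_def K_def)
      have IH2: "card (arcsets_of_type (c + i) M (m(i := m i - 1))) * (fact M * P) = m i * (c + i) * F"
        if i: "i \<in> I" "0 < m i" for i
      proof -
        let ?m = "m(i := m i - 1)"
        have s1: "sum m I = m i + sum m (I - {i})" "sum ?m I = m i - 1 + sum m (I - {i})"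
          using I i by (simp_all add: sum.remove)
        have s2: "(\<Sum>j\<in>I. j * m j) = i * m i + (\<Sum>j\<in>I-{i}. j * m j)"
          "(\<Sum>j\<in>I. j * ?m j) = i * (m i - 1) + (\<Sum>j\<in>I-{i}. j * m j)"
          using I i by (simp_all add: sum.remove)
        have p: "P = fact (m i) * (\<Prod>j\<in>I-{i}. fact (m j))"
          "(\<Prod>j\<in>I. fact (?m j)) = (fact (m i - 1) * (\<Prod>j\<in>I-{i}. fact (m j)) :: nat)"
          using I i by (simp_all add: prod.remove P_def)
        have p': "P = m i * (\<Prod>j\<in>I. fact (?m j))"
          unfolding p using i(2) by (simp add: fact_reduce)
        have s2': "(\<Sum>j\<in>I. j * m j) = i + (\<Sum>j\<in>I. j * ?m j)"
          unfolding s2 using i(2) by (cases "m i") auto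
        have s1': "M + K - 2 = M + sum ?m I - 1" "M + sum ?m I < M + sum m I" using s1 i(2) by (auto simp: K_def)
        have "card (arcsets_of_type (c + i) M ?m) * (fact M * (\<Prod>j\<in>I. fact (?m j))) = (c + i) * F"
          using less.hyps[of M ?m "c + i"] s1' s2' m0 M M1 I i by (force simp: F_def)
        thus ?thesis unfolding p' by (metis mult.assoc mult.left_commute)
      qed
      have "card (arcsets_of_type c M m) * (fact M * P)
        = card (arcsets_of_type c' M' m) * (fact M * P) +
          (\<Sum>i\<in>I. (if 0 < m i then card (arcsets_of_type (c + i) M (m(i := m i - 1))) else 0) * (fact M * P))"
        unfolding c M' using card_arcsets_recurrence[OF I m0] by (simp add: sum_distrib_right add_mult_distrib)
      also have "card (arcsets_of_type c' M' m) * (fact M * P) = M * (card (arcsets_of_type c' M' m) * (fact M' * P))"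
        by (simp add: M' algebra_simps)
      also have "\<dots> = M * (c' * F)" by (simp only: IH1)
      also have "(\<Sum>i\<in>I. (if 0 < m i then card (arcsets_of_type (c + i) M (m(i := m i - 1))) else 0) * (fact M * P))
         = (\<Sum>i\<in>I. m i * (c + i) * F)"
      proof (rule sum.cong[OF refl])
        fix i assume "i \<in> I"
        thus "(if 0 < m i then card (arcsets_of_type (c + i) M (m(i := m i - 1))) else 0) * (fact M * P)
            = m i * (c + i) * F"
          using IH2[of i] by (cases "0 < m i") (simp_all only: if_True if_False, simp)
      qed
      also have "\<dots> = (c * K + (\<Sum>i\<in>I. i * m i)) * F"
        by (simp add: K_def sum_distrib_left sum_distrib_right sum.distrib[symmetric] algebra_simps)
      \<comment> \<open>With M = c + sum of i m_i the coefficient is M (c - 1) + c K + (M - c) = c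
        (M + K - 1).\<close>
      also have "M * (c' * F) + \<dots> = c * (M + K - 1) * F"
      proof -
        have "M * c' + (c * K + (\<Sum>i\<in>I. i * m i)) = c * (M + K - 1)"
          using M unfolding c M' by (simp add: algebra_simps)
        thus ?thesis by (metis add_mult_distrib mult.assoc)
      qed
      finally show ?thesis using F by (simp add: K_def P_def mult.assoc)
    qed
  qed
qed

section \<open>Subgons and arcs\<close>

definition arcs :: "nat set set \<Rightarrow> (nat \<times> nat) set" where
  "arcs D = {(x,y). x < y \<and> {x,y} \<in> D}"

text \<open>The side joining the last vertex to the first one serves as the root.\<close>

definition rooted_arcs :: "nat \<Rightarrow> nat set set \<Rightarrow> (nat \<times> nat) set" where
  "rooted_arcs N D = insert (0, N - 1) (arcs D)"

lemma side_iff: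
  assumes "x < y"
  shows "side N x y \<longleftrightarrow> y < N \<and> (y = Suc x \<or> x = 0 \<and> y = N - 1)"
  using assms unfolding side_def by (auto simp: mod_Suc)

lemma side_commute: "side N x y \<longleftrightarrow> side N y x"
  by (auto simp: side_def)

lemma is_diagonal_iff:
  assumes "x < y"
  shows "is_diagonal N {x,y} \<longleftrightarrow> x + 2 \<le> y \<and> y < N \<and> \<not> (x = 0 \<and> y = N - 1)"
proof -
  have "is_diagonal N {x,y} \<longleftrightarrow> y < N \<and> \<not> side N x y"
  proof
    show "is_diagonal N {x,y} \<Longrightarrow> y < N \<and> \<not> side N x y"
      unfolding is_diagonal_def by (auto simp: doubleton_eq_iff side_commute)
    show "y < N \<and> \<not> side N x y \<Longrightarrow> is_diagonal N {x,y}"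
      unfolding is_diagonal_def using assms by (intro exI[of _ x] exI[of _ y]) auto
  qed
  thus ?thesis using assms by (auto simp: side_iff)
qed

lemma crosses_iff:
  assumes "x < y" "u < v"
  shows "crosses {x,y} {u,v} \<longleftrightarrow> x < u \<and> u < y \<and> y < v \<or> u < x \<and> x < v \<and> v < y"
proof
  show "crosses {x,y} {u,v} \<Longrightarrow> x < u \<and> u < y \<and> y < v \<or> u < x \<and> x < v \<and> v < y"
    using assms unfolding crosses_def by (auto simp: doubleton_eq_iff)
  show "x < u \<and> u < y \<and> y < v \<or> u < x \<and> x < v \<and> v < y \<Longrightarrow> crosses {x,y} {u,v}"
    unfolding crosses_def by blast
qed

lemma is_diagonalE:
  assumes "is_diagonal N d"
  obtains x y where "d = {x,y}" "x < y"
proof -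
  obtain i j where "d = {i,j}" "i \<noteq> j" using assms by (auto simp: is_diagonal_def)
  thus thesis using that[of i j] that[of j i] by (cases "i < j") (auto simp: insert_commute)
qed

text \<open>One inequality covers both crossing patterns, as the two diagonals may be exchanged. No
  order within the second pair is assumed: for v < u the conclusion is automatic.\<close>

lemma dissection_iff:
  "dissection N D \<longleftrightarrow> (\<forall>d\<in>D. is_diagonal N d) \<and>
     (\<forall>x y u v. {x,y} \<in> D \<longrightarrow> {u,v} \<in> D \<longrightarrow> x < u \<longrightarrow> u < y \<longrightarrow> v \<le> y)"
proof
  assume D: "dissection N D"
  have "v \<le> y" if "{x,y} \<in> D" "{u,v} \<in> D" "x < u" "u < y" for x y u v
  proof (rule ccontr)
    assume "\<not> v \<le> y"
    hence "crosses {x,y} {u,v}" using that by (subst crosses_iff) auto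
    thus False using D that by (auto simp: dissection_def)
  qed
  thus "(\<forall>d\<in>D. is_diagonal N d) \<and>
     (\<forall>x y u v. {x,y} \<in> D \<longrightarrow> {u,v} \<in> D \<longrightarrow> x < u \<longrightarrow> u < y \<longrightarrow> v \<le> y)"
    using D by (auto simp: dissection_def)
next
  assume D: "(\<forall>d\<in>D. is_diagonal N d) \<and>
     (\<forall>x y u v. {x,y} \<in> D \<longrightarrow> {u,v} \<in> D \<longrightarrow> x < u \<longrightarrow> u < y \<longrightarrow> v \<le> y)"
  have "\<not> crosses d e" if de: "d \<in> D" "e \<in> D" for d e
  proof -
    obtain x y where d: "d = {x,y}" "x < y" using D de is_diagonalE by metis
    obtain u v where e: "e = {u,v}" "u < v" using D de is_diagonalE by metis
    show ?thesis using D de unfolding d e crosses_iff[OF d(2) e(2)] by (meson not_less)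
  qed
  thus "dissection N D" using D by (auto simp: dissection_def)
qed

lemma dissection_arc_bounds:
  "dissection N D \<Longrightarrow> (x,y) \<in> arcs D \<Longrightarrow> x + 2 \<le> y \<and> y < N \<and> \<not> (x = 0 \<and> y = N - 1)"
  using is_diagonal_iff[of x y N] by (auto simp: dissection_def arcs_def)

lemma dissection_noncrossing:
  "dissection N D \<Longrightarrow> {x,y} \<in> D \<Longrightarrow> {u,v} \<in> D \<Longrightarrow> x < u \<Longrightarrow> u < y \<Longrightarrow> v \<le> y"
  by (auto simp: dissection_iff)

lemma dissection_eq_image_arcs:
  assumes "dissection N D"
  shows "D = (\<lambda>(x,y). {x,y}) ` arcs D"
proof -
  have "d \<in> (\<lambda>(x,y). {x,y}) ` arcs D" if "d \<in> D" for d
  proof -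
    obtain x y where "d = {x,y}" "x < y"
      using assms \<open>d \<in> D\<close> is_diagonalE unfolding dissection_def by blast
    thus ?thesis using \<open>d \<in> D\<close> by (intro image_eqI[of _ _ "(x,y)"]) (auto simp: arcs_def)
  qed
  thus ?thesis by (auto simp: arcs_def)
qed

lemma arcset_arcs:
  assumes D: "dissection N D"
  shows "arcset (N - 1) (arcs D)"
  unfolding arcset_def
proof (intro conjI allI impI)
  fix a b assume "(a,b) \<in> arcs D"
  thus "a + 2 \<le> b" "b \<le> N - 1" using dissection_arc_bounds[OF D, of a b] by auto
next
  fix a b c e assume "(a,b) \<in> arcs D" "(c,e) \<in> arcs D" "a < c" "c < b"
  thus "e \<le> b" using dissection_noncrossing[OF D, of a b c e] by (simp add: arcs_def)
qed

lemma arcset_insert_root: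
  assumes "arcset M E" "2 \<le> M"
  shows "arcset M (insert (0,M) E)"
  unfolding arcset_def
proof (intro conjI allI impI)
  fix a b assume "(a,b) \<in> insert (0,M) E"
  thus "a + 2 \<le> b" "b \<le> M" using arcset_bounds[OF assms(1), of a b] assms(2) by auto
next
  fix a b c e assume "(a,b) \<in> insert (0,M) E" "(c,e) \<in> insert (0,M) E" "a < c" "c < b"
  thus "e \<le> b" using arcset_noncrossing[OF assms(1), of a b c e] arcset_bounds[OF assms(1), of c e]
    arcset_bounds[OF assms(1), of a b] by auto
qed

lemma arcset_rooted_arcs:
  "dissection N D \<Longrightarrow> 3 \<le> N \<Longrightarrow> arcset (N - 1) (rooted_arcs N D)"
  unfolding rooted_arcs_def by (intro arcset_insert_root arcset_arcs) auto

text \<open>Cyclic distance is a difference of numbers, plus N when it runs backwards. The backward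
  pair (y, x) is consecutive only when it closes the polygon from maximum to minimum.\<close>

lemma cyc_consec_iff:
  assumes S: "S \<subseteq> {..<N}" "x \<in> S" "y \<in> S" "x < y"
  shows "cyc_consec N S x y \<longleftrightarrow> (\<forall>z\<in>S. \<not> (x < z \<and> z < y))"
    and "cyc_consec N S y x \<longleftrightarrow> (\<forall>z\<in>S. x \<le> z \<and> z \<le> y)"
proof -
  have lt: "z < N" if "z \<in> S" for z using S(1) that by auto
  have pos: "(int v - int u) mod int N = int v - int u" if "u \<le> v" "v < N" for u v
    using that by (simp add: mod_pos_pos_trivial)
  have neg: "(int v - int u) mod int N = int v - int u + int N" if "v < u" "u < N" for u v
  proof -
    have "(int v - int u) mod int N = (int v - int u + int N) mod int N" by simp
    also have "\<dots> = int v - int u + int N" using that by (intro mod_pos_pos_trivial) auto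
    finally show ?thesis .
  qed
  have "(int y - int x) mod int N \<le> (int z - int x) mod int N \<longleftrightarrow> \<not> (x < z \<and> z < y)" if "z \<in> S" "z \<noteq> x" for z
    using that lt[OF that(1)] lt[OF S(3)] lt[OF S(2)] S(4) by (cases "x < z") (auto simp: pos neg)
  thus "cyc_consec N S x y \<longleftrightarrow> (\<forall>z\<in>S. \<not> (x < z \<and> z < y))"
    using S unfolding cyc_consec_def by auto
  have "(int x - int y) mod int N \<le> (int z - int y) mod int N \<longleftrightarrow> x \<le> z \<and> z \<le> y" if "z \<in> S" "z \<noteq> y" for z
    using that lt[OF that(1)] lt[OF S(3)] lt[OF S(2)] S(4) by (cases "y < z") (auto simp: pos neg)
  thus "cyc_consec N S y x \<longleftrightarrow> (\<forall>z\<in>S. x \<le> z \<and> z \<le> y)"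
    using S unfolding cyc_consec_def by (metis nat_less_le order_refl)
qed

text \<open>The edges of the cell are unit steps or arcs below the base; the base itself is the
  closing edge from the last vertex to the first.\<close>

lemma subgon_cellset:
  assumes D: "dissection N D" and N: "3 \<le> N" and ab: "(a,b) \<in> rooted_arcs N D"
  defines "S \<equiv> cellset (rooted_arcs N D) a b"
  shows "subgon N D S" "Min S = a" "Max S = b"
proof -
  note E = arcset_rooted_arcs[OF D N]
  have ab2: "a + 2 \<le> b" "b \<le> N - 1" using arcset_bounds[OF E ab] by auto
  have ends: "a \<in> S" "b \<in> S" using endpoints_in_cellset[of a b] ab2 by (auto simp: S_def)
  have bnd: "a \<le> z \<and> z \<le> b" if "z \<in> S" for z using that by (auto simp: S_def cellset_def)
  have SN: "S \<subseteq> {..<N}" using bnd ab2 N by force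
  have fin: "finite S" by (simp add: S_def)
  show "Min S = a" "Max S = b" using fin ends bnd by (auto intro!: Min_eqI Max_eqI)
  have edge: "side N x y \<or> {x,y} \<in> D" if "x \<in> S" "y \<in> S" "x < y" "\<forall>z\<in>S. \<not> (x < z \<and> z < y)" for x y
  proof -
    have xy: "a \<le> x" "y \<le> b" using bnd that by auto
    have "y = Suc x \<or> (x,y) \<in> rooted_arcs N D \<and> (x,y) \<noteq> (a,b)"
      using that unfolding S_def by (intro cellset_consecutive[OF E ab2(2)]) auto
    \<comment> \<open>The root arc is a side and not a diagonal; spanning all vertices, it can occur
      only as the base.\<close>
    moreover have "(x,y) \<noteq> (0, N - 1)" if "(x,y) \<noteq> (a,b)" using that xy ab2 by auto
    ultimately show ?thesis using side_iff[OF that(3), of N] xy ab2 N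
      by (auto simp: rooted_arcs_def arcs_def)
  qed
  have ab_edge: "side N a b \<or> {a,b} \<in> D"
    using ab ab2 N side_iff[of a b N] by (auto simp: rooted_arcs_def arcs_def)
  have c1: "side N x y \<or> {x,y} \<in> D" if "cyc_consec N S x y" for x y
  proof -
    have xy: "x \<in> S" "y \<in> S" "x \<noteq> y" using that by (auto simp: cyc_consec_def)
    show ?thesis
    proof (cases "x < y")
      case True thus ?thesis using edge that cyc_consec_iff(1)[OF SN xy(1,2) True] xy by simp
    next
      case False
      hence "y < x" using xy by simp
      hence "\<forall>z\<in>S. y \<le> z \<and> z \<le> x" using that cyc_consec_iff(2)[OF SN xy(2,1)] by simp
      hence "y = a" "x = b" using ends bnd xy by (auto intro: antisym)
      thus ?thesis using ab_edge by (simp add: side_commute insert_commute)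
    qed
  qed
  have chord: "cyc_consec N S x y \<or> cyc_consec N S y x" if "x \<in> S" "y \<in> S" "{x,y} \<in> D" "x < y" for x y
  proof (cases "(x,y) = (a,b)")
    case True thus ?thesis using cyc_consec_iff(2)[OF SN that(1,2,4)] bnd by simp
  next
    case False
    have "(x,y) \<in> rooted_arcs N D" using that by (simp add: rooted_arcs_def arcs_def)
    hence "\<forall>z\<in>S. \<not> (x < z \<and> z < y)" using False bnd that by (auto simp: S_def cellset_def)
    thus ?thesis using cyc_consec_iff(1)[OF SN that(1,2,4)] by simp
  qed
  have c2: "cyc_consec N S x y \<or> cyc_consec N S y x" if "x \<in> S" "y \<in> S" "{x,y} \<in> D" for x y
  proof -
    have "x \<noteq> y" using D that by (auto simp: dissection_def is_diagonal_def doubleton_eq_iff)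
    thus ?thesis using chord[of x y] chord[of y x] that by (auto simp: insert_commute neq_iff)
  qed
  show "subgon N D S" unfolding subgon_def
    using SN c1 c2 card_cellset_ge_3[OF E ab2] by (auto simp: S_def)
qed

lemma consecutive_in_finite_set:
  fixes S :: "nat set"
  assumes "finite S" "a \<in> S" "b \<in> S" "a \<le> x" "x < b"
  obtains p q where "p \<in> S" "q \<in> S" "p \<le> x" "x < q" "\<forall>z\<in>S. \<not> (p < z \<and> z < q)"
proof -
  define p where "p = Max {s\<in>S. s \<le> x}"
  define q where "q = Min {s\<in>S. x < s}"
  have "p \<in> {s\<in>S. s \<le> x}" unfolding p_def using assms by (intro Max_in) auto
  moreover have "q \<in> {s\<in>S. x < s}" unfolding q_def using assms by (intro Min_in) auto
  moreover have "\<not> (p < z \<and> z < q)" if "z \<in> S" for z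
  proof (cases "z \<le> x")
    case True
    hence "z \<le> p" unfolding p_def using assms that by (intro Max_ge) auto
    thus ?thesis by simp
  next
    case False
    hence "q \<le> z" unfolding q_def using assms that by (intro Min_le) auto
    thus ?thesis by simp
  qed
  ultimately show thesis using that by blast
qed

text \<open>Every gap of \<open>S\<close> is closed by a diagonal of \<open>D\<close>, which hides
  the points in the gap. Conversely, a diagonal hiding a point of \<open>S\<close> would cross one
  of these closing diagonals or cut through \<open>S\<close>.\<close>

lemma subgon_eq_cellset:
  assumes D: "dissection N D" and N: "3 \<le> N" and S: "subgon N D S"
  shows "(Min S, Max S) \<in> rooted_arcs N D" "S = cellset (rooted_arcs N D) (Min S) (Max S)"
proof -
  have SN: "S \<subseteq> {..<N}" and c3: "3 \<le> card S"
    and edges: "\<And>x y. cyc_consec N S x y \<Longrightarrow> side N x y \<or> {x, y} \<in> D"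
    and chords: "\<And>x y. x \<in> S \<Longrightarrow> y \<in> S \<Longrightarrow> {x, y} \<in> D \<Longrightarrow> cyc_consec N S x y \<or> cyc_consec N S y x"
    using S by (auto simp: subgon_def)
  have fin: "finite S" using SN finite_subset by blast
  have ne: "S \<noteq> {}" using c3 by auto
  define a b where "a = Min S" and "b = Max S"
  have ab: "a \<in> S" "b \<in> S" "\<And>z. z \<in> S \<Longrightarrow> a \<le> z \<and> z \<le> b" using fin ne by (auto simp: a_def b_def)
  have "card S \<le> card {a..b}" using ab(3) by (intro card_mono) auto
  hence ab2: "a + 2 \<le> b" using c3 by simp
  hence "cyc_consec N S b a" using cyc_consec_iff(2)[OF SN ab(1,2)] ab(3) by simp
  hence "side N a b \<or> {a,b} \<in> D" using edges[of b a] by (simp add: side_commute insert_commute)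
  thus abE: "(Min S, Max S) \<in> rooted_arcs N D"
    using ab2 side_iff[of a b N] by (auto simp: rooted_arcs_def arcs_def a_def[symmetric] b_def[symmetric])
  \<comment> \<open>A side with p + 2 \<le> q can only join 0 and N - 1, which would leave no room
    for a third vertex.\<close>
  have gap: "{p,q} \<in> D" if "p \<in> S" "q \<in> S" "p + 2 \<le> q" "\<forall>z\<in>S. \<not> (p < z \<and> z < q)" for p q
  proof -
    have pq: "p < q" using that by simp
    have "side N p q \<or> {p,q} \<in> D" using edges cyc_consec_iff(1)[OF SN that(1,2) pq] that(4) by simp
    moreover have "\<not> side N p q"
    proof
      assume "side N p q"
      hence "p = 0" "q = N - 1" using side_iff[OF pq, of N] that by auto
      hence "S \<subseteq> {p,q}" using that(4) SN by force
      hence "card S \<le> card {p,q}" by (intro card_mono) auto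
      thus False using c3 pq by simp
    qed
    ultimately show ?thesis by simp
  qed
  note nc = dissection_noncrossing[OF D]
  have "z \<in> S \<longleftrightarrow> z \<in> cellset (rooted_arcs N D) a b" for z
  proof
    assume z: "z \<in> S"
    have "\<not> (x < z \<and> z < y)" if xyE: "(x,y) \<in> rooted_arcs N D" "(x,y) \<noteq> (a,b)" "a \<le> x" "y \<le> b" for x y
    proof
      assume xzy: "x < z \<and> z < y"
      have "b < N" using ab(2) SN by auto
      hence xy: "{x,y} \<in> D" using xyE by (auto simp: rooted_arcs_def arcs_def)
      \<comment> \<open>If x fell into a gap, the diagonal closing that gap would end between x and
        y and cross {x, y}.\<close>
      have "x \<in> S"
      proof -
        obtain p q where pq: "p \<in> S" "q \<in> S" "p \<le> x" "x < q" "\<forall>z\<in>S. \<not> (p < z \<and> z < q)"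
          using consecutive_in_finite_set[OF fin ab(1) z, of x] xyE xzy by auto
        have "q \<le> z" using pq z xzy by (meson le_less_trans not_less)
        have "\<not> p < x"
        proof
          assume "p < x"
          hence "{p,q} \<in> D" using gap pq by simp
          from nc[OF this xy \<open>p < x\<close> pq(4)] show False using \<open>q \<le> z\<close> xzy by simp
        qed
        thus ?thesis using pq by simp
      qed
      moreover have "y \<in> S"
      proof (rule ccontr)
        assume yS: "y \<notin> S"
        have "y < b" using yS xyE ab(2) by (metis nat_less_le)
        then obtain p q where pq: "p \<in> S" "q \<in> S" "p \<le> y" "y < q" "\<forall>z\<in>S. \<not> (p < z \<and> z < q)"
          using consecutive_in_finite_set[OF fin z ab(2), of y] xzy by auto
        have py: "p < y" using pq yS by (metis nat_less_le)
        have "z \<le> p" using pq z xzy by (meson not_less order.strict_trans)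
        have "{p,q} \<in> D" using gap pq py by simp
        from nc[OF xy this _ py] show False using \<open>z \<le> p\<close> xzy pq by simp
      qed
      \<comment> \<open>Now {x, y} is a chord of \<open>S\<close> with z on one side and a or b on
        the other, since (x, y) differs from (a, b); but a chord lying in \<open>D\<close> has to be
        an edge of \<open>S\<close>.\<close>
      ultimately have "cyc_consec N S x y \<or> cyc_consec N S y x" using chords xy by simp
      moreover have "\<not> cyc_consec N S x y"
        using cyc_consec_iff(1)[OF SN \<open>x \<in> S\<close> \<open>y \<in> S\<close>] xzy z by auto
      moreover have "\<not> cyc_consec N S y x"
      proof
        assume "cyc_consec N S y x"
        hence "\<forall>z\<in>S. x \<le> z \<and> z \<le> y" using cyc_consec_iff(2)[OF SN \<open>x \<in> S\<close> \<open>y \<in> S\<close>] xzy by simp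
        thus False using xyE ab by (metis antisym)
      qed
      ultimately show False by simp
    qed
    thus "z \<in> cellset (rooted_arcs N D) a b" using ab(3)[OF z] by (auto simp: cellset_def)
  next
    assume z: "z \<in> cellset (rooted_arcs N D) a b"
    show "z \<in> S"
    proof (rule ccontr)
      assume zS: "z \<notin> S"
      have "a \<le> z" "z < b" using z zS ab(2) by (auto simp: cellset_def le_less)
      then obtain p q where pq: "p \<in> S" "q \<in> S" "p \<le> z" "z < q" "\<forall>z\<in>S. \<not> (p < z \<and> z < q)"
        using consecutive_in_finite_set[OF fin ab(1,2)] by metis
      have pz: "p < z" using pq zS by (metis nat_less_le)
      hence "{p,q} \<in> D" using gap pq by simp
      hence "(p,q) \<in> rooted_arcs N D" using pz pq by (simp add: rooted_arcs_def arcs_def)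
      moreover have "(p,q) \<noteq> (a,b)"
      proof
        assume "(p,q) = (a,b)"
        hence "S \<subseteq> {p,q}" using pq(5) ab(3) by force
        hence "card S \<le> card {p,q}" by (intro card_mono) auto
        thus False using c3 pz pq by (simp add: card_insert_if split: if_splits)
      qed
      ultimately show False using z pz pq ab(3) by (auto simp: cellset_def)
    qed
  qed
  thus "S = cellset (rooted_arcs N D) (Min S) (Max S)" by (auto simp: a_def b_def)
qed

lemma bij_betw_cellset_subgons:
  assumes D: "dissection N D" and N: "3 \<le> N"
  shows "bij_betw (\<lambda>(a,b). cellset (rooted_arcs N D) a b) (rooted_arcs N D) (subgons N D)"
proof (rule bij_betw_byWitness[where f' = "\<lambda>S. (Min S, Max S)"])
  show "\<forall>e\<in>rooted_arcs N D. (\<lambda>S. (Min S, Max S)) ((\<lambda>(a,b). cellset (rooted_arcs N D) a b) e) = e"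
    using subgon_cellset[OF D N] by auto
  show "\<forall>S\<in>subgons N D. (\<lambda>(a,b). cellset (rooted_arcs N D) a b) (Min S, Max S) = S"
    using subgon_eq_cellset[OF D N] by (auto simp: subgons_def)
  show "(\<lambda>(a,b). cellset (rooted_arcs N D) a b) ` rooted_arcs N D \<subseteq> subgons N D"
    using subgon_cellset[OF D N] by (auto simp: subgons_def)
  show "(\<lambda>S. (Min S, Max S)) ` subgons N D \<subseteq> rooted_arcs N D"
    using subgon_eq_cellset[OF D N] by (auto simp: subgons_def)
qed

section \<open>Counting and rotating dissections\<close>

lemma finite_subgons: "finite (subgons N D)"
  by (rule finite_subset[of _ "Pow {..<N}"]) (auto simp: subgons_def subgon_def)

lemma card_subgons_of_size:
  assumes "dissection N D" "3 \<le> N"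
  shows "card {S \<in> subgons N D. card S = i + 2} = card (arcs_of_type (rooted_arcs N D) i)"
proof (rule bij_betw_same_card[symmetric])
  note b = bij_betw_cellset_subgons[OF assms]
  show "bij_betw (\<lambda>(a,b). cellset (rooted_arcs N D) a b) (arcs_of_type (rooted_arcs N D) i)
     {S \<in> subgons N D. card S = i + 2}"
  proof (rule bij_betw_imageI)
    show "inj_on (\<lambda>(a,b). cellset (rooted_arcs N D) a b) (arcs_of_type (rooted_arcs N D) i)"
      using bij_betw_imp_inj_on[OF b] by (rule inj_on_subset) (auto simp: arcs_of_type_def)
    show "(\<lambda>(a,b). cellset (rooted_arcs N D) a b) ` arcs_of_type (rooted_arcs N D) i
        = {S \<in> subgons N D. card S = i + 2}"
      unfolding bij_betw_imp_surj_on[OF b, symmetric] arcs_of_type_def by auto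
  qed
qed

lemma dissection_image_arcs:
  assumes F: "arcset (N - 1) F" "(0, N - 1) \<notin> F"
  shows "arcs ((\<lambda>(x,y). {x,y}) ` F) = F" "dissection N ((\<lambda>(x,y). {x,y}) ` F)"
proof -
  have lt: "x < y \<and> x + 2 \<le> y \<and> y < N" if "(x,y) \<in> F" for x y
    using arcset_bounds[OF F(1) that] by linarith
  show arcs: "arcs ((\<lambda>(x,y). {x,y}) ` F) = F"
  proof (rule set_eqI, clarify)
    fix x y
    show "(x,y) \<in> arcs ((\<lambda>(x,y). {x,y}) ` F) \<longleftrightarrow> (x,y) \<in> F"
      using lt by (force simp: arcs_def doubleton_eq_iff)
  qed
  show "dissection N ((\<lambda>(x,y). {x,y}) ` F)"
    unfolding dissection_iff
  proof (intro conjI ballI allI impI)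
    fix d assume "d \<in> (\<lambda>(x,y). {x,y}) ` F"
    then obtain x y where d: "d = {x,y}" and xy: "(x,y) \<in> F" by auto
    moreover have "\<not> (x = 0 \<and> y = N - 1)" using xy F(2) by auto
    ultimately show "is_diagonal N d" using lt[OF xy] is_diagonal_iff[of x y N] by auto
  next
    fix x y u v
    assume as: "{x,y} \<in> (\<lambda>(x,y). {x,y}) ` F" "{u,v} \<in> (\<lambda>(x,y). {x,y}) ` F" "x < u" "u < y"
    show "v \<le> y"
    proof (cases "u < v")
      case True
      hence "(x,y) \<in> arcs ((\<lambda>(x,y). {x,y}) ` F)" "(u,v) \<in> arcs ((\<lambda>(x,y). {x,y}) ` F)"
        unfolding arcs_def mem_Collect_eq case_prod_conv using as True by linarith+
      hence "(x,y) \<in> F" "(u,v) \<in> F" by (simp_all only: arcs)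
      thus ?thesis by (rule arcset_noncrossing[OF F(1) _ _ as(3,4)])
    next
      case False thus ?thesis using as by simp
    qed
  qed
qed

text \<open>\<open>A_mu\<close> prescribes the types from 1 to n, \<open>arcsets_of_type\<close>
  prescribes all of them; with M = n + 1 this closes the difference.\<close>

lemma arcs_of_type_out_of_range:
  assumes E: "arcset M E" and i: "i = 0 \<or> M \<le> i"
  shows "arcs_of_type E i = {}"
proof -
  have "card (cellset E a b) \<noteq> i + 2" if "(a,b) \<in> E" for a b
  proof -
    have "a + 2 \<le> b" "b \<le> M" using arcset_bounds[OF E that] by auto
    moreover have "card (cellset E a b) \<le> card {a..b}" by (intro card_mono) (auto simp: cellset_def)
    ultimately show ?thesis using card_cellset_ge_3[OF E, of a b] i by auto
  qed
  thus ?thesis by (auto simp: arcs_of_type_def)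
qed

text \<open>The root is adjoined as an arc \<open>(0, n + 1)\<close>, which gives c = 1 and M = n +
  1. Each subgon is then the cell of exactly one arc, so K is the number of subgons.\<close>

theorem card_A_mu:
  assumes n: "1 \<le> n" "n = (\<Sum>i=1..n. i * mu i)"
  shows "card (A_mu n mu) * (fact (n + 1) * (\<Prod>i=1..n. fact (mu i))) = fact (n + (\<Sum>i=1..n. mu i))"
proof -
  define m where "m = (\<lambda>i. if i \<in> {1..n} then mu i else 0)"
  let ?N = "n + 2"
  have N3: "3 \<le> ?N" using n by simp
  have "bij_betw (rooted_arcs ?N) (A_mu n mu) (arcsets_of_type 1 (n + 1) m)"
  proof (rule bij_betw_byWitness[where f' = "\<lambda>E. (\<lambda>(x,y). {x,y}) ` (E - {(0, n + 1)})"])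
    have "arcs D = rooted_arcs ?N D - {(0, n + 1)}" if "dissection ?N D" for D
      using dissection_arc_bounds[OF that, of 0 "n + 1"] by (auto simp: rooted_arcs_def)
    thus "\<forall>D\<in>A_mu n mu. (\<lambda>(x,y). {x,y}) ` (rooted_arcs ?N D - {(0, n + 1)}) = D"
      using dissection_eq_image_arcs by (metis (no_types, lifting) A_mu_def mem_Collect_eq)
    have E: "dissection ?N ((\<lambda>(x,y). {x,y}) ` (E - {(0, n + 1)})) \<and>
        rooted_arcs ?N ((\<lambda>(x,y). {x,y}) ` (E - {(0, n + 1)})) = E"
      if "E \<in> arcsets_of_type 1 (n + 1) m" for E
    proof -
      have E: "arcset (n + 1) E" "card (exposed E (n + 1)) = 2" using that by (auto simp: arcsets_of_type_def)
      have root: "(0, n + 1) \<in> E" using exposed_eq_endpoints_iff[OF E(1)] E(2) n by simp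
      have "arcset (?N - 1) (E - {(0, n + 1)})" using arcset_mono[OF E(1)] by simp
      from dissection_image_arcs[OF this] root show ?thesis by (auto simp: rooted_arcs_def)
    qed
    thus "\<forall>E\<in>arcsets_of_type 1 (n + 1) m. rooted_arcs ?N ((\<lambda>(x,y). {x,y}) ` (E - {(0, n + 1)})) = E"
      by blast
    have iff: "(\<forall>i\<in>{1..n}. card {S \<in> subgons ?N D. card S = i + 2} = mu i)
        \<longleftrightarrow> (\<forall>i. card (arcs_of_type (rooted_arcs ?N D) i) = m i)" if D: "dissection ?N D" for D
    proof -
      have "arcset (n + 1) (rooted_arcs ?N D)" using arcset_rooted_arcs[OF D N3] by simp
      hence "card (arcs_of_type (rooted_arcs ?N D) i) = 0" if "i \<notin> {1..n}" for i
        using arcs_of_type_out_of_range[of "n + 1" "rooted_arcs ?N D" i] that by force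
      thus ?thesis unfolding card_subgons_of_size[OF D N3] m_def by (metis (full_types))
    qed
    have "rooted_arcs ?N D \<in> arcsets_of_type 1 (n + 1) m" if "D \<in> A_mu n mu" for D
    proof -
      have D: "dissection ?N D" using that by (simp add: A_mu_def)
      have ac: "arcset (n + 1) (rooted_arcs ?N D)" using arcset_rooted_arcs[OF D N3] by simp
      have "(0, n + 1) \<in> rooted_arcs ?N D" by (simp add: rooted_arcs_def)
      hence "card (exposed (rooted_arcs ?N D) (n + 1)) = 2"
        using exposed_eq_endpoints_iff[OF ac] n by simp
      thus ?thesis using that iff[OF D] ac by (simp add: arcsets_of_type_def A_mu_def)
    qed
    thus "rooted_arcs ?N ` A_mu n mu \<subseteq> arcsets_of_type 1 (n + 1) m" by blast
    show "(\<lambda>E. (\<lambda>(x,y). {x,y}) ` (E - {(0, n + 1)})) ` arcsets_of_type 1 (n + 1) m \<subseteq> A_mu n mu"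
    proof clarify
      fix E assume as: "E \<in> arcsets_of_type 1 (n + 1) m"
      note E' = E[OF as]
      show "(\<lambda>(x,y). {x,y}) ` (E - {(0, n + 1)}) \<in> A_mu n mu"
        using E' iff[OF conjunct1[OF E']] as by (simp add: A_mu_def arcsets_of_type_def)
    qed
  qed
  hence "card (A_mu n mu) = card (arcsets_of_type 1 (n + 1) m)" by (rule bij_betw_same_card)
  moreover have "card (arcsets_of_type 1 (n + 1) m) * (fact (n + 1) * (\<Prod>i=1..n. fact (m i)))
      = 1 * fact (n + 1 + sum m {1..n} - 1)"
  proof (rule card_arcsets_of_type)
    have "(\<Sum>i=1..n. i * m i) = (\<Sum>i=1..n. i * mu i)" by (rule sum.cong) (auto simp: m_def)
    thus "n + 1 = 1 + (\<Sum>i=1..n. i * m i)" using n(2) by simp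
  qed (auto simp: m_def)
  moreover have "(\<Prod>i=1..n. fact (m i)) = ((\<Prod>i=1..n. fact (mu i)) :: nat)"
    "sum m {1..n} = sum mu {1..n}" by (auto intro!: prod.cong sum.cong simp: m_def)
  ultimately show ?thesis by simp
qed

section \<open>Rotations as translations modulo N\<close>

definition turn :: "nat \<Rightarrow> nat \<Rightarrow> nat set set \<Rightarrow> nat set set" where
  "turn N a D = (\<lambda>d. (\<lambda>v. (v + a) mod N) ` d) ` D"

lemma rot_dissection_eq_turn:
  assumes "0 < N"
  shows "rot_dissection N j D = turn N (nat ((- j) mod int N)) D"
proof -
  have "rot_vertex N j v = (v + nat ((- j) mod int N)) mod N" for v
  proof -
    have "int ((v + nat ((- j) mod int N)) mod N) = (int v - j) mod int N"
      using assms by (simp add: zmod_int mod_simps)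
    thus ?thesis unfolding rot_vertex_def by (metis nat_int)
  qed
  thus ?thesis by (simp add: rot_dissection_def turn_def)
qed

lemma turn_turn: "turn N a (turn N b D) = turn N (a + b) D"
  by (simp add: turn_def image_image mod_simps add.assoc add.commute[of b a])

lemma turn_mod: "turn N (a mod N) D = turn N a D"
  by (simp add: turn_def mod_simps)

lemma turn_mono: "D \<subseteq> D' \<Longrightarrow> turn N a D \<subseteq> turn N a D'"
  by (auto simp: turn_def)

lemma turn_0: "(\<And>e. e \<in> D \<Longrightarrow> e \<subseteq> {..<N}) \<Longrightarrow> turn N 0 D = D"
proof -
  assume *: "\<And>e. e \<in> D \<Longrightarrow> e \<subseteq> {..<N}"
  have "(\<lambda>v. (v + 0) mod N) ` d = d" if "d \<in> D" for d
    using *[OF that] by (force simp: image_iff)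
  thus ?thesis by (simp add: turn_def)
qed

lemma dissection_vertices: "dissection N D \<Longrightarrow> e \<in> D \<Longrightarrow> e \<subseteq> {..<N}"
  by (force simp: dissection_def is_diagonal_def)

lemma turn_multiple:
  assumes "dissection N D" "a mod N = 0"
  shows "turn N a D = D"
  using turn_0[of D N] turn_mod[of N a D] dissection_vertices[OF assms(1)] assms(2) by simp

lemma turn_cong: "a mod N = b mod N \<Longrightarrow> turn N a D = turn N b D"
  by (metis turn_mod)

lemma turn_fixed_mult:
  assumes "dissection N D" "turn N a D = D"
  shows "turn N (j * a) D = D"
proof (induction j)
  case 0 thus ?case using turn_multiple[OF assms(1), of 0] by simp
next
  case (Suc j) thus ?case using turn_turn[of N a "j * a" D] assms by simp
qed

lemma doubleton_in_turn_iff: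
  assumes D: "\<And>e. e \<in> D \<Longrightarrow> e \<subseteq> {..<N}" and ab: "(a + b) mod N = 0" and pq: "p < N" "q < N"
  shows "{p,q} \<in> turn N a D \<longleftrightarrow> {(p + b) mod N, (q + b) mod N} \<in> D"
proof
  have [simp]: "turn N (a + b) D = D" using turn_0[of D N] turn_mod[of N "a + b" D] D ab by simp
  have im: "(\<lambda>v. (v + c) mod N) ` e \<in> turn N c X" if "e \<in> X" for c e X
    using that by (auto simp: turn_def)
  show "{(p + b) mod N, (q + b) mod N} \<in> D" if "{p,q} \<in> turn N a D"
    using im[OF that, of b] by (simp add: turn_turn add.commute[of b a])
  show "{p,q} \<in> turn N a D" if "{(p + b) mod N, (q + b) mod N} \<in> D"
  proof -
    have "((v + b) mod N + a) mod N = v" if "v < N" for v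
    proof -
      have "((v + b) mod N + a) mod N = (v + (a + b)) mod N" by (simp add: mod_simps ac_simps)
      also have "\<dots> = (v + (a + b) mod N) mod N" by (simp add: mod_simps)
      finally show ?thesis using that ab by simp
    qed
    thus ?thesis using im[OF that, of a] pq by simp
  qed
qed

text \<open>Under one step only the vertex N - 1 changes its place in the order: arcs ending there
  become arcs at 0.\<close>

lemma arcs_turn_1:
  assumes D: "dissection N D"
  shows "(p,q) \<in> arcs (turn N 1 D) \<longleftrightarrow>
    q < N \<and> (0 < p \<and> (p - 1, q - 1) \<in> arcs D \<or> p = 0 \<and> (q - 1, N - 1) \<in> arcs D)"
proof -
  have le: "q < N" if "(p,q) \<in> arcs (turn N 1 D)"
  proof -
    obtain d where d: "d \<in> D" "{p,q} = (\<lambda>v. (v + 1) mod N) ` d"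
      using \<open>(p,q) \<in> arcs (turn N 1 D)\<close> unfolding arcs_def turn_def by blast
    hence "q \<in> (\<lambda>v. (v + 1) mod N) ` d" by blast
    then obtain v where "v \<in> d" "q = (v + 1) mod N" by blast
    moreover have "v < N" using dissection_vertices[OF D d(1)] \<open>v \<in> d\<close> by blast
    ultimately show ?thesis by simp
  qed
  have "(p,q) \<in> arcs (turn N 1 D) \<longleftrightarrow>
    0 < p \<and> (p - 1, q - 1) \<in> arcs D \<or> p = 0 \<and> (q - 1, N - 1) \<in> arcs D" if q: "q < N"
  proof (cases "p < q")
    case True
    have m: "(v + (N - 1)) mod N = (if v = 0 then N - 1 else v - 1)" if "v < N" for v
    proof (cases v)
      case (Suc w)
      hence "v + (N - 1) = w + N" using that by simp
      thus ?thesis using Suc that by simp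
    qed (use that in simp)
    have "{p,q} \<in> turn N 1 D \<longleftrightarrow> {(p + (N - 1)) mod N, (q + (N - 1)) mod N} \<in> D"
      using q True by (intro doubleton_in_turn_iff) (use dissection_vertices[OF D] in auto)
    also have "(p + (N - 1)) mod N = (if p = 0 then N - 1 else p - 1)" using m[of p] True q by simp
    also have "(q + (N - 1)) mod N = q - 1" using m[of q] True q by simp
    finally have *: "{p,q} \<in> turn N 1 D \<longleftrightarrow> {if p = 0 then N - 1 else p - 1, q - 1} \<in> D" .
    show ?thesis
    proof (cases "p = 0")
      case p: True
      have "(q - 1, N - 1) \<in> arcs D \<longleftrightarrow> {N - 1, q - 1} \<in> D"
        using True q by (auto simp: arcs_def insert_commute)
      thus ?thesis using True p * by (simp add: arcs_def)
    next
      case False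
      moreover from this have "p - 1 < q - 1" using True by linarith
      ultimately show ?thesis using True * by (simp add: arcs_def)
    qed
  next
    case False
    have "(p,q) \<notin> arcs (turn N 1 D)" "(p - 1, q - 1) \<notin> arcs D" using False
      unfolding arcs_def mem_Collect_eq case_prod_conv by linarith+
    moreover have "(q - 1, N - 1) \<notin> arcs D" if "p = 0"
      using False that dissection_arc_bounds[OF D, of 0 "N - 1"] by auto
    ultimately show ?thesis by blast
  qed
  thus ?thesis using le by blast
qed

text \<open>Crossing is defined through the order of the vertex numbers, which a rotation breaks. In
  a single step the damage is confined to the arcs at N - 1, hence the induction on the
  angle.\<close>

lemma dissection_turn:
  assumes "dissection N D"
  shows "dissection N (turn N a D)"
proof (induction a)
  case 0 thus ?case using turn_multiple[OF assms, of 0] assms by simp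
next
  case (Suc a)
  have step: "dissection N (turn N 1 D)" if D: "dissection N D" for D
  proof (cases "D = {}")
    case True thus ?thesis by (simp add: turn_def dissection_def)
  next
    case False
    let ?F = "arcs (turn N 1 D)"
    note iff = arcs_turn_1[OF D]
    have ac: "arcset (N - 1) ?F"
      unfolding arcset_def
    proof (intro conjI allI impI)
      fix a b assume "(a,b) \<in> ?F"
      thus "a + 2 \<le> b" "b \<le> N - 1" unfolding iff
        using dissection_arc_bounds[OF D, of "a-1" "b-1"] dissection_arc_bounds[OF D, of "b-1" "N-1"] by auto
    next
      fix a b c e assume as: "(a,b) \<in> ?F" "(c,e) \<in> ?F" "a < c" "c < b"
      have nc: "v \<le> y" if "(x,y) \<in> arcs D" "(u,v) \<in> arcs D" "x < u" "u < y" for x y u v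
        using dissection_noncrossing[OF D] that unfolding arcs_def by blast
      have ce: "(c - 1, e - 1) \<in> arcs D" "e < N" using as iff[of c e] by auto
      show "e \<le> b"
      proof (cases "a = 0")
        case True
        hence "(b - 1, N - 1) \<in> arcs D" using as iff[of a b] by auto
        thus ?thesis using nc[OF ce(1) \<open>(b - 1, N - 1) \<in> arcs D\<close>] as ce
            dissection_arc_bounds[OF D ce(1)] by force
      next
        case False
        hence "(a - 1, b - 1) \<in> arcs D" using as iff[of a b] by auto
        thus ?thesis using nc[OF \<open>(a - 1, b - 1) \<in> arcs D\<close> ce(1)] as False by force
      qed
    qed
    have "(0, N - 1) \<notin> ?F" unfolding iff
      using dissection_arc_bounds[OF D, of "N - 1 - 1" "N - 1"] by auto
    note di = dissection_image_arcs(2)[OF ac this]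
    have "turn N 1 D = (\<lambda>(x,y). {x,y}) ` ?F"
    proof -
      have "e \<in> (\<lambda>(x,y). {x,y}) ` ?F" if e: "e \<in> turn N 1 D" for e
      proof -
        obtain d where d: "d \<in> D" "e = (\<lambda>v. (v + 1) mod N) ` d" using e by (auto simp: turn_def)
        obtain x y where xy: "d = {x,y}" "x < y" using D d is_diagonalE unfolding dissection_def by blast
        have b: "x + 2 \<le> y" "y < N" using dissection_arc_bounds[OF D, of x y] d xy by (auto simp: arcs_def)
        have "e = {Suc x mod N, Suc y mod N}" using d xy by auto
        moreover have "Suc x mod N \<noteq> Suc y mod N" using b by (auto simp: mod_Suc)
        ultimately obtain p q where "e = {p,q}" "p < q"
          by (metis insert_commute nat_neq_iff)
        thus ?thesis using e by (intro image_eqI[of _ _ "(p,q)"]) (auto simp: arcs_def)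
      qed
      thus ?thesis by (auto simp: arcs_def)
    qed
    thus ?thesis using di by simp
  qed
  show ?case using step[OF Suc] turn_turn[of N 1 a D] by simp
qed

lemma inj_on_shift_mod: "inj_on (\<lambda>v. (v + a) mod N) {..<N::nat}"
proof (rule inj_onI)
  fix x y assume as: "x \<in> {..<N}" "y \<in> {..<N}" "(x + a) mod N = (y + a) mod N"
  hence "int (x + a) mod int N = int (y + a) mod int N" by (metis zmod_int)
  hence "int x mod int N = int y mod int N" by (simp add: mod_eq_dvd_iff)
  thus "x = y" using as by (simp add: zmod_int[symmetric])
qed

text \<open>Cyclic adjacency depends only on differences modulo N, so in contrast to non-crossing it
  can be rotated through any angle at once.\<close>

lemma subgon_turn:
  assumes D: "dissection N D" and N: "0 < N" and S: "subgon N D S"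
  shows "subgon N (turn N a D) ((\<lambda>v. (v + a) mod N) ` S)"
proof -
  let ?r = "\<lambda>v. (v + a) mod N"
  have SN: "S \<subseteq> {..<N}" using S by (simp add: subgon_def)
  have diff: "(int (?r y) - int (?r x)) mod int N = (int y - int x) mod int N" for x y
    by (simp add: zmod_int mod_simps)
  have inj: "inj_on ?r {..<N}" by (rule inj_on_shift_mod)
  have eq: "?r x = ?r y \<longleftrightarrow> x = y" if "x \<in> S" "y \<in> S" for x y
    using inj SN that by (auto simp: inj_on_def)
  have cc: "cyc_consec N (?r ` S) (?r x) (?r y) \<longleftrightarrow> cyc_consec N S x y" if "x \<in> S" "y \<in> S" for x y
    using that eq unfolding cyc_consec_def by (auto simp: diff)
  have side: "side N (?r x) (?r y)" if s: "side N x y" for x y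
  proof -
    have "?r z = Suc (?r w) mod N" if "z = Suc w mod N" for z w
      unfolding that by (metis add_Suc mod_Suc_eq mod_add_left_eq)
    moreover have "x < N" "y < N" "x \<noteq> y" using s by (simp_all add: side_def)
    hence "?r x \<noteq> ?r y" using inj_on_eq_iff[OF inj, of x y] by simp
    moreover have "?r x < N" "?r y < N" using N by simp_all
    ultimately show ?thesis using s unfolding side_def by blast
  qed
  have card: "card (?r ` S) = card S" using inj SN by (meson card_image inj_on_subset)
  have 1: "side N x y \<or> {x,y} \<in> turn N a D" if xy: "cyc_consec N (?r ` S) x y" for x y
  proof -
    obtain u v where uv: "u \<in> S" "v \<in> S" "x = ?r u" "y = ?r v" using xy by (auto simp: cyc_consec_def)
    hence "cyc_consec N S u v" using xy cc by simp
    hence "side N u v \<or> {u,v} \<in> D" using S by (simp add: subgon_def)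
    moreover have "{x,y} \<in> turn N a D" if "{u,v} \<in> D"
      unfolding turn_def using that uv by (intro image_eqI[of _ _ "{u,v}"]) auto
    ultimately show ?thesis using side[of u v] uv by auto
  qed
  have 2: "cyc_consec N (?r ` S) x y \<or> cyc_consec N (?r ` S) y x"
    if xy: "x \<in> ?r ` S" "y \<in> ?r ` S" "{x,y} \<in> turn N a D" for x y
  proof -
    obtain u where u: "u \<in> S" "x = ?r u" using xy(1) by auto
    obtain v where v: "v \<in> S" "y = ?r v" using xy(2) by auto
    note uv = u(1) v(1) u(2) v(2)
    have b: "(a + (N - a mod N)) mod N = 0"
      using N by (metis add_diff_inverse_nat mod_add_left_eq mod_less_divisor mod_self not_less_iff_gr_or_eq)
    have unturn: "(?r w + (N - a mod N)) mod N = w" if "w \<in> S" for w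
    proof -
      have "(?r w + (N - a mod N)) mod N = (w + (a + (N - a mod N)) mod N) mod N"
        by (simp add: mod_simps add.assoc)
      thus ?thesis using that SN b by auto
    qed
    have "x < N" "y < N" using N uv by simp_all
    hence "{x,y} \<in> turn N a D \<longleftrightarrow> {(x + (N - a mod N)) mod N, (y + (N - a mod N)) mod N} \<in> D"
      by (intro doubleton_in_turn_iff dissection_vertices[OF D] b)
    hence "{u,v} \<in> D" using xy uv unturn by simp
    thus ?thesis using S uv cc by (auto simp: subgon_def)
  qed
  show ?thesis unfolding subgon_def card using S 1 2 N by (auto simp: subgon_def)
qed

lemma card_subgons_of_size_turn:
  assumes D: "dissection N D" and N: "0 < N"
  shows "card {S \<in> subgons N (turn N a D). card S = k} = card {S \<in> subgons N D. card S = k}"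
proof -
  have le: "card {S \<in> subgons N D. card S = k} \<le> card {S \<in> subgons N (turn N a D). card S = k}"
    if D: "dissection N D" for a D
  proof (rule card_inj_on_le)
    let ?r = "\<lambda>v. (v + a) mod N"
    have sub: "S \<subseteq> {..<N}" if "S \<in> subgons N D" for S using that by (simp add: subgons_def subgon_def)
    have inj: "inj_on ?r {..<N}" by (rule inj_on_shift_mod)
    show "inj_on (image ?r) {S \<in> subgons N D. card S = k}"
    proof (rule inj_onI)
      fix S T assume "S \<in> {S \<in> subgons N D. card S = k}" "T \<in> {S \<in> subgons N D. card S = k}"
        and eq: "?r ` S = ?r ` T"
      hence "S \<subseteq> {..<N}" "T \<subseteq> {..<N}" using sub by simp_all
      thus "S = T" using eq inj_on_image_eq_iff[OF inj] by simp
    qed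
    show "image ?r ` {S \<in> subgons N D. card S = k} \<subseteq> {S \<in> subgons N (turn N a D). card S = k}"
    proof clarify
      fix S assume S: "S \<in> subgons N D" "k = card S"
      have "card (?r ` S) = card S" using inj_on_subset[OF inj sub[OF S(1)]] by (rule card_image)
      thus "?r ` S \<in> subgons N (turn N a D) \<and> card (?r ` S) = card S"
        using subgon_turn[OF D N, of S a] S by (simp add: subgons_def)
    qed
    show "finite {S \<in> subgons N (turn N a D). card S = k}" using finite_subgons[of N] by simp
  qed
  have "(N - a mod N + a) mod N = 0"
  proof -
    have "(N - a mod N + a) mod N = (N - a mod N + a mod N) mod N" by (simp only: mod_add_right_eq)
    also have "N - a mod N + a mod N = N" using N by (simp add: less_imp_le)
    finally show ?thesis by simp
  qed
  hence "turn N (N - a mod N) (turn N a D) = D"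
    using turn_multiple[OF D, of "N - a mod N + a"] unfolding turn_turn by simp
  thus ?thesis using le[OF D, of a] le[OF dissection_turn[OF D, of a], of "N - a mod N"] by simp
qed

section \<open>Dissections with rotational symmetry\<close>

text \<open>Translates of \<open>E\<close> by multiples of M. The vertex d M is 0 again, so the arcs
  \<open>(u,M)\<close> of the last block are cut off by \<open>y < d * M\<close> and reappear with 0
  as left end in the second clause.\<close>

definition block_arcs :: "nat \<Rightarrow> nat \<Rightarrow> (nat \<times> nat) set \<Rightarrow> (nat \<times> nat) set" where
  "block_arcs d M E = {(x,y). (\<exists>j u v. j < d \<and> (u,v) \<in> E \<and> x = u + j * M \<and> y = v + j * M \<and> y < d * M)
     \<or> x = 0 \<and> (\<exists>u. (u,M) \<in> E \<and> y = u + (d - 1) * M)}"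

text \<open>No diagonal cuts 0 off from the centre: the span y - x of a diagonal avoiding 0 stays
  below N - M, while under invariance by the turn through M each span is at most M or at least N -
  M. For d = 2 the strict inequality also excludes a diameter away from 0.\<close>

definition central_0 :: "nat \<Rightarrow> nat \<Rightarrow> nat set set \<Rightarrow> bool" where
  "central_0 N M D \<longleftrightarrow> (\<forall>(x,y)\<in>arcs D. 0 < x \<longrightarrow> y + M < N + x)"

definition block_restrict :: "nat \<Rightarrow> nat set set \<Rightarrow> (nat \<times> nat) set" where
  "block_restrict M D = {(x,y) \<in> arcs D. y \<le> M}"

lemma last_block_le: "2 \<le> d \<Longrightarrow> M \<le> (d - 1) * (M::nat)"
  by (cases "d - 1") auto

lemma pred_mult_add: "1 \<le> d \<Longrightarrow> (d - 1) * M + M = d * (M::nat)"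
  by (cases d) auto

section \<open>Building a symmetric dissection from one period\<close>

locale blocks =
  fixes d M N :: nat
  assumes d2: "2 \<le> d" and N_eq: "N = d * M" and N3: "3 \<le> N"
begin

lemma M_pos: "0 < M"
  using N_eq N3 by (cases M) auto

lemma N_split: "(d - 1) * M + M = N"
  using pred_mult_add[of d M] d2 N_eq by simp

lemma two_M_le: "2 * M \<le> N"
  unfolding N_eq using d2 by (rule mult_le_mono1)

lemma M_lt: "M < N - 1"
  using two_M_le N3 by linarith

lemma mult_lt: "j < d \<Longrightarrow> j * M + M \<le> N"
  unfolding N_eq using mult_le_mono1[of "Suc j" d M] by simp

lemma block_eqI:
  assumes "j' * M < v + j * M" "v \<le> M" "j * M < v' + j' * M" "v' \<le> M"
  shows "j' = j"
proof -
  have "j' * M < Suc j * M" "j * M < Suc j' * M" using assms by simp_all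
  hence "j' < Suc j" "j < Suc j'" by (simp_all only: mult_less_cancel2)
  thus ?thesis by simp
qed

lemma arcset_block_arcs:
  assumes E: "arcset M E"
  shows "arcset (N - 1) (block_arcs d M E)" "(0, N - 1) \<notin> block_arcs d M E"
proof -
  have bE: "u + 2 \<le> v" "v \<le> M" if "(u,v) \<in> E" for u v using arcset_bounds[OF E that] by auto
  show ac: "arcset (N - 1) (block_arcs d M E)"
    unfolding arcset_def
  proof (intro conjI allI impI)
    fix a b assume ab: "(a,b) \<in> block_arcs d M E"
    show "a + 2 \<le> b"
      using ab unfolding block_arcs_def
    proof (clarsimp, elim disjE exE conjE)
      fix u assume "(u,M) \<in> E" "a = 0" "b = u + (d - Suc 0) * M"
      moreover have "M \<le> (d - Suc 0) * M" using last_block_le[OF d2, of M] by simp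
      moreover have "2 \<le> M" using bE(1)[OF calculation(1)] by simp
      ultimately show "Suc (Suc a) \<le> b" by linarith
    qed (use bE in force)
    show "b \<le> N - 1"
      using ab unfolding block_arcs_def
    proof (clarsimp, elim disjE exE conjE)
      fix u assume "(u,M) \<in> E" "a = 0" "b = u + (d - Suc 0) * M"
      thus "b \<le> N - Suc 0" using bE(1)[of u M] N_split by simp
    qed (use N_eq in force)
  next
    fix a b c e assume ab: "(a,b) \<in> block_arcs d M E" and ce: "(c,e) \<in> block_arcs d M E"
      and ac: "a < c" and cb: "c < b"
    obtain j' u' v' where c: "j' < d" "(u',v') \<in> E" "c = u' + j' * M" "e = v' + j' * M" "e < d * M"
      using ce ac unfolding block_arcs_def by force
    note b' = bE[OF c(2)]
    show "e \<le> b"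
    proof (rule ccontr)
      assume neg: "\<not> e \<le> b"
      have "(\<exists>j u v. j < d \<and> (u,v) \<in> E \<and> a = u + j * M \<and> b = v + j * M \<and> b < d * M)
         \<or> a = 0 \<and> (\<exists>u. (u,M) \<in> E \<and> b = u + (d - 1) * M)"
        using ab unfolding block_arcs_def by simp
      thus False
      proof (elim disjE exE conjE)
        fix j u v assume a: "(u,v) \<in> E" "a = u + j * M" "b = v + j * M"
        note b = bE[OF a(1)]
        have "j' = j" by (rule block_eqI[of j' v j v']) (use a c b b' ac cb neg in linarith)+
        thus False using arcset_noncrossing[OF E a(1) c(2)] a c ac cb neg by simp
      next
        fix u assume a: "(u,M) \<in> E" "a = 0" "b = u + (d - 1) * M"
        note b = bE[OF a(1)]
        have "j' = d - 1"
        proof (rule block_eqI[of j' M "d - 1" v'])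
          show "j' * M < M + (d - 1) * M" using c(1) N_split mult_lt[OF c(1)] M_pos by linarith
          show "(d - 1) * M < v' + j' * M" using c a neg by linarith
        qed (use b' in auto)
        hence "u' < u" "u < v'" "v' < M" using c a cb neg N_split N_eq by simp_all
        thus False using arcset_noncrossing[OF E c(2) a(1)] by simp
      qed
    qed
  qed
  show "(0, N - 1) \<notin> block_arcs d M E"
  proof
    assume "(0, N - 1) \<in> block_arcs d M E"
    hence "(\<exists>j u v. j < d \<and> (u,v) \<in> E \<and> 0 = u + j * M \<and> N - 1 = v + j * M)
         \<or> (\<exists>u. (u,M) \<in> E \<and> N - 1 = u + (d - 1) * M)"
      unfolding block_arcs_def by blast
    thus False
    proof (elim disjE exE conjE)
      fix j u v assume "(u,v) \<in> E" "0 = u + j * M" "N - 1 = v + j * M"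
      thus False using bE(2)[of u v] M_lt by linarith
    next
      fix u assume "(u,M) \<in> E" "N - 1 = u + (d - 1) * M"
      thus False using bE(1)[of u M] N_split by linarith
    qed
  qed
qed

lemma block_arcs_restrict:
  assumes E: "arcset M E"
  shows "(x,y) \<in> block_arcs d M E \<and> y \<le> M \<longleftrightarrow> (x,y) \<in> E"
proof
  assume as: "(x,y) \<in> block_arcs d M E \<and> y \<le> M"
  hence "(\<exists>j u v. j < d \<and> (u,v) \<in> E \<and> x = u + j * M \<and> y = v + j * M)
     \<or> x = 0 \<and> (\<exists>u. (u,M) \<in> E \<and> y = u + (d - 1) * M)"
    unfolding block_arcs_def by blast
  thus "(x,y) \<in> E"
  proof (elim disjE exE conjE)
    fix j u v assume a: "(u,v) \<in> E" "x = u + j * M" "y = v + j * M"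
    have "j = 0"
    proof (cases j)
      case (Suc i)
      thus ?thesis using as a arcset_bounds[OF E a(1)] by simp
    qed simp
    thus ?thesis using a by simp
  next
    fix u assume a: "(u,M) \<in> E" "x = 0" "y = u + (d - 1) * M"
    hence "u = 0" "y = M" using as last_block_le[OF d2, of M] by linarith+
    thus ?thesis using a(1,2) by (simp only:)
  qed
next
  assume xy: "(x,y) \<in> E"
  hence "y \<le> M" "y < d * M" using arcset_bounds[OF E xy] M_lt N_eq by linarith+
  moreover from this have "0 < d \<and> (x,y) \<in> E \<and> x = x + 0 * M \<and> y = y + 0 * M \<and> y < d * M"
    using d2 xy by simp
  ultimately show "(x,y) \<in> block_arcs d M E \<and> y \<le> M"
    unfolding block_arcs_def by blast
qed

lemma dissection_block_arcs:
  assumes E: "arcset M E"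
  defines "D \<equiv> (\<lambda>(x,y). {x,y}) ` block_arcs d M E"
  shows "dissection N D" "arcs D = block_arcs d M E" "turn N M D = D" "central_0 N M D" "block_restrict M D = E"
proof -
  have bE: "u + 2 \<le> v" "v \<le> M" if "(u,v) \<in> E" for u v using arcset_bounds[OF E that] by auto
  note di = dissection_image_arcs[OF arcset_block_arcs[OF E], folded D_def]
  show D: "dissection N D" and A: "arcs D = block_arcs d M E" by (rule di)+
  show "block_restrict M D = E"
    using block_arcs_restrict[OF E] unfolding block_restrict_def A by auto
  show "central_0 N M D"
    unfolding central_0_def A
  proof (intro ballI, clarify)
    fix x y assume xy: "(x,y) \<in> block_arcs d M E" "0 < x"
    then obtain j u v where a: "j < d" "(u,v) \<in> E" "x = u + j * M" "y = v + j * M" "y < d * M"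
      unfolding block_arcs_def by force
    note b = bE[OF a(2)]
    show "y + M < N + x"
    proof (rule ccontr)
      assume "\<not> ?thesis"
      hence "v = M" "u = 0" "N = 2 * M" using a b two_M_le by linarith+
      hence "j = 1 \<or> j = 0" using a(1) N_eq M_pos by auto
      thus False using a xy \<open>u = 0\<close> \<open>v = M\<close> \<open>N = 2 * M\<close> N_eq by auto
    qed
  qed
  have sub: "turn N M D \<subseteq> D"
  proof
    fix e assume "e \<in> turn N M D"
    then obtain x y where xy: "(x,y) \<in> block_arcs d M E" and e: "e = {(x + M) mod N, (y + M) mod N}"
      unfolding turn_def D_def by auto
    have mem: "{x,y} \<in> D" if "(x,y) \<in> block_arcs d M E" for x y using that unfolding D_def by force
    have "(\<exists>j u v. j < d \<and> (u,v) \<in> E \<and> x = u + j * M \<and> y = v + j * M \<and> y < d * M)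
         \<or> x = 0 \<and> (\<exists>u. (u,M) \<in> E \<and> y = u + (d - 1) * M)"
      using xy unfolding block_arcs_def by simp
    thus "e \<in> D"
    proof (elim disjE exE conjE)
      fix j u v assume a: "j < d" "(u,v) \<in> E" "x = u + j * M" "y = v + j * M" "y < d * M"
      note b = bE[OF a(2)]
      show ?thesis
      proof (cases "Suc j = d")
        case True
        have jM: "j * M + M = N" using N_split True by auto
        have "x + M = u + N" "y + M = v + N" "u < N" "v < N" using a b jM M_lt by linarith+
        hence "e = {u,v}" using e by simp
        moreover have "(u,v) \<in> block_arcs d M E" using block_arcs_restrict[OF E, of u v] a by blast
        ultimately show ?thesis using mem by simp
      next
        case False
        hence j: "Suc j < d" using a by simp
        have jM: "Suc j * M + M \<le> N" by (rule mult_lt[OF j])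
        have xM: "(x + M) mod N = u + Suc j * M" using a b jM by simp
        show ?thesis
        proof (cases "y + M < N")
          case True
          hence "(u + Suc j * M, v + Suc j * M) \<in> block_arcs d M E"
            unfolding block_arcs_def using j a N_eq by auto
          moreover have "e = {u + Suc j * M, v + Suc j * M}"
            using e xM True a by (simp add: ac_simps)
          ultimately show ?thesis using mem by simp
        next
          case False
          \<comment> \<open>The turned copy lies in the last block with right end N, where the
            second clause of \<open>block_arcs\<close> takes over.\<close>
          hence eq: "v = M" "Suc j * M + M = N" "y + M = N" using jM a b by auto
          hence "Suc j * M = (d - 1) * M" using N_split by simp
          moreover have "e = {0, u + Suc j * M}" using e xM eq by auto
          moreover have "(0, u + (d - 1) * M) \<in> block_arcs d M E"
            unfolding block_arcs_def using a eq by auto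
          ultimately show ?thesis using mem by metis
        qed
      qed
    next
      fix u assume a: "(u,M) \<in> E" "x = 0" "y = u + (d - 1) * M"
      note b = bE[OF a(1)]
      have yM: "y + M = u + N" and "u < N" using a b N_split M_lt by linarith+
      hence "e = {u,M}" using e M_lt unfolding yM a(2) by (simp add: insert_commute)
      moreover have "(u,M) \<in> block_arcs d M E" using block_arcs_restrict[OF E, of u M] a by blast
      ultimately show ?thesis using mem by simp
    qed
  qed
  have sub': "turn N (j * M) D \<subseteq> D" for j
  proof (induction j)
    case 0 thus ?case using turn_multiple[OF D, of 0] by simp
  next
    case (Suc j)
    have "turn N (Suc j * M) D = turn N M (turn N (j * M) D)" by (simp add: turn_turn)
    also have "\<dots> \<subseteq> turn N M D" by (rule turn_mono[OF Suc])
    finally show ?case using sub by simp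
  qed
  \<comment> \<open>The first d - 1 turns stay inside \<open>D\<close> and one more completes the
    full rotation, which upgrades the inclusion to equality.\<close>
  have "D = turn N M (turn N ((d - 1) * M) D)"
    using turn_multiple[OF D, of N] N_split by (simp add: turn_turn add.commute)
  also have "\<dots> \<subseteq> turn N M D" by (rule turn_mono[OF sub'])
  finally show "turn N M D = D" using sub by blast
qed

end

section \<open>Cutting a symmetric dissection into periods\<close>

locale rotational_dissection = blocks +
  fixes D :: "nat set set"
  assumes dis: "dissection N D" and sym: "turn N M D = D"
begin

lemma turn_mult: "turn N (j * M) D = D"
  by (rule turn_fixed_mult[OF dis sym])

lemma rotate_mem:
  assumes "{p,q} \<in> D"
  shows "{(p + j * M) mod N, (q + j * M) mod N} \<in> D"
proof -
  have "(\<lambda>v. (v + j * M) mod N) ` {p,q} \<in> turn N (j * M) D" using assms unfolding turn_def by blast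
  thus ?thesis by (simp add: turn_mult)
qed

lemma arc_bounds:
  assumes "(x,y) \<in> arcs D"
  shows "x + 2 \<le> y" "y < N" "\<not> (x = 0 \<and> y = N - 1)"
  using dissection_arc_bounds[OF dis assms] by auto

text \<open>A diagonal spanning more than M on both sides crosses its own image under the turn by
  M.\<close>

lemma arc_short:
  assumes xy: "(x,y) \<in> arcs D"
  shows "y \<le> x + M \<or> N + x \<le> y + M"
proof (rule ccontr)
  assume neg: "\<not> ?thesis"
  note b = arc_bounds[OF xy]
  have mem: "{x,y} \<in> D" using xy by (simp add: arcs_def)
  from rotate_mem[OF this, of 1] have rot: "{(x + M) mod N, (y + M) mod N} \<in> D" by simp
  have xM: "(x + M) mod N = x + M" using neg b by simp
  show False
  proof (cases "y + M < N")
    case True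
    hence "{x + M, y + M} \<in> D" using rot xM by simp
    from dissection_noncrossing[OF dis mem this] show False using neg M_pos by simp
  next
    case False
    have "(y + M) mod N = y + M - N" using False b M_lt by (simp add: mod_if)
    hence "{y + M - N, x + M} \<in> D" using rot xM by (simp add: insert_commute)
    from dissection_noncrossing[OF dis this mem] show False using neg False M_pos by linarith
  qed
qed

end

locale centered_dissection = rotational_dissection +
  assumes cen: "central_0 N M D"
begin

definition "E = block_restrict M D"

lemma arc_centered: "(x,y) \<in> arcs D \<Longrightarrow> 0 < x \<Longrightarrow> y + M < N + x"
  using cen unfolding central_0_def by blast

lemma arcset_E: "arcset M E"
  unfolding arcset_def E_def block_restrict_def
proof (intro conjI allI impI; clarsimp)
  fix a b assume "(a,b) \<in> arcs D"
  thus "Suc (Suc a) \<le> b" using arc_bounds(1)[of a b] by simp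
next
  fix a b c e assume as: "(a,b) \<in> arcs D" "(c,e) \<in> arcs D" "a < c" "c < b"
  thus "e \<le> b" using dissection_noncrossing[OF dis, of a b c e] by (simp add: arcs_def)
qed

text \<open>All multiples of M are images of 0 and thus central too. For an arc passing over j M,
  rotated so that j M becomes 0, centrality demands x + M < y, whereas \<open>arc_short\<close> and
  centrality before the rotation give y \<le> x + M.\<close>

lemma arc_in_block:
  assumes xy: "(x,y) \<in> arcs D" and x: "0 < x"
  shows "y \<le> x div M * M + M"
proof (rule ccontr)
  assume neg: "\<not> ?thesis"
  define j where "j = Suc (x div M)"
  note b = arc_bounds[OF xy]
  have jM: "x < j * M" "j * M < y"
    using neg M_pos dividend_less_div_times[of M x] by (simp_all add: j_def)
  hence "j * M < d * M" using b N_eq by linarith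
  hence jd: "j < d" by (simp add: mult_less_cancel2[of j M d])
  have split: "(d - j) * M + j * M = N"
    using jd N_eq by (simp add: add_mult_distrib[symmetric])
  have "{x,y} \<in> D" using xy by (simp add: arcs_def)
  from rotate_mem[OF this, of "d - j"]
  have "{(x + (d - j) * M) mod N, (y + (d - j) * M) mod N} \<in> D" .
  moreover have "(x + (d - j) * M) mod N = x + (d - j) * M" using jM split by simp
  moreover have "y + (d - j) * M = (y - j * M) + N" using jM split by simp
  hence "(y + (d - j) * M) mod N = y - j * M" using b by simp
  ultimately have mem: "{y - j * M, x + (d - j) * M} \<in> D" by (simp add: insert_commute)
  have "y - j * M < x + (d - j) * M" using split jM b by linarith
  hence "(y - j * M, x + (d - j) * M) \<in> arcs D" using mem by (simp add: arcs_def)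
  from arc_centered[OF this] have "x + M < y" using jM split by linarith
  thus False using arc_short[OF xy] arc_centered[OF xy x] by linarith
qed

lemma arcs_eq_block_arcs: "arcs D = block_arcs d M E"
proof (rule set_eqI, clarify)
  fix x y
  show "(x,y) \<in> arcs D \<longleftrightarrow> (x,y) \<in> block_arcs d M E"
  proof
    assume xy: "(x,y) \<in> arcs D"
    note b = arc_bounds[OF xy]
    have mem: "{x,y} \<in> D" using xy by (simp add: arcs_def)
    show "(x,y) \<in> block_arcs d M E"
    proof (cases "0 < x")
      case True
      define j where "j = x div M"
      have jx: "j * M \<le> x" "y \<le> j * M + M" using arc_in_block[OF xy True] by (simp_all add: j_def)
      have "j * M < d * M" using jx b N_eq by linarith
      hence jd: "j < d" by (simp add: mult_less_cancel2[of j M d])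
      have split: "(d - j) * M + j * M = N"
        using jd N_eq by (simp add: add_mult_distrib[symmetric])
      have shifted: "x + (d - j) * M = (x - j * M) + N" "y + (d - j) * M = (y - j * M) + N"
        using jx split b by linarith+
      have "(x + (d - j) * M) mod N = x - j * M" "(y + (d - j) * M) mod N = y - j * M"
        unfolding shifted mod_add_self2 using b by simp_all
      hence "{x - j * M, y - j * M} \<in> D" using rotate_mem[OF mem, of "d - j"] by metis
      moreover have "x - j * M < y - j * M" using jx b by linarith
      ultimately have "(x - j * M, y - j * M) \<in> E" using jx
        by (simp add: E_def block_restrict_def arcs_def)
      moreover have "x = (x - j * M) + j * M" "y = (y - j * M) + j * M" "y < d * M"
        using jx b N_eq by linarith+
      ultimately show ?thesis unfolding block_arcs_def using jd by blast
    next
      case False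
      hence x0: "x = 0" by simp
      show ?thesis
      proof (cases "y \<le> M")
        case True
        hence "(x,y) \<in> E" using xy by (simp add: E_def block_restrict_def)
        thus ?thesis using block_arcs_restrict[OF arcset_E] by blast
      next
        case F: False
        \<comment> \<open>An arc at 0 longer than one period has its short side across N; the turn
          by M carries it to an arc of the first block ending at M.\<close>
        hence y: "N \<le> y + M" using arc_short[OF xy] x0 by simp
        have "(x + 1 * M) mod N = M" using x0 M_lt by simp
        moreover have "(y + 1 * M) mod N = y + M - N" using y b M_lt by (simp add: mod_if)
        ultimately have "{y + M - N, M} \<in> D" using rotate_mem[OF mem, of 1] by (simp add: insert_commute)
        hence "(y + M - N, M) \<in> E" using b y by (simp add: E_def block_restrict_def arcs_def)
        moreover have "y = (y + M - N) + (d - 1) * M" using y N_split by linarith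
        ultimately show ?thesis unfolding block_arcs_def using x0 by blast
      qed
    qed
  next
    assume "(x,y) \<in> block_arcs d M E"
    hence "(\<exists>j u v. j < d \<and> (u,v) \<in> E \<and> x = u + j * M \<and> y = v + j * M \<and> y < d * M)
     \<or> x = 0 \<and> (\<exists>u. (u,M) \<in> E \<and> y = u + (d - 1) * M)"
      unfolding block_arcs_def by blast
    thus "(x,y) \<in> arcs D"
    proof (elim disjE exE conjE)
      fix j u v assume a: "(u,v) \<in> E" "x = u + j * M" "y = v + j * M" "y < d * M"
      have uv: "{u,v} \<in> D" "u < v" using a by (auto simp: E_def block_restrict_def arcs_def)
      hence "(u + j * M) mod N = x" "(v + j * M) mod N = y" using a N_eq by auto
      thus ?thesis using rotate_mem[OF uv(1), of j] uv a by (simp add: arcs_def)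
    next
      fix u assume a: "(u,M) \<in> E" "x = 0" "y = u + (d - 1) * M"
      have uv: "{u,M} \<in> D" "u < M" using a by (auto simp: E_def block_restrict_def arcs_def)
      have "(u + (d - 1) * M) mod N = y" using a uv N_split by simp
      moreover have "(M + (d - 1) * M) mod N = 0" using N_split by (simp add: add.commute)
      ultimately have "{x,y} \<in> D" using rotate_mem[OF uv(1), of "d - 1"] a by (simp add: insert_commute)
      moreover have "0 < y" using a last_block_le[OF d2, of M] M_pos by linarith
      ultimately show ?thesis using a by (simp add: arcs_def)
    qed
  qed
qed

lemma D_eq: "D = (\<lambda>(x,y). {x,y}) ` block_arcs d M E"
  using dissection_eq_image_arcs[OF dis] arcs_eq_block_arcs by simp

end

section \<open>Subgons of a centred symmetric dissection\<close>

context centered_dissection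
begin

abbreviation R :: "(nat \<times> nat) set" where "R \<equiv> rooted_arcs N D"
abbreviation X :: "nat set" where "X \<equiv> exposed E M"

definition block_turn :: "nat \<Rightarrow> nat set \<Rightarrow> nat set" where
  "block_turn j S = (\<lambda>v. (v + j * M) mod N) ` S"

definition central_vertices :: "nat set" where
  "central_vertices = {v. v < N \<and> v mod M \<in> X}"

definition block_subgons :: "nat set set" where
  "block_subgons = {S \<in> subgons N D. S \<subseteq> {..M}}"

text \<open>Defined negatively, as what no turn brings into the first block; that there is at most
  one, and when there is one, is derived below.\<close>

definition central_subgons :: "nat set set" where
  "central_subgons = {S \<in> subgons N D. \<forall>j. \<not> block_turn j S \<subseteq> {..M}}"

lemma in_E_iff: "(x,y) \<in> E \<longleftrightarrow> (x,y) \<in> R \<and> y \<le> M"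
  using M_lt unfolding E_def block_restrict_def rooted_arcs_def by auto

lemma cellset_R_eq: "(a,b) \<in> E \<Longrightarrow> cellset R a b = cellset E a b"
  using in_E_iff unfolding cellset_def by (auto; force)

lemma bij_betw_E_block_subgons: "bij_betw (\<lambda>(a,b). cellset E a b) E block_subgons"
proof (rule bij_betw_byWitness[where f' = "\<lambda>S. (Min S, Max S)"])
  have fwd: "cellset E a b \<in> block_subgons \<and> Min (cellset E a b) = a \<and> Max (cellset E a b) = b"
    if "(a,b) \<in> E" for a b
  proof -
    have "(a,b) \<in> R" "b \<le> M" using that in_E_iff by auto
    moreover have "cellset E a b \<subseteq> {..b}" by (auto simp: cellset_def)
    ultimately show ?thesis using subgon_cellset[OF dis N3, of a b] cellset_R_eq[OF that]
      by (auto simp: block_subgons_def subgons_def)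
  qed
  thus "\<forall>e\<in>E. (\<lambda>S. (Min S, Max S)) ((\<lambda>(a,b). cellset E a b) e) = e"
    and "(\<lambda>(a,b). cellset E a b) ` E \<subseteq> block_subgons" by auto
  have bwd: "(Min S, Max S) \<in> E \<and> cellset E (Min S) (Max S) = S" if S: "S \<in> block_subgons" for S
  proof -
    have sg: "subgon N D S" and sub: "S \<subseteq> {..M}" using S by (auto simp: block_subgons_def subgons_def)
    have "finite S" "S \<noteq> {}" using sub finite_subset sg by (auto simp: subgon_def)
    hence "Max S \<le> M" using sub Max_in by blast
    hence "(Min S, Max S) \<in> E" using subgon_eq_cellset(1)[OF dis N3 sg] in_E_iff by blast
    thus ?thesis using subgon_eq_cellset(2)[OF dis N3 sg] cellset_R_eq by metis
  qed
  thus "\<forall>S\<in>block_subgons. (\<lambda>(a,b). cellset E a b) (Min S, Max S) = S"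
    and "(\<lambda>S. (Min S, Max S)) ` block_subgons \<subseteq> E" by auto
qed

lemma subgon_subset: "S \<in> subgons N D \<Longrightarrow> S \<subseteq> {..<N}"
  by (simp add: subgons_def subgon_def)

lemma block_turn_block_turn: "block_turn i (block_turn j S) = block_turn (i + j) S"
  by (simp add: block_turn_def image_image mod_simps algebra_simps)

lemma block_turn_mod: "block_turn (j mod d) S = block_turn j S"
proof -
  have "(v + (j mod d) * M) mod N = (v + j * M) mod N" for v
  proof -
    have "(j mod d) * M = (j * M) mod N" by (simp add: N_eq mod_mult_mult2)
    thus ?thesis by (simp add: mod_simps)
  qed
  thus ?thesis by (simp add: block_turn_def)
qed

lemma block_turn_0: "S \<subseteq> {..<N} \<Longrightarrow> block_turn 0 S = S"
  unfolding block_turn_def by (force simp: image_iff)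

lemma block_turn_multiple: "S \<subseteq> {..<N} \<Longrightarrow> j mod d = 0 \<Longrightarrow> block_turn j S = S"
  using block_turn_mod[of j S] block_turn_0[of S] by simp

lemma inj_on_block_turn: "inj_on (\<lambda>v. (v + j * M) mod N) {..<N}"
  by (rule inj_on_shift_mod)

lemma card_block_turn: "S \<subseteq> {..<N} \<Longrightarrow> card (block_turn j S) = card S"
  unfolding block_turn_def using inj_on_block_turn by (meson card_image inj_on_subset)

lemma in_block_turn_iff: "S \<subseteq> {..<N} \<Longrightarrow> v < N \<Longrightarrow> (v + j * M) mod N \<in> block_turn j S \<longleftrightarrow> v \<in> S"
  unfolding block_turn_def using inj_on_image_mem_iff[OF inj_on_block_turn[of j], of v S] by auto

lemma block_turn_in_subgons: "S \<in> subgons N D \<Longrightarrow> block_turn j S \<in> subgons N D"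
  using subgon_turn[OF dis, of S "j * M"] turn_mult[of j] N3 by (simp add: subgons_def block_turn_def)

text \<open>A subgon of the first block has a third vertex strictly between 0 and M, and no other
  block contains such a vertex.\<close>

lemma block_subgons_separated:
  assumes A: "A \<in> block_subgons" and B: "B \<in> block_subgons" and i: "0 < i" "i < d"
  shows "A \<noteq> block_turn i B"
proof
  assume eq: "A = block_turn i B"
  have A': "A \<subseteq> {..M}" "3 \<le> card A" using A by (auto simp: block_subgons_def subgons_def subgon_def)
  have "\<not> A \<subseteq> {0,M}"
  proof
    assume "A \<subseteq> {0,M}"
    hence "card A \<le> card {0,M}" by (intro card_mono) auto
    also have "\<dots> \<le> 2" by (simp add: card_insert_if)
    finally show False using A' by simp
  qed
  then obtain z where z: "z \<in> A" "z \<noteq> 0" "z \<noteq> M" by blast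
  hence zM: "z < M" using A' by (meson atMost_iff le_neq_implies_less subsetD)
  obtain w where w: "w \<in> B" "z = (w + i * M) mod N" using z eq by (auto simp: block_turn_def)
  have wM: "w \<le> M" using w B by (auto simp: block_subgons_def)
  have iM: "M \<le> i * M" using i by (cases i) auto
  have "w + i * M \<le> N" using mult_lt[OF i(2)] wM by linarith
  hence "z = 0 \<or> z = w + i * M" using w(2) by (cases "w + i * M = N") auto
  thus False using z zM iM by linarith
qed

lemma subgons_decomposition:
  "subgons N D = (\<Union>j\<in>{1..d}. block_turn j ` block_subgons) \<union> central_subgons"
proof (rule equalityI; rule subsetI)
  fix S assume S: "S \<in> subgons N D"
  show "S \<in> (\<Union>j\<in>{1..d}. block_turn j ` block_subgons) \<union> central_subgons"
  proof (cases "S \<in> central_subgons")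
    case False
    then obtain j where j: "block_turn j S \<subseteq> {..M}" using S by (auto simp: central_subgons_def)
    hence "block_turn (j mod d) S \<in> block_subgons"
      using block_turn_in_subgons[OF S] by (simp add: block_subgons_def block_turn_mod)
    moreover have "j mod d < d" using d2 by simp
    hence "(d - j mod d) + j mod d = d" by simp
    hence "block_turn (d - j mod d) (block_turn (j mod d) S) = S"
      using block_turn_multiple[OF subgon_subset[OF S], of d] unfolding block_turn_block_turn by simp
    \<comment> \<open>The index set \<open>{1..d}\<close> suits the inverse turn d - j mod d, which
      is d and not 0 when d divides j.\<close>
    moreover have "d - j mod d \<in> {1..d}" using \<open>j mod d < d\<close> by auto
    ultimately show ?thesis by (metis UN_I UnI1 imageI)
  qed simp
next
  fix S assume "S \<in> (\<Union>j\<in>{1..d}. block_turn j ` block_subgons) \<union> central_subgons"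
  thus "S \<in> subgons N D" using block_turn_in_subgons by (auto simp: block_subgons_def central_subgons_def)
qed

lemma block_turn_block_subgons_disjoint:
  assumes "i \<in> {1..d}" "j \<in> {1..d}" "i < j"
  shows "block_turn i ` block_subgons \<inter> block_turn j ` block_subgons = {}"
proof -
  have False if A: "A \<in> block_subgons" and B: "B \<in> block_subgons" and eq: "block_turn i A = block_turn j B" for A B
  proof -
    have sub: "A \<subseteq> {..<N}" using A subgon_subset by (auto simp: block_subgons_def)
    have "block_turn (d - i) (block_turn i A) = A" using block_turn_multiple[OF sub, of d] assms unfolding block_turn_block_turn by simp
    moreover have "block_turn (d - i) (block_turn j B) = block_turn (j - i) B"
    proof -
      have "(d - i + j) mod d = (j - i) mod d" using assms mod_add_self1[of d "j - i"] by (simp add: add.commute)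
      thus ?thesis unfolding block_turn_block_turn by (metis block_turn_mod)
    qed
    ultimately have "A = block_turn (j - i) B" using eq by simp
    moreover have "0 < j - i" "j - i < d" using assms by auto
    ultimately show False using block_subgons_separated[OF A B] by blast
  qed
  thus ?thesis by blast
qed

lemma block_turn_block_central_disjoint: "block_turn j ` block_subgons \<inter> central_subgons = {}"
proof -
  have "block_turn j A \<notin> central_subgons" if A: "A \<in> block_subgons" for A
  proof
    assume c: "block_turn j A \<in> central_subgons"
    have sub: "A \<subseteq> {..<N}" using A subgon_subset by (auto simp: block_subgons_def)
    have "block_turn (d * j - j) (block_turn j A) = block_turn (d * j) A"
      unfolding block_turn_block_turn using d2 by (cases d) (auto simp: add.commute)
    also have "\<dots> = A" by (rule block_turn_multiple[OF sub]) simp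
    finally show False using c A by (auto simp: central_subgons_def block_subgons_def)
  qed
  thus ?thesis by blast
qed

text \<open>The weight f stays arbitrary: indicators give the number of subgons of each size, and k
  - 2 gives the Euler relation for the whole polygon.\<close>

lemma sum_subgons:
  fixes f :: "nat \<Rightarrow> nat"
  shows "(\<Sum>S\<in>subgons N D. f (card S))
    = d * (\<Sum>(a,b)\<in>E. f (card (cellset E a b))) + (\<Sum>S\<in>central_subgons. f (card S))"
proof -
  have fin: "finite block_subgons" "finite central_subgons"
    using finite_subgons[of N D] by (auto simp: block_subgons_def central_subgons_def)
  have "(\<Sum>S\<in>subgons N D. f (card S)) = (\<Sum>S\<in>(\<Union>j\<in>{1..d}. block_turn j ` block_subgons). f (card S))
      + (\<Sum>S\<in>central_subgons. f (card S))"
    unfolding subgons_decomposition using fin block_turn_block_central_disjoint by (intro sum.union_disjoint) auto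
  also have "(\<Sum>S\<in>(\<Union>j\<in>{1..d}. block_turn j ` block_subgons). f (card S))
      = (\<Sum>j\<in>{1..d}. \<Sum>S\<in>block_turn j ` block_subgons. f (card S))"
  proof (rule sum.UNION_disjoint)
    show "\<forall>i\<in>{1..d}. \<forall>j\<in>{1..d}. i \<noteq> j \<longrightarrow> block_turn i ` block_subgons \<inter> block_turn j ` block_subgons = {}"
      using block_turn_block_subgons_disjoint by (metis inf_commute nat_neq_iff)
  qed (use fin in auto)
  also have "\<dots> = (\<Sum>j\<in>{1..d}. \<Sum>S\<in>block_subgons. f (card S))"
  proof (rule sum.cong[OF refl])
    fix j assume j: "j \<in> {1..d}"
    have sub: "A \<subseteq> {..<N}" if "A \<in> block_subgons" for A
      using that subgon_subset by (auto simp: block_subgons_def)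
    have "inj_on (block_turn j) block_subgons"
    proof (rule inj_on_inverseI)
      fix A assume "A \<in> block_subgons"
      thus "block_turn (d - j) (block_turn j A) = A" using block_turn_multiple[OF sub, of A d] j unfolding block_turn_block_turn by simp
    qed
    thus "(\<Sum>S\<in>block_turn j ` block_subgons. f (card S)) = (\<Sum>S\<in>block_subgons. f (card S))"
      by (simp add: sum.reindex card_block_turn[OF sub])
  qed
  also have "\<dots> = d * (\<Sum>S\<in>block_subgons. f (card S))" by simp
  also have "(\<Sum>S\<in>block_subgons. f (card S)) = (\<Sum>(a,b)\<in>E. f (card (cellset E a b)))"
    using sum.reindex_bij_betw[OF bij_betw_E_block_subgons, of "\<lambda>S. f (card S)"]
    by (simp add: split_beta)
  finally show ?thesis .
qed

lemma block_turn_central: "S \<in> central_subgons \<Longrightarrow> block_turn j S \<in> central_subgons"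
  using block_turn_in_subgons by (auto simp: central_subgons_def block_turn_block_turn)

text \<open>A base arc not starting at 0 lies in a single block, and a turn then brings the entire
  subgon into the first block.\<close>

lemma central_contains_0:
  assumes S: "S \<in> central_subgons"
  shows "0 \<in> S"
proof (rule ccontr)
  assume S0: "0 \<notin> S"
  have sg: "subgon N D S" using S by (simp add: central_subgons_def subgons_def)
  have fin: "finite S" "S \<noteq> {}" using sg finite_subset by (auto simp: subgon_def)
  define a b where "a = Min S" and "b = Max S"
  have "a \<noteq> 0" using S0 Min_in[OF fin] unfolding a_def by metis
  moreover have "(a,b) \<in> R" using subgon_eq_cellset(1)[OF dis N3 sg] by (simp add: a_def b_def)
  ultimately have "(a,b) \<in> block_arcs d M E" using arcs_eq_block_arcs by (auto simp: rooted_arcs_def)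
  then obtain j u v where j: "j < d" "(u,v) \<in> E" "a = u + j * M" "b = v + j * M"
    using \<open>a \<noteq> 0\<close> unfolding block_arcs_def by blast
  have vM: "v \<le> M" using j in_E_iff by blast
  have "block_turn (d - j) S \<subseteq> {..M}"
  proof
    fix t assume "t \<in> block_turn (d - j) S"
    then obtain s where s: "s \<in> S" "t = (s + (d - j) * M) mod N" by (auto simp: block_turn_def)
    have sb: "a \<le> s" "s \<le> b" "s < N" using fin s sg by (auto simp: a_def b_def subgon_def)
    have "(d - j) * M + j * M = N" using j N_eq by (simp add: add_mult_distrib[symmetric])
    hence eq: "s + (d - j) * M = (s - j * M) + N" using sb j by linarith
    have "t = s - j * M" unfolding s(2) eq using sb by simp
    thus "t \<in> {..M}" using sb j vM by simp
  qed
  thus False using S by (simp add: central_subgons_def)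
qed

lemma central_contains_M:
  assumes S: "S \<in> central_subgons"
  shows "M \<in> S"
proof -
  have "0 \<in> block_turn (d - 1) S" using central_contains_0[OF block_turn_central[OF S]] .
  then obtain s where s: "s \<in> S" "(s + (d - 1) * M) mod N = 0" by (auto simp: block_turn_def)
  have "s < N" using s S subgon_subset by (auto simp: central_subgons_def)
  have "s + (d - 1) * M = N"
  proof (rule ccontr)
    assume neq: "s + (d - 1) * M \<noteq> N"
    have pos: "0 < s + (d - 1) * M" using last_block_le[OF d2, of M] M_pos by linarith
    show False
    proof (cases "s + (d - 1) * M < N")
      case True thus ?thesis using s pos by simp
    next
      case False
      hence "(s + (d - 1) * M) mod N = s + (d - 1) * M - N" "0 < s + (d - 1) * M - N"
        using \<open>s < N\<close> N_split M_pos neq by (simp_all add: mod_if)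
      thus ?thesis using s by simp
    qed
  qed
  hence "s = M" using N_split by linarith
  thus ?thesis using s by simp
qed

text \<open>With 0 and M both in \<open>S\<close>, no arc except the base passes over M, so only the
  arcs of \<open>E\<close> can hide a point of the first block.\<close>

lemma central_first_block:
  assumes S: "S \<in> central_subgons" and v: "v < M"
  shows "v \<in> S \<longleftrightarrow> v \<in> X"
proof -
  have sg: "subgon N D S" using S by (simp add: central_subgons_def subgons_def)
  have fin: "finite S" "S \<noteq> {}" using sg finite_subset by (auto simp: subgon_def)
  define b where "b = Max S"
  have "Min S = 0" using central_contains_0[OF S] fin Min_le by blast
  hence Sb: "S = cellset R 0 b" using subgon_eq_cellset(2)[OF dis N3 sg] by (simp add: b_def)
  have "\<not> S \<subseteq> {..M}" using S block_turn_0[OF subgon_subset, of S] by (auto simp: central_subgons_def)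
  hence bM: "M < b" using fin unfolding b_def by (meson Max_ge atMost_iff not_less order_trans subsetI)
  show ?thesis
  proof
    assume vS: "v \<in> S"
    have "\<not> (x < v \<and> v < y)" if "(x,y) \<in> E" for x y
    proof -
      have "(x,y) \<in> R" "y \<le> M" using that in_E_iff by auto
      thus ?thesis using vS bM unfolding Sb by (auto simp: cellset_def)
    qed
    thus "v \<in> X" using v by (auto simp: exposed_def)
  next
    assume vX: "v \<in> X"
    have "\<not> (x < v \<and> v < y)" if xy: "(x,y) \<in> R" "(x,y) \<noteq> (0,b)" "y \<le> b" for x y
    proof (cases "y \<le> M")
      case True
      hence "(x,y) \<in> E" using xy in_E_iff by blast
      thus ?thesis using vX by (auto simp: exposed_def)
    next
      case False
      have "M \<in> cellset R 0 b" using central_contains_M[OF S] Sb by simp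
      hence "\<not> (x < M \<and> M < y)" using xy by (auto simp: cellset_def)
      thus ?thesis using False v by simp
    qed
    thus "v \<in> S" using v bM unfolding Sb by (auto simp: cellset_def)
  qed
qed

lemma central_subgon_eq:
  assumes S: "S \<in> central_subgons"
  shows "S = central_vertices"
proof -
  have sub: "S \<subseteq> {..<N}" using S subgon_subset by (auto simp: central_subgons_def)
  have "v \<in> S \<longleftrightarrow> v mod M \<in> X" if v: "v < N" for v
  proof -
    define j where "j = v div M"
    have vj: "v = v mod M + j * M" by (simp add: j_def)
    have "j < d" using v N_eq M_pos by (simp add: j_def less_mult_imp_div_less)
    hence "(d - j) * M + j * M = N" using N_eq by (simp add: add_mult_distrib[symmetric])
    hence eq: "v + (d - j) * M = v mod M + N" using vj by linarith
    have "v mod M < M" using M_pos by simp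
    hence "v mod M < N" using M_lt by linarith
    hence "(v + (d - j) * M) mod N = v mod M" unfolding eq by simp
    hence "v \<in> S \<longleftrightarrow> v mod M \<in> block_turn (d - j) S" using in_block_turn_iff[OF sub v, of "d - j"] by simp
    thus ?thesis using central_first_block[OF block_turn_central[OF S]] M_pos by simp
  qed
  thus ?thesis using sub by (auto simp: central_vertices_def)
qed

lemma X_endpoints: "0 \<in> X" "M \<in> X"
  using exposed_endpoints[OF arcset_E] by auto

text \<open>M is left out of each copy of \<open>X\<close>, being the 0 of the next copy.\<close>

lemma card_central_vertices: "card central_vertices = d * (card X - 1)"
proof -
  have XM: "v < M" if "v \<in> X - {M}" for v using that by (auto simp: exposed_def le_less)
  have "inj_on (\<lambda>(j,v). v + j * M) ({..<d} \<times> (X - {M}))"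
  proof (rule inj_on_inverseI)
    fix p assume p: "p \<in> {..<d} \<times> (X - {M})"
    obtain j v where jv: "p = (j,v)" by (cases p)
    have "v < M" using p jv XM by auto
    thus "(\<lambda>w. (w div M, w mod M)) ((\<lambda>(j,v). v + j * M) p) = p" by (simp add: jv)
  qed
  moreover have "(\<lambda>(j,v). v + j * M) ` ({..<d} \<times> (X - {M})) = central_vertices"
  proof (rule equalityI; rule subsetI)
    fix w assume "w \<in> (\<lambda>(j,v). v + j * M) ` ({..<d} \<times> (X - {M}))"
    then obtain j v where jv: "j < d" "v \<in> X - {M}" "w = v + j * M" by auto
    have "v < M" using XM jv by blast
    moreover have "w < N" using mult_lt[OF jv(1)] calculation jv(3) by linarith
    ultimately show "w \<in> central_vertices" using jv by (simp add: central_vertices_def)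
  next
    fix w assume w: "w \<in> central_vertices"
    have "w < d * M" using w unfolding central_vertices_def N_eq[symmetric] by simp
    hence "w div M < d" by (rule less_mult_imp_div_less)
    moreover have "w mod M \<in> X - {M}" using w M_pos
      by (metis (no_types, lifting) DiffI central_vertices_def mem_Collect_eq mod_less_divisor nat_neq_iff singletonD)
    ultimately show "w \<in> (\<lambda>(j,v). v + j * M) ` ({..<d} \<times> (X - {M}))"
      by (intro image_eqI[of _ _ "(w div M, w mod M)"]) auto
  qed
  ultimately have "card central_vertices = card ({..<d} \<times> (X - {M}))" by (metis card_image)
  thus ?thesis using X_endpoints by (simp add: card_cartesian_product)
qed

text \<open>Existence comes from counting. Without a central subgon the Euler relations of the
  polygon and of one period give N = 2 + d t and N = d (card X - 1) + d t, with t the sum of the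
  types over \<open>E\<close>. The excluded value 2 belongs to a central diagonal.\<close>

lemma central_subgons_eq:
  "d * (card X - 1) \<noteq> 2 \<Longrightarrow> central_subgons = {central_vertices}"
proof -
  assume ne: "d * (card X - 1) \<noteq> 2"
  have sub: "central_subgons \<subseteq> {central_vertices}" using central_subgon_eq by blast
  have "central_subgons \<noteq> {}"
  proof
    assume em: "central_subgons = {}"
    let ?t = "\<Sum>(a,b)\<in>E. card (cellset E a b) - 2"
    have 1: "card X + ?t = M + 1" by (rule card_exposed_plus_types[OF arcset_E])
    have acR: "arcset (N - 1) R" by (rule arcset_rooted_arcs[OF dis N3])
    have "card (exposed R (N - 1)) + (\<Sum>(a,b)\<in>R. card (cellset R a b) - 2) = N - 1 + 1"
      by (rule card_exposed_plus_types[OF acR])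
    moreover have "card (exposed R (N - 1)) = 2"
      using exposed_eq_endpoints_iff[OF acR] N3 by (simp add: rooted_arcs_def)
    moreover have "(\<Sum>(a,b)\<in>R. card (cellset R a b) - 2) = (\<Sum>S\<in>subgons N D. card S - 2)"
      using sum.reindex_bij_betw[OF bij_betw_cellset_subgons[OF dis N3], of "\<lambda>S. card S - 2"]
      by (simp add: split_beta)
    moreover have "(\<Sum>S\<in>subgons N D. card S - 2) = d * ?t"
      using sum_subgons[of "\<lambda>k. k - 2"] em by simp
    ultimately have 2: "2 + d * ?t = N" using N3 by simp
    have "0 < card X" using X_endpoints by (auto simp: card_gt_0_iff)
    hence "card X - 1 + ?t = M" using 1 by linarith
    hence "d * (card X - 1) + d * ?t = N" unfolding N_eq by (metis distrib_left)
    thus False using 2 ne by linarith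
  qed
  thus ?thesis using sub by blast
qed

lemma card_subgons_by_size:
  assumes i: "1 \<le> i"
  shows "card {S \<in> subgons N D. card S = i + 2}
    = d * card (arcs_of_type E i) + (if d * (card X - 1) = i + 2 then 1 else 0)"
proof -
  let ?f = "\<lambda>k. if k = i + 2 then 1 else (0::nat)"
  have "card {S \<in> subgons N D. card S = i + 2} = (\<Sum>S\<in>subgons N D. ?f (card S))"
    using sum.inter_filter[OF finite_subgons[of N D], of "\<lambda>_. 1::nat" "\<lambda>S. card S = i + 2"] by simp
  also have "\<dots> = d * (\<Sum>(a,b)\<in>E. ?f (card (cellset E a b))) + (\<Sum>S\<in>central_subgons. ?f (card S))"
    by (rule sum_subgons)
  also have "(\<Sum>(a,b)\<in>E. ?f (card (cellset E a b))) = card (arcs_of_type E i)"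
  proof -
    have "arcs_of_type E i = {e\<in>E. card (cellset E (fst e) (snd e)) = i + 2}"
      by (auto simp: arcs_of_type_def)
    thus ?thesis
      using sum.inter_filter[OF finite_arcset[OF arcset_E], of "\<lambda>_. 1::nat" "\<lambda>e. card (cellset E (fst e) (snd e)) = i + 2"]
      by (simp add: split_beta)
  qed
  also have "(\<Sum>S\<in>central_subgons. ?f (card S)) = (if d * (card X - 1) = i + 2 then 1 else 0)"
  proof (cases "d * (card X - 1) = 2")
    case True
    \<comment> \<open>For this value a central subgon would have only 2 vertices, fewer than i + 2,
      so it contributes nothing.\<close>
    have "card S = 2" if "S \<in> central_subgons" for S
      using central_subgon_eq[OF that] card_central_vertices True by simp
    thus ?thesis using True i by simp
  next
    case False
    thus ?thesis using central_subgons_eq card_central_vertices by simp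
  qed
  finally show ?thesis .
qed

end

section \<open>The number of central vertices\<close>

context centered_dissection
begin

text \<open>By symmetry v may be replaced by its residue r. An arc of \<open>E\<close> over r
  becomes, once r is moved to 0, a diagonal cutting 0 off from the centre, and every such diagonal
  arises in this way.\<close>

lemma turn_central_0_iff:
  assumes v: "v < N"
  shows "central_0 N M (turn N (N - v) D) \<longleftrightarrow> v \<in> central_vertices"
proof -
  define r where "r = v mod M"
  have rM: "r < M" using M_pos by (simp add: r_def)
  have "turn N (N - v) D = turn N (N - v) (turn N ((v div M) * M) D)"
    by (simp only: turn_mult)
  also have "\<dots> = turn N (N - r) D"
    using v by (simp add: turn_turn r_def minus_mod_eq_div_mult[symmetric] add.commute)
  finally have tv: "turn N (N - v) D = turn N (N - r) D" .
  have mem: "{p,q} \<in> turn N (N - r) D \<longleftrightarrow> {(p + r) mod N, (q + r) mod N} \<in> D" if "p < N" "q < N" for p q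
    using rM M_lt that by (intro doubleton_in_turn_iff dissection_vertices[OF dis]) auto
  have "central_0 N M (turn N (N - r) D) \<longleftrightarrow> r \<in> X"
  proof
    assume c: "central_0 N M (turn N (N - r) D)"
    have "\<not> (x < r \<and> r < y)" if xy: "(x,y) \<in> E" for x y
    proof
      assume xry: "x < r \<and> r < y"
      have b: "y \<le> M" "{x,y} \<in> D" using xy by (auto simp: E_def block_restrict_def arcs_def)
      have "x + N - r < N" "y - r < N" "y - r < x + N - r" using xry b M_lt by linarith+
      moreover have shifted: "x + N - r + r = x + N" "y - r + r = y" using xry rM M_lt by linarith+
      have "x < N" "y < N" using xry b M_lt by linarith+
      hence "(x + N - r + r) mod N = x" "(y - r + r) mod N = y" unfolding shifted by simp_all
      ultimately have "(y - r, x + N - r) \<in> arcs (turn N (N - r) D)"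
        using mem[of "y - r" "x + N - r"] b by (simp add: arcs_def insert_commute)
      hence "0 < y - r \<longrightarrow> x + N - r + M < N + (y - r)" using c unfolding central_0_def by blast
      thus False using xry b M_lt rM by linarith
    qed
    thus "r \<in> X" using rM by (auto simp: exposed_def)
  next
    assume rX: "r \<in> X"
    show "central_0 N M (turn N (N - r) D)"
      unfolding central_0_def
    proof (intro ballI, clarify)
      fix p q assume pq: "(p,q) \<in> arcs (turn N (N - r) D)" "0 < p"
      have qN: "q < N" "p < q"
        using dissection_arc_bounds[OF dissection_turn[OF dis] pq(1)] by auto
      have m: "{(p + r) mod N, (q + r) mod N} \<in> D"
        using mem[of p q] pq qN by (simp add: arcs_def)
      show "q + M < N + p"
      proof (rule ccontr)
        assume "\<not> ?thesis"
        hence long: "N + p \<le> q + M" by simp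
        have pr: "(p + r) mod N = p + r" using long qN rM two_M_le by simp
        show False
        proof (cases "q + r < N")
          case True
          hence "(p + r, q + r) \<in> arcs D" using m pr qN by (simp add: arcs_def)
          from arc_centered[OF this] show False using pq long by simp
        next
          case False
          have "(q + r) mod N = q + r - N" using False qN rM M_lt by (simp add: mod_if)
          hence "{q + r - N, p + r} \<in> D" using m pr by (simp add: insert_commute)
          moreover have lt: "q + r - N < r" "r < p + r" "q + r - N < p + r"
            using False qN pq by linarith+
          ultimately have arc: "(q + r - N, p + r) \<in> arcs D" by (simp add: arcs_def)
          have "p + r \<le> M"
          proof (cases "q + r - N = 0")
            case True thus ?thesis using long False by linarith
          next
            case F: False
            have "(q + r - N) div M = 0" using lt rM by simp
            thus ?thesis using arc_in_block[OF arc] F by simp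
          qed
          hence "(q + r - N, p + r) \<in> E" using arc by (simp add: E_def block_restrict_def)
          thus False using rX lt by (auto simp: exposed_def)
        qed
      qed
    qed
  qed
  thus ?thesis unfolding tv central_vertices_def r_def using v by simp
qed

lemma card_central_turns: "card {v \<in> {..<N}. central_0 N M (turn N (N - v) D)} = d * (card X - 1)"
proof -
  have "{v \<in> {..<N}. central_0 N M (turn N (N - v) D)} = central_vertices"
    using turn_central_0_iff by (auto simp: central_vertices_def)
  thus ?thesis using card_central_vertices by simp
qed

lemma card_X_types:
  assumes "M \<le> n + 1"
  shows "card X + (\<Sum>i=1..n. i * card (arcs_of_type E i)) = M + 1"
proof -
  let ?g = "\<lambda>e. card (cellset E (fst e) (snd e)) - 2"
  have fin: "finite E" by (rule finite_arcset[OF arcset_E])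
  have ge: "3 \<le> card (cellset E a b)" if "(a,b) \<in> E" for a b
    using card_cellset_ge_3[OF arcset_E] arcset_bounds[OF arcset_E that] by blast
  have eq: "{e \<in> E. ?g e = i} = arcs_of_type E i" for i
    using ge by (force simp: arcs_of_type_def)
  have "?g ` E \<subseteq> {1..n}"
  proof (rule image_subsetI)
    fix e assume e: "e \<in> E"
    hence "e \<in> arcs_of_type E (?g e)" using eq[of "?g e"] by blast
    hence "\<not> (?g e = 0 \<or> M \<le> ?g e)" using arcs_of_type_out_of_range[OF arcset_E, of "?g e"] by blast
    thus "?g e \<in> {1..n}" using assms by auto
  qed
  hence "(\<Sum>i=1..n. \<Sum>e\<in>{e \<in> E. ?g e = i}. ?g e) = sum ?g E"
    by (intro sum.group[OF fin]) auto
  moreover have "(\<Sum>e\<in>{e \<in> E. ?g e = i}. ?g e) = i * card (arcs_of_type E i)" for i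
    unfolding eq[of i, symmetric] by simp
  ultimately have "(\<Sum>i=1..n. i * card (arcs_of_type E i)) = sum ?g E" by (simp only:)
  thus ?thesis
    using card_exposed_plus_types[OF arcset_E] by (simp add: split_beta)
qed

end

lemma central_rotation_cong:
  assumes "v < N" "w < N" "0 < (N::nat)"
  shows "turn N (N - v) (turn N (N - w) D) = turn N (N - (v + w) mod N) D"
proof -
  have "(N - v + (N - w)) mod N = (N - (v + w) mod N) mod N"
  proof (cases "v + w < N")
    case True
    have "N - v + (N - w) = (N - (v + w) mod N) + N" using True assms by simp
    thus ?thesis by simp
  next
    case False
    hence "(v + w) mod N = v + w - N" using assms by (simp add: mod_if)
    hence "N - v + (N - w) = N - (v + w) mod N" using False assms by simp
    thus ?thesis by simp
  qed
  thus ?thesis unfolding turn_turn by (rule turn_cong)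
qed

context rotational_dissection
begin

lemma turn_rotational: "rotational_dissection d M N (turn N a D)"
proof unfold_locales
  show "dissection N (turn N a D)" by (rule dissection_turn[OF dis])
  show "turn N M (turn N a D) = turn N a D"
    using turn_turn[of N a M D] turn_turn[of N M a D] sym by (simp add: add.commute)
qed

text \<open>An endpoint of a longest diagonal, measured along its shorter side, is central.\<close>

lemma exists_central_vertex: "\<exists>v<N. central_0 N M (turn N (N - v) D)"
proof (cases "D = {}")
  case True
  thus ?thesis using N3 by (intro exI[of _ 0]) (auto simp: turn_def central_0_def arcs_def)
next
  case False
  have N0: "0 < N" using N3 by simp
  \<comment> \<open>A pair (v, y) encodes the diagonal from v to v + y modulo N, moved so that v
    becomes 0.\<close>
  define P where "P = {(v,y). v < N \<and> 0 < y \<and> y < N \<and> {0,y} \<in> turn N (N - v) D}"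
  let ?f = "\<lambda>p. min (snd p) (N - snd p)"
  have mk: "{0, q - p} \<in> turn N (N - p) D'" if D': "dissection N D'" "(p,q) \<in> arcs D'" for p q D'
  proof -
    have b: "p < q" "q < N" using dissection_arc_bounds[OF that] by auto
    have "{0, q - p} \<in> turn N (N - p) D' \<longleftrightarrow> {(0 + p) mod N, (q - p + p) mod N} \<in> D'"
      using b by (intro doubleton_in_turn_iff dissection_vertices[OF D'(1)]) auto
    thus ?thesis using b that by (simp add: arcs_def)
  qed
  have finP: "finite P" by (rule finite_subset[of _ "{..<N} \<times> {..<N}"]) (auto simp: P_def)
  have "arcs D \<noteq> {}" using False dissection_eq_image_arcs[OF dis] by auto
  then obtain x y where xy: "(x,y) \<in> arcs D" by auto
  have "(x, y - x) \<in> P" using mk[OF dis xy] arc_bounds[OF xy] by (simp add: P_def)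
  hence neP: "P \<noteq> {}" by blast
  have "Max (?f ` P) \<in> ?f ` P" using finP neP by (intro Max_in) auto
  then obtain v y where vy: "(v,y) \<in> P" "min y (N - y) = Max (?f ` P)" by auto
  have mx: "min q (N - q) \<le> min y (N - y)" if "(p,q) \<in> P" for p q
  proof -
    have "?f (p,q) \<le> Max (?f ` P)" using finP that by (intro Max_ge finite_imageI imageI)
    thus ?thesis unfolding vy(2) by simp
  qed
  define D' where "D' = turn N (N - v) D"
  have D': "dissection N D'" unfolding D'_def by (rule dissection_turn[OF dis])
  have v: "v < N" "0 < y" "y < N" "{0,y} \<in> D'" using vy by (auto simp: P_def D'_def)
  have "central_0 N M D'"
    unfolding central_0_def
  proof (intro ballI, clarify)
    fix p q assume pq: "(p,q) \<in> arcs D'" "0 < p"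
    have b: "p < q" "q < N" using dissection_arc_bounds[OF D' pq(1)] by auto
    show "q + M < N + p"
    proof (rule ccontr)
      assume neg: "\<not> ?thesis"
      have "{0, q - p} \<in> turn N (N - p) D'" by (rule mk[OF D' pq(1)])
      also have "turn N (N - p) D' = turn N (N - (p + v) mod N) D"
        unfolding D'_def using b v by (intro central_rotation_cong) auto
      finally have "((p + v) mod N, q - p) \<in> P" using b N0 by (simp add: P_def)
      from mx[OF this] have "min (q - p) (N - (q - p)) \<le> min y (N - y)" .
      moreover have "N - (q - p) \<le> q - p" using neg b two_M_le by linarith
      ultimately have le: "N - (q - p) \<le> y" "N - (q - p) \<le> N - y" by linarith+
      have "{p,q} \<in> D'" using pq by (simp add: arcs_def)
      \<comment> \<open>Non-crossing puts {p, q} on one side of {0, y}; as p > 0, its span q - p is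
        then smaller than y or than N - y, against \<open>le\<close>.\<close>
      hence "p < y \<longrightarrow> q \<le> y" using dissection_noncrossing[OF D' v(4), of p q] pq(2) by blast
      thus False using le b pq v by linarith
    qed
  qed
  thus ?thesis using v unfolding D'_def by blast
qed

lemma card_central_turns_turn:
  assumes w: "w < N"
  shows "card {v \<in> {..<N}. central_0 N M (turn N (N - v) (turn N (N - w) D))}
    = card {v \<in> {..<N}. central_0 N M (turn N (N - v) D)}"
proof (rule bij_betw_same_card)
  let ?r = "\<lambda>v. (v + w) mod N"
  have inj: "inj_on ?r {..<N}" by (rule inj_on_shift_mod)
  moreover have "?r ` {..<N} \<subseteq> {..<N}" using w by auto
  ultimately have surj: "?r ` {..<N} = {..<N}" by (intro endo_inj_surj) auto
  have eq: "turn N (N - v) (turn N (N - w) D) = turn N (N - ?r v) D" if "v < N" for v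
    using that w by (intro central_rotation_cong) auto
  show "bij_betw ?r {v \<in> {..<N}. central_0 N M (turn N (N - v) (turn N (N - w) D))}
     {v \<in> {..<N}. central_0 N M (turn N (N - v) D)}"
  proof (rule bij_betw_imageI)
    show "inj_on ?r {v \<in> {..<N}. central_0 N M (turn N (N - v) (turn N (N - w) D))}"
      using inj by (rule inj_on_subset) auto
    show "?r ` {v \<in> {..<N}. central_0 N M (turn N (N - v) (turn N (N - w) D))}
        = {v \<in> {..<N}. central_0 N M (turn N (N - v) D)}" (is "?r ` ?A = ?B")
    proof (rule equalityI; rule subsetI)
      fix u assume "u \<in> ?r ` ?A"
      thus "u \<in> ?B" using eq w by auto
    next
      fix u assume u: "u \<in> ?B"
      then obtain v where "v \<in> {..<N}" "u = ?r v" using surj by auto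
      thus "u \<in> ?r ` ?A" using u eq by (intro image_eqI[of _ _ v]) auto
    qed
  qed
qed

end

theorem card_fixed_A_mu:
  assumes n: "n = (\<Sum>i=1..n. i * mu i)" "1 \<le> n" and dM: "n + 2 = d * M" "2 \<le> d"
  defines "F \<equiv> {D \<in> A_mu n mu. turn (n + 2) M D = D}"
  shows "2 \<le> (\<Sum>i=1..n. mu i mod d) \<Longrightarrow> card F = 0"
    and "(\<Sum>i=1..n. mu i mod d) \<le> 1 \<Longrightarrow>
      card F * (fact (M - 1) * (\<Prod>i=1..n. fact (mu i div d))) = fact (M - 1 + (\<Sum>i=1..n. mu i div d))"
proof -
  define N where "N = n + 2"
  interpret blocks d M N using dM n by unfold_locales (auto simp: N_def)
  define F0 where "F0 = {D \<in> F. central_0 N M D}"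
  define m where "m = (\<lambda>i. if i \<in> {1..n} then mu i div d else 0)"
  \<comment> \<open>The Euler relation for one period forces this number of contour edges.\<close>
  define c where "c = M - (\<Sum>i=1..n. i * (mu i div d))"
  have Mn: "M \<le> n + 1" using M_lt by (simp add: N_def)
  have rot: "rotational_dissection d M N D" if "D \<in> F" for D
    using that by unfold_locales (auto simp: F_def A_mu_def N_def)
  have cent: "centered_dissection d M N D" if "D \<in> F0" for D
    using that rot[of D] by (auto simp: F0_def centered_dissection_def centered_dissection_axioms_def)
  have memF: "D \<in> F \<longleftrightarrow> dissection N D \<and> turn N M D = D \<and>
      (\<forall>i\<in>{1..n}. card {S \<in> subgons N D. card S = i + 2} = mu i)" for D
    by (auto simp: F_def A_mu_def N_def)
  have turnF: "turn N a D \<in> F" if "D \<in> F" for a D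
  proof -
    interpret rotational_dissection d M N D by (rule rot[OF that])
    interpret t: rotational_dissection d M N "turn N a D" by (rule turn_rotational)
    show ?thesis using that t.dis t.sym card_subgons_of_size_turn[OF dis, of a] N3 unfolding memF by simp
  qed
  have F_ne: "F0 \<noteq> {}" if ne: "F \<noteq> {}"
  proof -
    obtain D where D: "D \<in> F" using ne by blast
    obtain v where "central_0 N M (turn N (N - v) D)"
      using rotational_dissection.exists_central_vertex[OF rot[OF D]] by blast
    thus ?thesis using turnF[OF D] unfolding F0_def by blast
  qed
  have "F \<subseteq> Pow (Pow {..<N})" using dissection_vertices memF by blast
  hence finF: "finite F" by (rule finite_subset) simp
  have types: "mu i mod d = (if d * (card (exposed (block_restrict M D) M) - 1) = i + 2 then 1 else 0)
      \<and> mu i div d = card (arcs_of_type (block_restrict M D) i)" if D: "D \<in> F0" and i: "i \<in> {1..n}" for D i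
  proof -
    interpret centered_dissection d M N D by (rule cent[OF D])
    have "mu i = d * card (arcs_of_type E i) + (if d * (card X - 1) = i + 2 then 1 else 0)"
      using D i card_subgons_by_size[of i] by (auto simp: F0_def memF)
    \<comment> \<open>The indicator is less than d, so it is the remainder of \<open>mu i\<close>
      and the arcs of one period give the quotient.\<close>
    thus ?thesis unfolding E_def using d2 by (auto simp: div_mult_self4)
  qed
  show "card F = 0" if "2 \<le> (\<Sum>i=1..n. mu i mod d)"
  proof -
    have "F0 = {}"
    proof (rule ccontr)
      assume "F0 \<noteq> {}"
      then obtain D where D: "D \<in> F0" by blast
      let ?k = "d * (card (exposed (block_restrict M D) M) - 1)"
      have "(\<Sum>i=1..n. mu i mod d) = (\<Sum>i=1..n. if i = ?k - 2 \<and> 2 \<le> ?k then 1 else 0)"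
        by (rule sum.cong) (use types[OF D] in auto)
      also have "\<dots> \<le> (\<Sum>i=1..n. if i = ?k - 2 then 1 else 0)" by (rule sum_mono) auto
      also have "\<dots> \<le> 1" by (simp add: sum.delta)
      finally show False using that by simp
    qed
    thus ?thesis using F_ne by (metis card.empty)
  qed
  assume le1: "(\<Sum>i=1..n. mu i mod d) \<le> 1"
  have "n = (\<Sum>i=1..n. d * (i * (mu i div d)) + i * (mu i mod d))"
    by (subst n(1), rule sum.cong) (auto simp: add_mult_distrib2[symmetric] mult.left_commute[of d])
  hence n_split: "n = d * (\<Sum>i=1..n. i * (mu i div d)) + (\<Sum>i=1..n. i * (mu i mod d))"
    by (simp only: sum.distrib sum_distrib_left)
  have "d * (\<Sum>i=1..n. i * (mu i div d)) < d * M" using n_split dM by linarith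
  hence sM: "(\<Sum>i=1..n. i * (mu i div d)) < M" by simp
  hence cM: "M = c + (\<Sum>i=1..n. i * (mu i div d))" "0 < c" by (simp_all add: c_def)
  have dc: "d * c = 2 + (\<Sum>i=1..n. i * (mu i mod d))"
  proof -
    have "d * M = d * c + d * (\<Sum>i=1..n. i * (mu i div d))"
      using cM(1) by (metis distrib_left)
    thus ?thesis using n_split dM(1) by linarith
  qed
  \<comment> \<open>At most one type has a nonzero residue. If it is type j, then d c = j + 2; if
    there is none, then d c = 2, which is i + 2 for no i \<ge> 1.\<close>
  have mod_eq: "mu i mod d = (if d * c = i + 2 then 1 else 0)" if i: "i \<in> {1..n}" for i
  proof (cases "\<exists>j\<in>{1..n}. mu j mod d \<noteq> 0")
    case True
    then obtain j where j: "j \<in> {1..n}" "mu j mod d \<noteq> 0" by blast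
    have "(\<Sum>i=1..n. mu i mod d) = mu j mod d + (\<Sum>i\<in>{1..n}-{j}. mu i mod d)"
      using j by (intro sum.remove) auto
    hence j1: "mu j mod d = 1" "(\<Sum>i\<in>{1..n}-{j}. mu i mod d) = 0" using le1 j by linarith+
    hence z: "mu i mod d = 0" if "i \<in> {1..n}" "i \<noteq> j" for i using that by auto
    have "(\<Sum>i=1..n. i * (mu i mod d)) = (\<Sum>i=1..n. if i = j then j else 0)"
      by (rule sum.cong) (use z j1 in auto)
    hence "d * c = j + 2" using dc j by (simp add: sum.delta)
    thus ?thesis using z[OF i] j1 by auto
  next
    case False
    hence "(\<Sum>i=1..n. i * (mu i mod d)) = 0" by auto
    thus ?thesis using False i dc by auto
  qed
  have sum_m: "(\<Sum>i=1..n. i * m i) = (\<Sum>i=1..n. i * (mu i div d))" "sum m {1..n} = (\<Sum>i=1..n. mu i div d)"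
    "(\<Prod>i=1..n. fact (m i)) = ((\<Prod>i=1..n. fact (mu i div d)) :: nat)"
    by (auto intro!: sum.cong prod.cong simp: m_def)
  have F0_types: "arcset M (block_restrict M D) \<and> card (exposed (block_restrict M D) M) = c + 1 \<and>
      (\<forall>i. card (arcs_of_type (block_restrict M D) i) = m i)" if D: "D \<in> F0" for D
  proof -
    interpret centered_dissection d M N D by (rule cent[OF D])
    have t: "card (arcs_of_type E i) = m i" for i
    proof (cases "i \<in> {1..n}")
      case True thus ?thesis using types[OF D True] by (simp add: m_def E_def)
    next
      case False
      hence "i = 0 \<or> M \<le> i" using Mn by auto
      thus ?thesis using arcs_of_type_out_of_range[OF arcset_E] False by (auto simp: m_def)
    qed
    have "card X + (\<Sum>i=1..n. i * (mu i div d)) = M + 1"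
      using card_X_types[OF Mn] unfolding t sum_m(1) .
    hence "card X = c + 1" using cM(1) by linarith
    thus ?thesis using t arcset_E by (simp add: E_def)
  qed
  have "bij_betw (block_restrict M) F0 (arcsets_of_type c M m)"
  proof (rule bij_betw_byWitness[where f' = "\<lambda>E. (\<lambda>(x,y). {x,y}) ` block_arcs d M E"])
    show "\<forall>D\<in>F0. (\<lambda>(x,y). {x,y}) ` block_arcs d M (block_restrict M D) = D"
      using centered_dissection.D_eq[OF cent] centered_dissection.E_def[OF cent] by metis
    show "\<forall>E\<in>arcsets_of_type c M m. block_restrict M ((\<lambda>(x,y). {x,y}) ` block_arcs d M E) = E"
      using dissection_block_arcs(5) by (auto simp: arcsets_of_type_def)
    show "block_restrict M ` F0 \<subseteq> arcsets_of_type c M m"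
      using F0_types by (auto simp: arcsets_of_type_def)
    show "(\<lambda>E. (\<lambda>(x,y). {x,y}) ` block_arcs d M E) ` arcsets_of_type c M m \<subseteq> F0"
    proof (rule image_subsetI)
      fix E assume E: "E \<in> arcsets_of_type c M m"
      define D where "D = (\<lambda>(x,y). {x,y}) ` block_arcs d M E"
      have ac: "arcset M E" "card (exposed E M) = c + 1" "\<And>i. card (arcs_of_type E i) = m i"
        using E by (auto simp: arcsets_of_type_def)
      note db = dissection_block_arcs[OF ac(1), folded D_def]
      interpret D: centered_dissection d M N D by unfold_locales (rule db)+
      have DE: "D.E = E" using db(5) by (simp add: D.E_def)
      have "card {S \<in> subgons N D. card S = i + 2} = mu i" if i: "i \<in> {1..n}" for i
      proof -
        have "card {S \<in> subgons N D. card S = i + 2} = d * (mu i div d) + mu i mod d"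
          using D.card_subgons_by_size[of i] i mod_eq[OF i] by (simp add: DE ac m_def)
        thus ?thesis by simp
      qed
      thus "D \<in> F0" using db by (simp add: F0_def memF)
    qed
  qed
  hence "card F0 = card (arcsets_of_type c M m)" by (rule bij_betw_same_card)
  moreover have "card (arcsets_of_type c M m) * (fact M * (\<Prod>i=1..n. fact (m i)))
      = c * fact (M + sum m {1..n} - 1)"
    by (rule card_arcsets_of_type) (use M_pos cM(1) sum_m(1) in \<open>auto simp: m_def\<close>)
  ultimately have F0_eq: "card F0 * (fact M * (\<Prod>i=1..n. fact (mu i div d)))
      = c * fact (M + (\<Sum>i=1..n. mu i div d) - 1)"
    unfolding sum_m by simp
  \<comment> \<open>Pairs of a fixed dissection and a central vertex v: moving v to 0 gives
    \<open>card F0\<close> pairs for each of the N vertices, while each dissection has d c of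
    them.\<close>
  have "(\<Sum>D\<in>F. card {v \<in> {..<N}. central_0 N M (turn N (N - v) D)}) = (\<Sum>v\<in>{..<N}. card F0)"
  proof (rule sum_multicount_gen[OF finF])
    show "\<forall>v\<in>{..<N}. card {D \<in> F. central_0 N M (turn N (N - v) D)} = card F0"
    proof
      fix v assume v: "v \<in> {..<N}"
      show "card {D \<in> F. central_0 N M (turn N (N - v) D)} = card F0"
      proof (rule bij_betw_same_card, rule bij_betw_byWitness[where f = "turn N (N - v)" and f' = "turn N v"])
        have dF: "dissection N D" if "D \<in> F" for D using that memF by blast
        have vN: "v + (N - v) = N" "N - v + v = N" using v by auto
        have tt: "turn N v (turn N (N - v) D) = D" "turn N (N - v) (turn N v D) = D" if "D \<in> F" for D
          using turn_multiple[OF dF[OF that], of N] unfolding turn_turn vN by simp_all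
        show "\<forall>D\<in>{D \<in> F. central_0 N M (turn N (N - v) D)}. turn N v (turn N (N - v) D) = D"
          using tt by blast
        show "\<forall>D\<in>F0. turn N (N - v) (turn N v D) = D" using tt by (auto simp: F0_def)
        show "turn N (N - v) ` {D \<in> F. central_0 N M (turn N (N - v) D)} \<subseteq> F0"
          using turnF by (auto simp: F0_def)
        show "turn N v ` F0 \<subseteq> {D \<in> F. central_0 N M (turn N (N - v) D)}"
          using turnF tt by (auto simp: F0_def)
      qed
    qed
  qed simp
  moreover have "card {v \<in> {..<N}. central_0 N M (turn N (N - v) D)} = d * c" if D: "D \<in> F" for D
  proof -
    interpret rotational_dissection d M N D by (rule rot[OF D])
    obtain w where w: "w < N" "central_0 N M (turn N (N - w) D)" using exists_central_vertex by blast
    hence t0: "turn N (N - w) D \<in> F0" using turnF[OF D] by (simp add: F0_def)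
    interpret t: centered_dissection d M N "turn N (N - w) D" by (rule cent[OF t0])
    show ?thesis using card_central_turns_turn[OF w(1)] t.card_central_turns F0_types[OF t0]
      by (simp add: t.E_def)
  qed
  ultimately have "card F * (d * c) = N * card F0" by simp
  hence "d * (card F * c) = d * (M * card F0)" unfolding N_eq by (simp only: ac_simps)
  hence FF0: "card F * c = M * card F0" using d2 by simp
  have "c * (card F * (fact (M - 1) * (\<Prod>i=1..n. fact (mu i div d))))
      = card F0 * (fact M * (\<Prod>i=1..n. fact (mu i div d)))"
  proof -
    have M: "fact M = M * (fact (M - 1) :: nat)" using M_pos by (simp add: fact_reduce)
    have "c * (card F * (fact (M - 1) * (\<Prod>i=1..n. fact (mu i div d))))
        = (card F * c) * (fact (M - 1) * (\<Prod>i=1..n. fact (mu i div d)))" by (simp only: ac_simps)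
    also have "\<dots> = card F0 * (fact M * (\<Prod>i=1..n. fact (mu i div d)))"
      unfolding FF0 M by (simp only: ac_simps)
    finally show ?thesis .
  qed
  also have "\<dots> = c * fact (M - 1 + (\<Sum>i=1..n. mu i div d))"
    using F0_eq M_pos by simp
  finally show "card F * (fact (M - 1) * (\<Prod>i=1..n. fact (mu i div d)))
      = fact (M - 1 + (\<Sum>i=1..n. mu i div d))" using cM(2) by simp
qed

section \<open>Values of q-factorials at roots of unity\<close>

lemma qint_0 [simp]: "qint 0 = 0"
  by (simp add: qint_def)

lemma qint_1 [simp]: "qint (Suc 0) = 1"
  by (simp add: qint_def)

lemma qint_Suc: "qint (Suc a) = qint a + monom 1 a"
  by (simp add: qint_def)

lemma qint_add: "qint (a + b) = qint a + monom 1 a * qint b"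
  by (induction b) (simp_all add: qint_Suc algebra_simps mult_monom)

lemma qint_geometric: "(monom 1 1 - 1) * qint a = monom 1 a - 1"
  by (induction a) (simp_all add: qint_Suc algebra_simps mult_monom monom_0 one_pCons)

lemma qfact_0 [simp]: "qfact 0 = 1"
  by (simp add: qfact_def)

lemma qfact_Suc: "qfact (Suc a) = qint (Suc a) * qfact a"
  by (simp add: qfact_def mult.commute)

lemma poly_qint_1: "poly (qint a) 1 = int a"
  by (simp add: qint_def poly_sum poly_monom)

lemma qint_nonzero: "0 < a \<Longrightarrow> qint a \<noteq> 0"
  using poly_qint_1[of a] by auto

lemma qfact_nonzero: "qfact a \<noteq> 0"
  by (simp add: qfact_def qint_nonzero)

text \<open>The splitting [a + b] = [a] + q^a [b] acts as a q-analogue of Pascal's rule, in the form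
  of divisibility.\<close>

lemma qfact_mult_dvd: "qfact a * qfact b dvd qfact (a + b)"
proof (induction "a + b" arbitrary: a b)
  case 0 thus ?case by simp
next
  case (Suc s)
  show ?case
  proof (cases "a = 0 \<or> b = 0")
    case True thus ?thesis by auto
  next
    case False
    then obtain a' b' where ab: "a = Suc a'" "b = Suc b'" by (metis not0_implies_Suc)
    have s: "s = a' + b" "s = a + b'" using Suc ab by simp_all
    have "qint a * (qfact a' * qfact b) dvd qint a * qfact s"
      and "qint b * (qfact a * qfact b') dvd qint b * qfact s" by (use Suc.hyps(1)[OF s(1)] Suc.hyps(1)[OF s(2)] s in \<open>simp_all add: mult_dvd_mono\<close>)
    hence 1: "qfact a * qfact b dvd qint a * qfact s" "qfact a * qfact b dvd qint b * qfact s"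
      by (simp_all add: ab qfact_Suc ac_simps)
    have "qfact (a + b) = qint a * qfact s + monom 1 a * (qint b * qfact s)"
      unfolding Suc(2)[symmetric] qfact_Suc unfolding Suc(2) qint_add by (simp add: algebra_simps)
    thus ?thesis using 1 by (simp add: dvd_add dvd_mult)
  qed
qed

lemma prod_qfact_dvd: "finite I \<Longrightarrow> (\<Prod>i\<in>I. qfact (m i)) dvd qfact (\<Sum>i\<in>I. m i)"
proof (induction I rule: finite_induct)
  case (insert x I)
  hence "qfact (m x) * (\<Prod>i\<in>I. qfact (m i)) dvd qfact (m x) * qfact (\<Sum>i\<in>I. m i)" by (simp add: mult_dvd_mono)
  also have "\<dots> dvd qfact (m x + (\<Sum>i\<in>I. m i))" by (rule qfact_mult_dvd)
  finally show ?case using insert by simp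
qed simp

text \<open>Since n + 1 and all i * mu i are indices g with Q dvd qint g * P, closure of these indices under
  addition and subtraction puts 1 = (n + 1) - n among them.\<close>

lemma qint_dvd_add:
  assumes "Q dvd qint a * P" "Q dvd qint b * P"
  shows "Q dvd qint (a + b) * P"
proof -
  have "qint (a + b) * P = qint a * P + monom 1 a * (qint b * P)" by (simp add: qint_add algebra_simps)
  thus ?thesis using assms by (simp add: dvd_add dvd_mult)
qed

text \<open>The power q^a cannot be cancelled, so [b] is written as q^a [b] - (q^a - 1) [b], where
  q^a - 1 is a multiple of [a].\<close>

lemma qint_dvd_diff:
  assumes "Q dvd qint a * P" "Q dvd qint (a + b) * P"
  shows "Q dvd qint b * P"
proof -
  have "qint b * P = monom 1 a * qint b * P - ((monom 1 1 - 1) * qint a) * qint b * P"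
    unfolding qint_geometric by (simp add: algebra_simps)
  also have "\<dots> = qint (a + b) * P - qint a * P - ((monom 1 1 - 1) * qint b) * (qint a * P)"
    by (simp add: qint_add algebra_simps)
  finally show ?thesis using assms by (metis dvd_diff dvd_mult)
qed

lemma qint_dvd_sum:
  assumes "\<And>i. i \<in> I \<Longrightarrow> Q dvd qint (f i) * P"
  shows "Q dvd qint (\<Sum>i\<in>I. f i) * P"
  using assms by (induction I rule: infinite_finite_induct) (auto intro: qint_dvd_add)

lemma qint_dvd_mult: "Q dvd qint a * P \<Longrightarrow> Q dvd qint (j * a) * P"
  by (induction j) (auto intro: qint_dvd_add)

lemma qfact_prod_dvd:
  assumes n: "n = (\<Sum>i=1..n. i * mu i)"
  shows "qfact (n + 1) * (\<Prod>i=1..n. qfact (mu i)) dvd qfact (n + (\<Sum>i=1..n. mu i))"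
proof -
  define k where "k = (\<Sum>i=1..n. mu i)"
  define Q where "Q = qfact (n + 1) * (\<Prod>i=1..n. qfact (mu i))"
  let ?P = "qfact (n + k)"
  \<comment> \<open>The parts n and all \<open>mu i\<close> add up to n + k; the extra factor
    [n + 1] on the right pays for replacing [n]! by [n + 1]!.\<close>
  have "qfact n * (\<Prod>i=1..n. qfact (mu i)) dvd qfact n * qfact k"
    unfolding k_def by (intro mult_dvd_mono prod_qfact_dvd) auto
  also have "\<dots> dvd ?P" by (rule qfact_mult_dvd)
  finally have 1: "Q dvd qint (n + 1) * ?P"
    unfolding Q_def by (simp add: qfact_Suc mult.assoc mult_dvd_mono)
  have 2: "Q dvd qint (i * mu i) * ?P" if i: "i \<in> {1..n}" for i
  proof (cases "mu i")
    case (Suc w)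
    define mu' where "mu' = mu(i := w)"
    have p: "(\<Prod>j=1..n. qfact (mu j)) = qint (mu i) * (\<Prod>j=1..n. qfact (mu' j))"
      using i by (simp add: prod.remove[of _ i] mu'_def Suc qfact_Suc mult.assoc)
    \<comment> \<open>Lowering one \<open>mu i\<close> by 1 makes room for n + 1 instead of n among
      the parts.\<close>
    have s: "n + k = (n + 1) + (\<Sum>j=1..n. mu' j)"
      using i by (simp add: sum.remove[of _ i] mu'_def Suc k_def)
    have "qfact (n + 1) * (\<Prod>j=1..n. qfact (mu' j)) dvd qfact (n + 1) * qfact (\<Sum>j=1..n. mu' j)"
      by (intro mult_dvd_mono prod_qfact_dvd) auto
    also have "\<dots> dvd ?P" unfolding s by (rule qfact_mult_dvd)
    finally have "qint (mu i) * (qfact (n + 1) * (\<Prod>j=1..n. qfact (mu' j))) dvd qint (mu i) * ?P"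
      by (simp only: mult_dvd_mono dvd_refl)
    hence "Q dvd qint (mu i) * ?P" unfolding Q_def p by (simp only: ac_simps)
    thus ?thesis by (rule qint_dvd_mult)
  qed simp
  have "Q dvd qint (\<Sum>i=1..n. i * mu i) * ?P" using 2 by (rule qint_dvd_sum)
  hence "Q dvd qint n * ?P" using n by simp
  from qint_dvd_diff[OF this 1] show ?thesis by (simp add: Q_def k_def)
qed

text \<open>The operation \<open>div\<close> represents a quotient only when the division is exact;
  this is established here for all three divisions behind \<open>a_mu\<close>. The second equation,
  free of division, is the one that gets evaluated.\<close>

lemma a_mu_eqs:
  assumes n: "n = (\<Sum>i=1..n. i * mu i)"
  defines "k \<equiv> \<Sum>i=1..n. mu i"
  shows "qint (n + 1) * a_mu n mu = qbinom (n + k) k * qmultinom k n mu"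
    and "qfact (n + 1) * (\<Prod>i=1..n. qfact (mu i)) * a_mu n mu = qfact (n + k)"
proof -
  define Z where "Z = (\<Prod>i=1..n. qfact (mu i))"
  have Z0: "Z \<noteq> 0" by (simp add: Z_def qfact_nonzero)
  obtain w where w: "qfact (n + k) = qfact (n + 1) * Z * w"
    using qfact_prod_dvd[OF n] unfolding k_def Z_def by (rule dvdE)
  have "Z dvd qfact k" unfolding Z_def k_def by (rule prod_qfact_dvd) simp
  then obtain y where y: "qfact k = Z * y" by (rule dvdE)
  have "qfact k * qfact n dvd qfact (n + k)" using qfact_mult_dvd[of k n] by (simp add: add.commute)
  then obtain x where x: "qfact (n + k) = qfact k * qfact n * x" by (rule dvdE)
  have "qmultinom k n mu = y" unfolding qmultinom_def Z_def[symmetric] y using Z0 by simp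
  moreover have "qbinom (n + k) k = x" unfolding qbinom_def using x qfact_nonzero by simp
  moreover have xy: "x * y = qint (n + 1) * w"
  proof -
    have "(Z * qfact n) * (x * y) = (Z * qfact n) * (qint (n + 1) * w)"
    proof -
      have "(Z * qfact n) * (x * y) = qfact (n + k)" unfolding x y by (simp only: ac_simps)
      also have "\<dots> = (Z * qfact n) * (qint (n + 1) * w)"
        unfolding w by (simp add: qfact_Suc ac_simps)
      finally show ?thesis .
    qed
    moreover have "Z * qfact n \<noteq> 0" using Z0 qfact_nonzero by simp
    ultimately show ?thesis using mult_left_cancel by blast
  qed
  ultimately have a: "a_mu n mu = w"
    unfolding a_mu_def Let_def k_def[symmetric] using qint_nonzero[of "n + 1"] by simp
  show "qint (n + 1) * a_mu n mu = qbinom (n + k) k * qmultinom k n mu"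
    using xy a \<open>qmultinom k n mu = y\<close> \<open>qbinom (n + k) k = x\<close> by simp
  show "qfact (n + 1) * (\<Prod>i=1..n. qfact (mu i)) * a_mu n mu = qfact (n + k)"
    using w a by (simp add: Z_def)
qed

section \<open>Integer polynomials at complex arguments\<close>

abbreviation eval_at :: "complex \<Rightarrow> int poly \<Rightarrow> complex" where
  "eval_at z p \<equiv> poly (map_poly of_int p) z"

lemma eval_at_mult: "eval_at z (p * q) = eval_at z p * eval_at z q"
proof -
  have "map_poly of_int (p * q) = (map_poly of_int p * map_poly of_int q :: complex poly)"
    by (intro poly_eqI) (simp add: coeff_map_poly coeff_mult)
  thus ?thesis by simp
qed

lemma eval_at_add: "eval_at z (p + q) = eval_at z p + eval_at z q"
proof -
  have "map_poly of_int (p + q) = (map_poly of_int p + map_poly of_int q :: complex poly)"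
    by (intro poly_eqI) (simp add: coeff_map_poly)
  thus ?thesis by simp
qed

lemma eval_at_1 [simp]: "eval_at z 1 = 1"
  by (simp add: map_poly_1)

lemma eval_at_monom: "eval_at z (monom 1 a) = z ^ a"
  by (simp add: map_poly_monom poly_monom)

lemma eval_at_prod: "eval_at z (\<Prod>i\<in>I. f i) = (\<Prod>i\<in>I. eval_at z (f i))"
  by (induction I rule: infinite_finite_induct) (simp_all add: eval_at_mult)

lemma eval_at_sum: "eval_at z (\<Sum>i\<in>I. f i) = (\<Sum>i\<in>I. eval_at z (f i))"
  by (induction I rule: infinite_finite_induct) (simp_all add: eval_at_add)

lemma eval_at_qint: "eval_at z (qint a) = (\<Sum>i<a. z ^ i)"
  by (simp add: qint_def eval_at_sum eval_at_monom)

lemma eval_qfact_at_1: "eval_at 1 (qfact a) = of_nat (fact a)"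
  by (induction a) (simp_all add: qfact_Suc eval_at_mult eval_at_qint algebra_simps)

text \<open>The factor qint d ^ (a div d) of qfact a, which vanishes at roots of unity of order d,
  is split off.\<close>

definition qfact_coprime_part :: "nat \<Rightarrow> nat \<Rightarrow> int poly" where
  "qfact_coprime_part d a = (\<Prod>j=1..a. if d dvd j then (\<Sum>i<j div d. monom 1 (d * i)) else qint j)"

lemma qint_mult: "qint (d * j) = qint d * (\<Sum>i<j. monom 1 (d * i))"
proof (induction j)
  case (Suc j)
  have "qint (d * Suc j) = qint (d * j) + monom 1 (d * j) * qint d"
    using qint_add[of "d * j" d] by (simp add: add.commute)
  thus ?case by (simp add: Suc algebra_simps)
qed simp

lemma qfact_factorization: "qfact a = qint d ^ (a div d) * qfact_coprime_part d a"
proof (induction a)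
  case 0 thus ?case by (simp add: qfact_coprime_part_def)
next
  case (Suc a)
  show ?case
  proof (cases "d dvd Suc a")
    case True
    then obtain j where j: "Suc a = d * j" by (rule dvdE)
    have "d \<noteq> 0" using j by (cases d) auto
    hence 1: "Suc a div d = j" unfolding j by simp
    have 2: "Suc a div d = Suc (a div d)" using True by (simp add: div_Suc dvd_eq_mod_eq_0)
    have "qfact_coprime_part d (Suc a) = (\<Sum>i<j. monom 1 (d * i)) * qfact_coprime_part d a"
      using True 1 by (simp add: qfact_coprime_part_def mult.commute)
    moreover have "qint (Suc a) = qint d * (\<Sum>i<j. monom 1 (d * i))"
      unfolding j qint_mult ..
    ultimately show ?thesis unfolding qfact_Suc Suc 2 by (simp add: ac_simps)
  next
    case False
    hence "Suc a div d = a div d" by (simp add: div_Suc dvd_eq_mod_eq_0)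
    thus ?thesis using Suc False by (simp add: qfact_Suc qfact_coprime_part_def ac_simps)
  qed
qed

section \<open>q-factorials at a root of unity of order d\<close>

context
  fixes z :: complex and d :: nat
  assumes d2: "2 \<le> d" and ord: "\<And>k. z ^ k = 1 \<longleftrightarrow> d dvd k"
begin

text \<open>The value of [r]! at z, nonzero for r < d.\<close>

definition qfact_small :: "nat \<Rightarrow> complex" where
  "qfact_small r = (\<Prod>j=1..r. \<Sum>i<j. z ^ i)"

lemma power_d: "z ^ d = 1"
  using ord by simp

lemma geometric_nonzero: "\<not> d dvd a \<Longrightarrow> (\<Sum>i<a. z ^ i) \<noteq> 0"
  using ord[of a] ord[of 1] d2 by (auto simp: sum_gp_strict split: if_splits)

lemma geometric_zero: "(\<Sum>i<d. z ^ i) = 0"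
  using ord[of 1] d2 power_d by (auto simp: sum_gp_strict)

lemma power_mod_d: "z ^ (a mod d) = z ^ a"
proof -
  have "z ^ a = z ^ (d * (a div d) + a mod d)" by simp
  thus ?thesis unfolding power_add power_mult power_d by simp
qed

lemma geometric_mod: "(\<Sum>i<a mod d. z ^ i) = (\<Sum>i<a. z ^ i)"
  using ord[of 1] d2 by (auto simp: sum_gp_strict power_mod_d)

lemma qfact_small_nonzero: "r < d \<Longrightarrow> qfact_small r \<noteq> 0"
  using geometric_nonzero by (auto simp: qfact_small_def dvd_imp_le nat_dvd_not_less)

text \<open>Since z^d = 1, the value of [j] depends only on j modulo d. So each full run of d
  indices contributes the value of [d - 1]! from those not divisible by d, and the index d j
  contributes a sum of j ones.\<close>

lemma eval_qfact_coprime_part: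
  "eval_at z (qfact_coprime_part d a)
    = of_nat (fact (a div d)) * qfact_small (d - 1) ^ (a div d) * qfact_small (a mod d)"
proof (induction a)
  case 0 thus ?case by (simp add: qfact_coprime_part_def qfact_small_def)
next
  case (Suc a)
  have step: "qfact_coprime_part d (Suc a) = qfact_coprime_part d a
      * (if d dvd Suc a then (\<Sum>i<Suc a div d. monom 1 (d * i)) else qint (Suc a))"
    by (simp add: qfact_coprime_part_def)
  show ?case
  proof (cases "d dvd Suc a")
    case True
    hence 1: "Suc a mod d = 0" "Suc a div d = Suc (a div d)" by (simp_all add: div_Suc dvd_eq_mod_eq_0)
    have 2: "a mod d = d - 1" using 1(1) d2 by (simp add: mod_Suc split: if_splits)
    have "eval_at z (\<Sum>i<Suc a div d. monom 1 (d * i)) = of_nat (Suc (a div d))"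
      unfolding eval_at_sum eval_at_monom power_mult power_d 1 by simp
    hence "eval_at z (qfact_coprime_part d (Suc a))
        = eval_at z (qfact_coprime_part d a) * of_nat (Suc (a div d))"
      using True by (simp only: step eval_at_mult if_True)
    thus ?thesis unfolding Suc 1 2 by (simp add: qfact_small_def algebra_simps)
  next
    case False
    hence 1: "Suc a mod d = Suc (a mod d)" "Suc a div d = a div d"
      by (auto simp: div_Suc dvd_eq_mod_eq_0 mod_Suc)
    have "eval_at z (qint (Suc a)) = (\<Sum>i<Suc (a mod d). z ^ i)"
      using geometric_mod[of "Suc a"] by (simp add: eval_at_qint 1)
    thus ?thesis using False Suc by (simp add: step eval_at_mult qfact_small_def 1)
  qed
qed

theorem eval_a_mu_root_of_unity:
  assumes n: "n = (\<Sum>i=1..n. i * mu i)" and dM: "n + 2 = d * M"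
  shows "2 \<le> (\<Sum>i=1..n. mu i mod d) \<Longrightarrow> eval_at z (a_mu n mu) = 0"
    and "(\<Sum>i=1..n. mu i mod d) \<le> 1 \<Longrightarrow>
      eval_at z (a_mu n mu) * of_nat (fact (M - 1) * (\<Prod>i=1..n. fact (mu i div d)))
       = of_nat (fact (M - 1 + (\<Sum>i=1..n. mu i div d)))"
proof -
  define k K r where "k = (\<Sum>i=1..n. mu i)" and "K = (\<Sum>i=1..n. mu i div d)"
    and "r = (\<Sum>i=1..n. mu i mod d)"
  have kK: "k = d * K + r"
    by (simp add: k_def K_def r_def sum_distrib_left sum.distrib[symmetric])
  obtain M' where M': "M = Suc M'" using dM by (cases M) auto
  have n1: "n + 1 = d * M' + (d - 1)" using dM d2 M' by simp
  have dm: "(d * q + s) div d = q" "(d * q + s) mod d = s" if "s < d" for q s using that by simp_all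
  have n1_div: "(n + 1) div d = M'" "(n + 1) mod d = d - 1" unfolding n1 using d2 by (intro dm; simp)+
  \<comment> \<open>The denominator carries [d] to the power M' + K. The term d - 2 + r reaches d,
    and gives the numerator at least one more factor [d], exactly when r \<ge> 2.\<close>
  have nk: "n + k = d * (M' + K) + (d - 2 + r)" using dM d2 M' kK by (simp add: algebra_simps)
  define A where "A = qfact_small (d - 1)"
  define RQ where "RQ = qfact_coprime_part d (n + 1) * (\<Prod>i=1..n. qfact_coprime_part d (mu i))"
  define RP where "RP = qfact_coprime_part d (n + k)"
  have "(\<Prod>i=1..n. qfact (mu i)) = qint d ^ K * (\<Prod>i=1..n. qfact_coprime_part d (mu i))"
    unfolding K_def power_sum prod.distrib[symmetric]
    by (rule prod.cong[OF refl]) (rule qfact_factorization)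
  hence Q: "qfact (n + 1) * (\<Prod>i=1..n. qfact (mu i)) = qint d ^ (M' + K) * RQ"
    unfolding RQ_def qfact_factorization[of "n + 1" d] n1_div by (simp add: power_add ac_simps)
  have P: "qfact (n + k) = qint d ^ ((n + k) div d) * RP"
    unfolding RP_def by (rule qfact_factorization)
  have eq: "qint d ^ (M' + K) * (RQ * a_mu n mu) = qint d ^ ((n + k) div d) * RP"
    using a_mu_eqs(2)[OF n] unfolding k_def[symmetric] Q P by (simp only: mult.assoc)
  have qd: "qint d \<noteq> 0" using qint_nonzero d2 by simp
  have A0: "A \<noteq> 0" unfolding A_def using d2 by (intro qfact_small_nonzero) simp
  have eRQ: "eval_at z RQ = of_nat (fact M' * (\<Prod>i=1..n. fact (mu i div d))) * A ^ (M' + K)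
      * A * (\<Prod>i=1..n. qfact_small (mu i mod d))"
    unfolding RQ_def eval_at_mult eval_at_prod eval_qfact_coprime_part n1_div A_def[symmetric] K_def
    by (simp add: prod.distrib power_sum power_add ac_simps)
  have "(\<Prod>i=1..n. qfact_small (mu i mod d)) \<noteq> 0"
    using qfact_small_nonzero d2 by simp
  hence eRQ0: "eval_at z RQ \<noteq> 0" unfolding eRQ using A0 by simp
  show "eval_at z (a_mu n mu) = 0" if "2 \<le> (\<Sum>i=1..n. mu i mod d)"
  proof -
    have r2: "2 \<le> r" using that by (simp add: r_def)
    have "d * (M' + K + 1) \<le> n + k" unfolding nk using r2 d2 by simp
    hence "M' + K + 1 \<le> (n + k) div d" using d2 by (simp add: less_eq_div_iff_mult_less_eq mult.commute)
    then obtain e where e: "(n + k) div d = M' + K + Suc e" by (metis Suc_eq_plus1 add.assoc add.commute le_iff_add)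
    have "qint d ^ (M' + K) * (RQ * a_mu n mu) = qint d ^ (M' + K) * (qint d ^ Suc e * RP)"
      using eq unfolding e by (simp only: power_add mult.assoc)
    hence "RQ * a_mu n mu = qint d ^ Suc e * RP" using qd by simp
    hence "eval_at z RQ * eval_at z (a_mu n mu) = eval_at z (qint d ^ Suc e * RP)"
      by (simp only: eval_at_mult[symmetric])
    also have "\<dots> = 0" by (simp add: eval_at_mult eval_at_qint geometric_zero)
    finally show ?thesis using eRQ0 by simp
  qed
  assume le1: "(\<Sum>i=1..n. mu i mod d) \<le> 1"
  hence r1: "r \<le> 1" by (simp add: r_def)
  have nk_div: "(n + k) div d = M' + K" unfolding nk using r1 d2 by (intro dm) simp
  have "RQ * a_mu n mu = RP" using eq qd unfolding nk_div by simp
  hence ev: "eval_at z RQ * eval_at z (a_mu n mu) = eval_at z RP" by (simp only: eval_at_mult[symmetric])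
  have small01: "qfact_small 0 = 1" "qfact_small 1 = 1" by (simp_all add: qfact_small_def)
  have "mu i mod d \<le> 1" if "i \<in> {1..n}" for i
    using member_le_sum[OF that, of "\<lambda>i. mu i mod d"] le1 by simp
  hence "qfact_small (mu i mod d) = 1" if "i \<in> {1..n}" for i
    using small01 that by (metis One_nat_def le_Suc_eq le_zero_eq)
  hence "(\<Prod>i=1..n. qfact_small (mu i mod d)) = 1" by simp
  \<comment> \<open>This has to match the factor A left over by [n + 1]!. For r = 1 the remainder is
    d - 1. For r = 0 it is d - 2, but then d divides both n and n + 2, so d = 2 and A = 1.\<close>
  moreover have "qfact_small ((n + k) mod d) = A"
  proof (cases "r = 1")
    case True
    hence "d - 2 + r = d - 1" using d2 by simp
    hence "(n + k) mod d = d - 1" unfolding nk using dm(2)[of "d - 1"] d2 by (simp only:)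
    thus ?thesis by (simp add: A_def)
  next
    case False
    hence r0: "r = 0" using r1 by simp
    hence "d dvd mu i" if "i \<in> {1..n}" for i using that by (auto simp: r_def)
    hence "d dvd (\<Sum>i=1..n. i * mu i)" by (intro dvd_sum) simp
    hence "d dvd n" using n by simp
    moreover have "d dvd n + 2" unfolding dM by simp
    ultimately have "d dvd 2" by (simp only: dvd_add_right_iff)
    hence "d = 2" using d2 by (simp add: dvd_imp_le order_antisym)
    thus ?thesis unfolding nk r0 using small01 by (simp add: A_def)
  qed
  ultimately have "of_nat (fact M' * (\<Prod>i=1..n. fact (mu i div d))) * A ^ (M' + K) * A * eval_at z (a_mu n mu)
      = of_nat (fact (M' + K)) * A ^ (M' + K) * A"
    using ev unfolding eRQ RP_def eval_qfact_coprime_part nk_div A_def[symmetric] by simp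
  hence "(A ^ (M' + K) * A) * (eval_at z (a_mu n mu) * of_nat (fact M' * (\<Prod>i=1..n. fact (mu i div d))))
      = (A ^ (M' + K) * A) * of_nat (fact (M' + K))" by (simp only: ac_simps)
  hence "eval_at z (a_mu n mu) * of_nat (fact M' * (\<Prod>i=1..n. fact (mu i div d))) = of_nat (fact (M' + K))"
    using A0 by simp
  thus "eval_at z (a_mu n mu) * of_nat (fact (M - 1) * (\<Prod>i=1..n. fact (mu i div d)))
       = of_nat (fact (M - 1 + (\<Sum>i=1..n. mu i div d)))"
    by (simp add: M' K_def)
qed

end

section \<open>Cyclic sieving\<close>

lemma cis_eq_1_iff: "cis x = 1 \<longleftrightarrow> (\<exists>m::int. x = of_int m * 2 * pi)"
proof
  assume "cis x = 1"
  hence "cos x = 1" by (metis cis.sel(1) one_complex.sel(1))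
  thus "\<exists>m::int. x = of_int m * 2 * pi" by (simp add: cos_one_2pi_int)
next
  assume "\<exists>m::int. x = of_int m * 2 * pi"
  then obtain m :: int where "x = 2 * pi * of_int m" by (auto simp: mult_ac)
  thus "cis x = 1" by simp
qed

text \<open>The order is written with the residue of -j, the number of steps of the corresponding
  \<open>turn\<close>; the sign does not change the gcd with N.\<close>

lemma root_of_unity_power_eq_1_iff:
  assumes N: "0 < N"
  shows "(cis (2 * pi / real N) powi j) ^ k = 1 \<longleftrightarrow> N div gcd (nat ((- j) mod int N)) N dvd k"
proof -
  define a where "a = nat ((- j) mod int N)"
  have a: "int a = (- j) mod int N" using N by (simp add: a_def)
  have "(cis (2 * pi / real N) powi j) ^ k = cis (of_int (j * int k) * (2 * pi / real N))"
    by (simp add: cis_power_int Complex.DeMoivre mult_ac)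
  hence "(cis (2 * pi / real N) powi j) ^ k = 1
      \<longleftrightarrow> (\<exists>m::int. of_int (j * int k) * (2 * pi / real N) = of_int m * 2 * pi)"
    by (simp only: cis_eq_1_iff)
  also have "\<dots> \<longleftrightarrow> (\<exists>m::int. j * int k = m * int N)"
  proof -
    have "of_int (j * int k) * (2 * pi / real N) = of_int m * 2 * pi \<longleftrightarrow> j * int k = m * int N" for m :: int
    proof -
      have "of_int (j * int k) * (2 * pi / real N) = of_int m * 2 * pi
          \<longleftrightarrow> (of_int (j * int k) :: real) = of_int m * real N"
        using N by (simp add: field_simps)
      also have "\<dots> \<longleftrightarrow> (of_int (j * int k) :: real) = of_int (m * int N)" by simp
      finally show ?thesis by (simp only: of_int_eq_iff)
    qed
    thus ?thesis by simp
  qed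
  also have "\<dots> \<longleftrightarrow> int N dvd j * int k" by (auto simp: dvd_def mult.commute)
  also have "\<dots> \<longleftrightarrow> (- j * int k) mod int N = 0" by (simp add: dvd_eq_mod_eq_0[symmetric])
  also have "\<dots> \<longleftrightarrow> (int a * int k) mod int N = 0" unfolding a by (simp add: mod_mult_left_eq)
  also have "\<dots> \<longleftrightarrow> N dvd a * k"
    by (metis dvd_eq_mod_eq_0 int_dvd_int_iff of_nat_mult)
  also have "\<dots> \<longleftrightarrow> N div gcd a N dvd k"
  proof -
    define g where "g = gcd a N"
    have g: "0 < g" "N = g * (N div g)" "a = g * (a div g)" using N by (simp_all add: g_def)
    have "coprime (N div g) (a div g)"
      using N div_gcd_coprime[of a N] by (simp add: g_def coprime_commute)
    moreover have "N dvd a * k \<longleftrightarrow> g * (N div g) dvd g * (a div g * k)"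
      using g by (metis mult.assoc)
    ultimately show ?thesis using g(1) by (simp add: coprime_dvd_mult_right_iff g_def[symmetric])
  qed
  finally show ?thesis unfolding a_def .
qed

text \<open>By Bezout the gcd is a multiple of a modulo N. Any rotation may thus be replaced by the
  turn through a divisor M of N, and N / M is the order of the root of unity.\<close>

lemma turn_fixed_gcd:
  assumes D: "dissection N D" and N: "0 < N"
  shows "turn N a D = D \<longleftrightarrow> turn N (gcd a N) D = D"
proof
  assume fixed: "turn N a D = D"
  show "turn N (gcd a N) D = D"
  proof (cases "a = 0")
    case True thus ?thesis using turn_multiple[OF D, of N] by simp
  next
    case False
    then obtain x y where "a * x = N * y + gcd a N" using bezout_nat by blast
    hence "gcd a N mod N = (x * a) mod N" by (simp add: mult.commute)
    thus ?thesis using turn_fixed_mult[OF D fixed, of x] turn_cong by metis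
  qed
next
  assume "turn N (gcd a N) D = D"
  from turn_fixed_mult[OF D this, of "a div gcd a N"] show "turn N a D = D" by simp
qed

text \<open>P_2 has no diagonals, and the size conditions range over an empty set.\<close>

lemma A_mu_0: "A_mu 0 mu = {{}}"
proof -
  have "\<not> is_diagonal 2 e" for e
    by (auto simp: is_diagonal_def side_def less_2_cases_iff)
  hence "dissection 2 D \<longleftrightarrow> D = {}" for D by (auto simp: dissection_def)
  thus ?thesis by (auto simp: A_mu_def numeral_2_eq_2)
qed

theorem theorem2p3:
  fixes n :: nat and mu :: "nat \<Rightarrow> nat"
  assumes "n = (\<Sum>i=1..n. i * mu i)"
  shows "qint (n + 1) * a_mu n mu = qbinom (n + (\<Sum>i=1..n. mu i)) (\<Sum>i=1..n. mu i) * qmultinom (\<Sum>i=1..n. mu i) n mu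
     \<and> cyclic_sieving (n + 2) (A_mu n mu) (a_mu n mu)"
proof
  show "qint (n + 1) * a_mu n mu = qbinom (n + (\<Sum>i=1..n. mu i)) (\<Sum>i=1..n. mu i) * qmultinom (\<Sum>i=1..n. mu i) n mu"
    by (rule a_mu_eqs(1)[OF assms])
  show "cyclic_sieving (n + 2) (A_mu n mu) (a_mu n mu)"
    unfolding cyclic_sieving_def
  proof
    fix j :: int
    define N where "N = n + 2"
    define z where "z = cis (2 * pi / real N) powi j"
    define M where "M = gcd (nat ((- j) mod int N)) N"
    define d where "d = N div M"
    have N0: "0 < N" by (simp add: N_def)
    have ord: "z ^ k = 1 \<longleftrightarrow> d dvd k" for k
      unfolding z_def d_def M_def by (rule root_of_unity_power_eq_1_iff[OF N0])
    have NdM: "n + 2 = d * M" unfolding N_def[symmetric] by (simp add: d_def M_def)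
    have "d \<noteq> 0" using NdM by (cases d) auto
    have fixed: "{D \<in> A_mu n mu. rot_dissection N j D = D} = {D \<in> A_mu n mu. turn N M D = D}"
      using turn_fixed_gcd[OF _ N0] unfolding rot_dissection_eq_turn[OF N0] M_def
      by (auto simp: A_mu_def N_def)
    have "eval_at z (a_mu n mu) = of_nat (card {D \<in> A_mu n mu. turn N M D = D})"
    proof (cases "d = 1")
      case True
      \<comment> \<open>The trivial rotation singles out no centre, so the total count is compared
        with the value at 1.\<close>
      have z1: "z = 1" using ord[of 1] True by simp
      have "turn N M D = D" if "D \<in> A_mu n mu" for D
        using that turn_multiple[of N D N] NdM True by (simp add: A_mu_def N_def)
      hence all: "{D \<in> A_mu n mu. turn N M D = D} = A_mu n mu" by blast
      have ev: "of_nat (fact (n + 1) * (\<Prod>i=1..n. fact (mu i))) * eval_at z (a_mu n mu)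
          = of_nat (fact (n + (\<Sum>i=1..n. mu i)))"
      proof -
        have "eval_at z (qfact (n + 1) * (\<Prod>i=1..n. qfact (mu i)) * a_mu n mu)
            = eval_at z (qfact (n + (\<Sum>i=1..n. mu i)))"
          by (simp only: a_mu_eqs(2)[OF assms])
        thus ?thesis
          unfolding eval_at_mult eval_at_prod z1 eval_qfact_at_1 by (simp only: of_nat_mult of_nat_prod)
      qed
      have "card (A_mu n mu) * (fact (n + 1) * (\<Prod>i=1..n. fact (mu i))) = fact (n + (\<Sum>i=1..n. mu i))"
      proof (cases "n = 0")
        case True
        thus ?thesis using A_mu_0 by simp
      next
        case False
        thus ?thesis using assms by (intro card_A_mu) auto
      qed
      hence "of_nat (fact (n + 1) * (\<Prod>i=1..n. fact (mu i))) * (of_nat (card (A_mu n mu)) :: complex)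
          = of_nat (fact (n + (\<Sum>i=1..n. mu i)))"
        by (simp only: of_nat_mult[symmetric] mult.commute)
      hence "of_nat (fact (n + 1) * (\<Prod>i=1..n. fact (mu i))) * eval_at z (a_mu n mu)
          = of_nat (fact (n + 1) * (\<Prod>i=1..n. fact (mu i))) * of_nat (card (A_mu n mu))"
        using ev by simp
      moreover have "of_nat (fact (n + 1) * (\<Prod>i=1..n. fact (mu i))) \<noteq> (0::complex)"
        unfolding of_nat_eq_0_iff by simp
      ultimately show ?thesis unfolding all using mult_left_cancel by blast
    next
      case False
      hence d2: "2 \<le> d" using \<open>d \<noteq> 0\<close> by simp
      note ev = eval_a_mu_root_of_unity[OF d2 ord assms NdM]
      show ?thesis
      proof (cases "n = 0")
        case True
        \<comment> \<open>The counting results assume n \<ge> 1, where the root arc spans at least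
          two steps; P_2 is checked directly.\<close>
        hence "{D \<in> A_mu n mu. turn N M D = D} = {{}}" by (auto simp: A_mu_0 turn_def)
        moreover have "a_mu n mu = 1" using a_mu_eqs(2)[OF assms] True by (simp add: qfact_def)
        ultimately show ?thesis by simp
      next
        case n0: False
        hence n1: "1 \<le> n" by simp
        note cd = card_fixed_A_mu[OF assms n1 NdM d2]
        show ?thesis
        proof (cases "2 \<le> (\<Sum>i=1..n. mu i mod d)")
          case True
          thus ?thesis using ev(1) cd(1) by (simp add: N_def)
        next
          case False
          hence le1: "(\<Sum>i=1..n. mu i mod d) \<le> 1" by simp
          let ?c = "fact (M - 1) * (\<Prod>i=1..n. fact (mu i div d)) :: nat"
          have "eval_at z (a_mu n mu) * of_nat ?c
              = of_nat (card {D \<in> A_mu n mu. turn N M D = D} * ?c)"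
            unfolding ev(2)[OF le1] N_def cd(2)[OF le1] ..
          moreover have "of_nat ?c \<noteq> (0::complex)" unfolding of_nat_eq_0_iff by simp
          ultimately show ?thesis unfolding of_nat_mult using mult_right_cancel by blast
        qed
      qed
    qed
    thus "eval_at (cis (2 * pi / real (n + 2)) powi j) (a_mu n mu)
        = of_nat (card {D \<in> A_mu n mu. rot_dissection (n + 2) j D = D})"
      using fixed by (simp add: z_def N_def)
  qed
qed

end
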